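(* Let $G$ be any partially ordered group, $\mathsf V$ any variety of $\ell$-groups, and $H=F_{\mathsf V}(G)$ the free $\ell$-group over $G$ in $\mathsf V$. The minimal layer of $\mathscr{P}_{\mathsf V}(G)$ (the subspace of its inclusion-minimal elements) is compact if, and only if, any one of the following equivalent conditions holds: (1) $\mathrm{Pol}_{\mathrm p}H$ is a Boolean subalgebra of $\mathrm{Pol}\,H$; (2) $\mathrm{Min}\,H$ is compact; (3) $H^+$ is complemented: for every $x\in H^+$ there is $y\in H^+$ such that $x\wedge y=\mathrm{e}$ and $x\vee y$ is a weak unit of $H$.
   Context: A partially ordered group is a group $G$ (identity $\mathrm{e}$) with a partial order such that $a\le b$ implies $sat\le sbt$; $G^+=\{a\mid a\ge \mathrm{e}\}$. An $\ell$-group is a partially ordered group whose order is a lattice; an $\ell$-subgroup is a sublattice subgroup; a variety of $\ell$-groups is an equationally definable class. "Compact" does not include Hausdorff. A right pre-order on $G$ is a reflexive, transitive, total relation $\preceq$ on $G$, with $\preceq\ne G\times G$, extending the partial order of $G$ and such that $a\preceq b\Rightarrow at\preceq bt$. It is identified with its pre-cone $C=\{a\mid \mathrm{e}\preceq a\}$; $a\preceq_C b$ iff $ba^{-1}\in C$. Put $a\equiv_C b$ iff $a\preceq_C b$ and $b\preceq_C a$; $\Omega_C=G/{\equiv_C}$ is a chain with $[a]\le_C[b]$ iff $a\preceq_C b$. $\mathrm{Aut}\,\Omega_C$ is the $\ell$-group of order-preserving bijections of $\Omega_C$, where $f\cdot g$ means "$g$ after $f$" and lattice operations are pointwise. With $R_C(a)\colon[b]\mapsto[ba]$,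 $H_C$ is the $\ell$-subgroup of $\mathrm{Aut}\,\Omega_C$ generated by $R_C[G]$. $\mathscr{P}_{\mathsf V}(G)$ is the set of right pre-orders (pre-cones) $C$ on $G$ with $H_C\in\mathsf V$, ordered by inclusion, with the smallest topology containing all sets $\{C\in\mathscr{P}_{\mathsf V}(G)\mid a\in C,\ a^{-1}\notin C\}$, $a\in G$. $F_{\mathsf V}(G)$, with order-preserving group homomorphism $\eta\colon G\to F_{\mathsf V}(G)$, is the free $\ell$-group over $G$ in $\mathsf V$: $F_{\mathsf V}(G)\in\mathsf V$ and for each order-preserving group homomorphism $p\colon G\to K$ with $K\in\mathsf V$ there is exactly one group and lattice homomorphism $h\colon F_{\mathsf V}(G)\to K$ with $h\circ\eta=p$. For an $\ell$-group $H$: a convex $\ell$-subgroup is an order-convex sublattice subgroup $\mathfrak k$; cosets are ordered by $\mathfrak kx\le\mathfrak ky$ iff $x\le ty$ for some $t\in\mathfrak k$; $\mathfrak k$ is prime if proper with $H/\mathfrak k$ totally ordered. $\mathrm{Spec}\,H$ is the set of prime subgroups with open sets $\{\mathfrak p\mid A\not\subseteq\mathfrak p\}$, $A\subseteq H$, and $\mathrm{Min}\,H$ is the subspace of inclusion-minimal ones. $|x|=x\vee x^{-1}$; for $S\subseteq H$, $S^\perp=\{x\in H\mid |x|\wedge|y|=\mathrm{e}\text{ for all }y\in S\}$. A polar is a set $T$ with $T=T^{\perp\perp}$; the set $\mathrm{Pol}\,H$ of polars under inclusion is a complete Boolean algebra with top $H$, bottom $\{\mathrm{e}\}$, meet intersection,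 join $(\bigcup T_i)^{\perp\perp}$, and complement $T\mapsto T^\perp$. $\mathrm{Pol}_{\mathrm p}H=\{x^{\perp\perp}\mid x\in H\}$ is its sublattice of principal polars. A weak unit is $w\in H^+$ such that $w\wedge|x|=\mathrm{e}$ implies $x=\mathrm{e}$. *)

theory Defs
  imports "HOL-Analysis.Abstract_Topology" "HOL-Algebra.Bij" "HOL-Algebra.Coset"
    "HOL-Algebra.Lattice"
begin

section \<open>Partially ordered groups and lattice-ordered groups\<close>

record 'a ordered_group = "'a monoid" +
  leq :: "'a \<Rightarrow> 'a \<Rightarrow> bool" (infixl \<open>\<preceq>\<index>\<close> 50)

definition order_of :: "('a, 'm) ordered_group_scheme \<Rightarrow> 'a gorder" where
  "order_of G = \<lparr>carrier = carrier G, eq = (=), le = leq G\<rparr>"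

lemma order_of_simps [simp]:
  "carrier (order_of G) = carrier G" "eq (order_of G) = (=)" "le (order_of G) = leq G"
  by (simp_all add: order_of_def)

locale po_group = group G for G :: "('a, 'm) ordered_group_scheme" (structure) +
  assumes po: "partial_order (order_of G)"
    and translation: "\<lbrakk>a \<in> carrier G; b \<in> carrier G; s \<in> carrier G; t \<in> carrier G; a \<preceq> b\<rbrakk>
      \<Longrightarrow> s \<otimes> a \<otimes> t \<preceq> s \<otimes> b \<otimes> t"

locale l_group = po_group +
  assumes lattice: "lattice (order_of G)"

abbreviation gjoin :: "('a, 'm) ordered_group_scheme \<Rightarrow> 'a \<Rightarrow> 'a \<Rightarrow> 'a" where
  "gjoin G x y \<equiv> x \<squnion>\<^bsub>order_of G\<^esub> y"

abbreviation gmeet :: "('a, 'm) ordered_group_scheme \<Rightarrow> 'a \<Rightarrow> 'a \<Rightarrow> 'a" where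
  "gmeet G x y \<equiv> x \<sqinter>\<^bsub>order_of G\<^esub> y"

definition positive_cone :: "('a, 'm) ordered_group_scheme \<Rightarrow> 'a set" where
  "positive_cone G = {a \<in> carrier G. \<one>\<^bsub>G\<^esub> \<preceq>\<^bsub>G\<^esub> a}"

definition po_hom ::
  "('a, 'm) ordered_group_scheme \<Rightarrow> ('b, 'n) ordered_group_scheme \<Rightarrow> ('a \<Rightarrow> 'b) set" where
  "po_hom G K = {p \<in> hom G K. \<forall>a\<in>carrier G. \<forall>b\<in>carrier G. a \<preceq>\<^bsub>G\<^esub> b \<longrightarrow> p a \<preceq>\<^bsub>K\<^esub> p b}"

definition l_hom ::
  "('a, 'm) ordered_group_scheme \<Rightarrow> ('b, 'n) ordered_group_scheme \<Rightarrow> ('a \<Rightarrow> 'b) set" where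
  "l_hom H K = {h \<in> hom H K. \<forall>x\<in>carrier H. \<forall>y\<in>carrier H.
     h (gjoin H x y) = gjoin K (h x) (h y) \<and> h (gmeet H x y) = gmeet K (h x) (h y)}"

definition l_subgroup :: "'a set \<Rightarrow> ('a, 'm) ordered_group_scheme \<Rightarrow> bool" where
  "l_subgroup S H \<longleftrightarrow> subgroup S H \<and> (\<forall>x\<in>S. \<forall>y\<in>S. gjoin H x y \<in> S \<and> gmeet H x y \<in> S)"

definition l_subgroup_generated ::
  "('a, 'm) ordered_group_scheme \<Rightarrow> 'a set \<Rightarrow> 'a set" where
  "l_subgroup_generated H A = \<Inter> {S. l_subgroup S H \<and> A \<subseteq> S}"


section \<open>Varieties\<close>

datatype (lvars: 'v) lterm =
    LVar 'v
  | LOne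
  | LMult "'v lterm" "'v lterm"
  | LInv "'v lterm"
  | LJoin "'v lterm" "'v lterm"
  | LMeet "'v lterm" "'v lterm"

primrec leval :: "('a, 'm) ordered_group_scheme \<Rightarrow> ('v \<Rightarrow> 'a) \<Rightarrow> 'v lterm \<Rightarrow> 'a" where
  "leval G e (LVar v) = e v"
| "leval G e LOne = \<one>\<^bsub>G\<^esub>"
| "leval G e (LMult s t) = leval G e s \<otimes>\<^bsub>G\<^esub> leval G e t"
| "leval G e (LInv s) = inv\<^bsub>G\<^esub> (leval G e s)"
| "leval G e (LJoin s t) = gjoin G (leval G e s) (leval G e t)"
| "leval G e (LMeet s t) = gmeet G (leval G e s) (leval G e t)"

text \<open>A variety is a class of \<open>\<ell>\<close>-groups, spread over all types, so it is represented by a set of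
  defining equations. Every equation is finitary, so countably many variables suffice.\<close>

type_synonym variety = "(nat lterm \<times> nat lterm) set"

definition in_variety :: "('a, 'm) ordered_group_scheme \<Rightarrow> variety \<Rightarrow> bool" where
  "in_variety K V \<longleftrightarrow> l_group K \<and>
     (\<forall>(s, t)\<in>V. \<forall>e. range e \<subseteq> carrier K \<longrightarrow> leval K e s = leval K e t)"


section \<open>The free \<open>\<ell>\<close>-group over a partially ordered group\<close>

definition unique_extension ::
  "('g, 'm) ordered_group_scheme \<Rightarrow> ('h, 'n) ordered_group_scheme \<Rightarrow> ('g \<Rightarrow> 'h) \<Rightarrow>
   ('k, 'l) ordered_group_scheme \<Rightarrow> bool" where
  "unique_extension G H \<eta> K \<longleftrightarrow>
     (\<forall>p\<in>po_hom G K. \<exists>!h. h \<in> extensional (carrier H) \<and> h \<in> l_hom H K \<and>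
        (\<forall>a\<in>carrier G. h (\<eta> a) = p a))"

text \<open>The universal property refers to \<open>\<ell>\<close>-groups \<open>K\<close> on arbitrary types, which a single formula
  cannot quantify over. It is stated for the \<open>K\<close> carried by a subset of \<open>'h\<close> or of \<open>'g lterm set\<close>.
  This is no restriction: the theorem \<open>free_l_groupD\<close> below derives it for all \<open>K\<close> on any type.
  (The second clause suffices for existence of extensions, as an \<open>\<ell>\<close>-group generated by an image of
  \<open>G\<close> has a copy on a set of sets of terms; the first one yields uniqueness.)\<close>

definition free_l_group ::
  "variety \<Rightarrow> 'g ordered_group \<Rightarrow> 'h ordered_group \<Rightarrow> ('g \<Rightarrow> 'h) \<Rightarrow> bool" where
  "free_l_group V G H \<eta> \<longleftrightarrow> in_variety H V \<and> \<eta> \<in> po_hom G H \<and>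
     (\<forall>K :: 'h ordered_group. in_variety K V \<longrightarrow> unique_extension G H \<eta> K) \<and>
     (\<forall>K :: 'g lterm set ordered_group. in_variety K V \<longrightarrow> unique_extension G H \<eta> K)"

lemma (in l_group) lattice_facts:
  shows order_refl: "x \<in> carrier G \<Longrightarrow> x \<preceq> x"
    and order_antisym: "\<lbrakk>x \<preceq> y; y \<preceq> x; x \<in> carrier G; y \<in> carrier G\<rbrakk> \<Longrightarrow> x = y"
    and order_trans: "\<lbrakk>x \<preceq> y; y \<preceq> z; x \<in> carrier G; y \<in> carrier G; z \<in> carrier G\<rbrakk> \<Longrightarrow> x \<preceq> z"
    and gjoin_closed: "\<lbrakk>x \<in> carrier G; y \<in> carrier G\<rbrakk> \<Longrightarrow> gjoin G x y \<in> carrier G"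
    and gmeet_closed: "\<lbrakk>x \<in> carrier G; y \<in> carrier G\<rbrakk> \<Longrightarrow> gmeet G x y \<in> carrier G"
    and gjoin_left: "\<lbrakk>x \<in> carrier G; y \<in> carrier G\<rbrakk> \<Longrightarrow> x \<preceq> gjoin G x y"
    and gjoin_right: "\<lbrakk>x \<in> carrier G; y \<in> carrier G\<rbrakk> \<Longrightarrow> y \<preceq> gjoin G x y"
    and gjoin_least: "\<lbrakk>x \<preceq> z; y \<preceq> z; x \<in> carrier G; y \<in> carrier G; z \<in> carrier G\<rbrakk>
      \<Longrightarrow> gjoin G x y \<preceq> z"
    and gmeet_left: "\<lbrakk>x \<in> carrier G; y \<in> carrier G\<rbrakk> \<Longrightarrow> gmeet G x y \<preceq> x"
    and gmeet_right: "\<lbrakk>x \<in> carrier G; y \<in> carrier G\<rbrakk> \<Longrightarrow> gmeet G x y \<preceq> y"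
    and gmeet_greatest: "\<lbrakk>z \<preceq> x; z \<preceq> y; x \<in> carrier G; y \<in> carrier G; z \<in> carrier G\<rbrakk>
      \<Longrightarrow> z \<preceq> gmeet G x y"
proof -
  interpret L: lattice "order_of G" by (rule lattice)
  show "x \<in> carrier G \<Longrightarrow> x \<preceq> x" using L.le_refl by simp
  show "\<lbrakk>x \<preceq> y; y \<preceq> x; x \<in> carrier G; y \<in> carrier G\<rbrakk> \<Longrightarrow> x = y"
    using L.le_antisym by simp
  show "\<lbrakk>x \<preceq> y; y \<preceq> z; x \<in> carrier G; y \<in> carrier G; z \<in> carrier G\<rbrakk> \<Longrightarrow> x \<preceq> z"
    using L.le_trans[of x y z] by simp
  show "\<lbrakk>x \<in> carrier G; y \<in> carrier G\<rbrakk> \<Longrightarrow> gjoin G x y \<in> carrier G"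
    using L.join_closed by simp
  show "\<lbrakk>x \<in> carrier G; y \<in> carrier G\<rbrakk> \<Longrightarrow> gmeet G x y \<in> carrier G"
    using L.meet_closed by simp
  show "\<lbrakk>x \<in> carrier G; y \<in> carrier G\<rbrakk> \<Longrightarrow> x \<preceq> gjoin G x y"
    using L.join_left by simp
  show "\<lbrakk>x \<in> carrier G; y \<in> carrier G\<rbrakk> \<Longrightarrow> y \<preceq> gjoin G x y"
    using L.join_right by simp
  show "\<lbrakk>x \<preceq> z; y \<preceq> z; x \<in> carrier G; y \<in> carrier G; z \<in> carrier G\<rbrakk> \<Longrightarrow> gjoin G x y \<preceq> z"
    using L.join_le[of x z y] by simp
  show "\<lbrakk>x \<in> carrier G; y \<in> carrier G\<rbrakk> \<Longrightarrow> gmeet G x y \<preceq> x"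
    using L.meet_left by simp
  show "\<lbrakk>x \<in> carrier G; y \<in> carrier G\<rbrakk> \<Longrightarrow> gmeet G x y \<preceq> y"
    using L.meet_right by simp
  show "\<lbrakk>z \<preceq> x; z \<preceq> y; x \<in> carrier G; y \<in> carrier G; z \<in> carrier G\<rbrakk> \<Longrightarrow> z \<preceq> gmeet G x y"
    using L.meet_le[of z x y] by simp
qed

lemma (in l_group) gjoin_eqI:
  assumes "x \<in> carrier G" "y \<in> carrier G" "s \<in> carrier G" "x \<preceq> s" "y \<preceq> s"
    and "\<And>z. \<lbrakk>z \<in> carrier G; x \<preceq> z; y \<preceq> z\<rbrakk> \<Longrightarrow> s \<preceq> z"
  shows "gjoin G x y = s"
  using assms by (metis gjoin_closed gjoin_least gjoin_left gjoin_right order_antisym)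

lemma (in l_group) gmeet_eqI:
  assumes "x \<in> carrier G" "y \<in> carrier G" "s \<in> carrier G" "s \<preceq> x" "s \<preceq> y"
    and "\<And>z. \<lbrakk>z \<in> carrier G; z \<preceq> x; z \<preceq> y\<rbrakk> \<Longrightarrow> z \<preceq> s"
  shows "gmeet G x y = s"
  using assms by (metis gmeet_closed gmeet_greatest gmeet_left gmeet_right order_antisym)

lemma (in l_group) leval_closed:
  "e ` lvars t \<subseteq> carrier G \<Longrightarrow> leval G e t \<in> carrier G"
  by (induction t) (auto simp: image_Un gjoin_closed gmeet_closed)

lemma leval_cong: "(\<And>v. v \<in> lvars t \<Longrightarrow> e v = e' v) \<Longrightarrow> leval G e t = leval G e' t"
  by (induction t) auto

lemma l_hom_leval:
  assumes "l_group H" "l_group K" "h \<in> l_hom H K" "e ` lvars t \<subseteq> carrier H"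
  shows "h (leval H e t) = leval K (h \<circ> e) t"
proof -
  interpret H: l_group H by fact
  interpret K: l_group K by fact
  interpret group_hom H K h
    using assms(3) by unfold_locales (simp add: l_hom_def)
  have join: "h (gjoin H x y) = gjoin K (h x) (h y)"
    and meet: "h (gmeet H x y) = gmeet K (h x) (h y)"
    if "x \<in> carrier H" "y \<in> carrier H" for x y
    using assms(3) that by (auto simp: l_hom_def)
  show ?thesis
    using assms(4)
    by (induction t) (auto simp: image_Un join meet H.leval_closed)
qed

lemma l_hom_comp:
  assumes "h \<in> l_hom H K" "k \<in> l_hom K L"
  shows "k \<circ> h \<in> l_hom H L"
proof -
  have "h x \<in> carrier K" if "x \<in> carrier H" for x
    using assms(1) that by (auto simp: l_hom_def hom_def)
  then show ?thesis
    using assms by (auto simp: l_hom_def hom_def Pi_def)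
qed

lemma l_hom_restrict:
  assumes "l_group H" "h \<in> l_hom H K"
  shows "restrict h (carrier H) \<in> l_hom H K"
proof -
  interpret l_group H by fact
  show ?thesis
    using assms(2) by (auto simp: l_hom_def hom_def Pi_def gjoin_closed gmeet_closed)
qed

text \<open>Transport of an \<open>\<ell>\<close>-subgroup of \<open>K\<close> along an injection into another type.\<close>

lemma transport:
  fixes K :: "('k, 'l) ordered_group_scheme" and \<phi> :: "'k \<Rightarrow> 'b"
  assumes K: "in_variety K V" and S: "l_subgroup S K" and inj: "inj_on \<phi> S"
  obtains K' :: "'b ordered_group" and \<psi> where
    "in_variety K' V" "carrier K' = \<phi> ` S" "\<psi> \<in> l_hom K' K" "\<And>x. x \<in> S \<Longrightarrow> \<psi> (\<phi> x) = x"
    "\<And>p G. p \<in> po_hom G K \<Longrightarrow> p ` carrier G \<subseteq> S \<Longrightarrow> \<phi> \<circ> p \<in> po_hom G K'"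
proof -
  define \<psi> where "\<psi> = inv_into S \<phi>"
  interpret K: l_group K using K by (simp add: in_variety_def)
  interpret S: subgroup S K using S by (simp add: l_subgroup_def)
  have S_join: "gjoin K x y \<in> S" and S_meet: "gmeet K x y \<in> S" if "x \<in> S" "y \<in> S" for x y
    using S that by (auto simp: l_subgroup_def)
  have psi: "\<psi> (\<phi> x) = x" if "x \<in> S" for x
    using inj that by (simp add: \<psi>_def)
  have SK: "x \<in> carrier K" if "x \<in> S" for x using that S.subset by auto
  define K' :: "'b ordered_group" where
    "K' = \<lparr>carrier = \<phi> ` S, mult = (\<lambda>X Y. \<phi> (\<psi> X \<otimes>\<^bsub>K\<^esub> \<psi> Y)), one = \<phi> \<one>\<^bsub>K\<^esub>,
      leq = (\<lambda>X Y. \<psi> X \<preceq>\<^bsub>K\<^esub> \<psi> Y)\<rparr>"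
  have K'_simps [simp]: "carrier K' = \<phi> ` S" "X \<otimes>\<^bsub>K'\<^esub> Y = \<phi> (\<psi> X \<otimes>\<^bsub>K\<^esub> \<psi> Y)"
    "\<one>\<^bsub>K'\<^esub> = \<phi> \<one>\<^bsub>K\<^esub>" "X \<preceq>\<^bsub>K'\<^esub> Y \<longleftrightarrow> \<psi> X \<preceq>\<^bsub>K\<^esub> \<psi> Y" for X Y
    by (simp_all add: K'_def)
  have grp: "group K'"
  proof (rule groupI)
    show "\<exists>Y\<in>carrier K'. Y \<otimes>\<^bsub>K'\<^esub> X = \<one>\<^bsub>K'\<^esub>" if "X \<in> carrier K'" for X
    proof -
      obtain x where x: "x \<in> S" "X = \<phi> x" using \<open>X \<in> carrier K'\<close> by auto
      then show ?thesis
        by (intro bexI[of _ "\<phi> (inv\<^bsub>K\<^esub> x)"]) (auto simp: psi SK)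
    qed
  qed (auto simp: psi K.m_assoc SK)
  have po: "partial_order (order_of K')"
  proof unfold_locales
    fix X Y Z
    assume "X \<in> carrier (order_of K')" "Y \<in> carrier (order_of K')" "Z \<in> carrier (order_of K')"
    then obtain x y z where xyz: "x \<in> S" "y \<in> S" "z \<in> S" "X = \<phi> x" "Y = \<phi> y" "Z = \<phi> z"
      by auto
    show "X \<sqsubseteq>\<^bsub>order_of K'\<^esub> Z"
      if "X \<sqsubseteq>\<^bsub>order_of K'\<^esub> Y" "Y \<sqsubseteq>\<^bsub>order_of K'\<^esub> Z"
      using that xyz K.order_trans[of x y z] by (simp add: psi SK)
  next
    fix X Y
    assume "X \<in> carrier (order_of K')" "Y \<in> carrier (order_of K')"
    then obtain x y where xy: "x \<in> S" "y \<in> S" "X = \<phi> x" "Y = \<phi> y"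
      by auto
    show "X .=\<^bsub>order_of K'\<^esub> Y"
      if "X \<sqsubseteq>\<^bsub>order_of K'\<^esub> Y" "Y \<sqsubseteq>\<^bsub>order_of K'\<^esub> X"
      using that xy K.order_antisym[of x y] by (simp add: psi SK)
  qed (auto simp: psi SK intro: K.order_refl)
  have joinK: "least (order_of K') (\<phi> (gjoin K x y)) (Upper (order_of K') {\<phi> x, \<phi> y})"
    if "x \<in> S" "y \<in> S" for x y
    using that
    by (auto simp: least_def Upper_def psi S_join SK
        intro: K.gjoin_left K.gjoin_right K.gjoin_least)
  have meetK: "greatest (order_of K') (\<phi> (gmeet K x y)) (Lower (order_of K') {\<phi> x, \<phi> y})"
    if "x \<in> S" "y \<in> S" for x y
    using that
    by (auto simp: greatest_def Lower_def psi S_meet SK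
        intro: K.gmeet_left K.gmeet_right K.gmeet_greatest)
  have lat: "lattice (order_of K')"
  proof -
    interpret P: partial_order "order_of K'" by (rule po)
    show ?thesis
    proof unfold_locales
      fix X Y assume "X \<in> carrier (order_of K')" "Y \<in> carrier (order_of K')"
      then obtain x y where xy: "x \<in> S" "y \<in> S" "X = \<phi> x" "Y = \<phi> y"
        by auto
      show "\<exists>s. least (order_of K') s (Upper (order_of K') {X, Y})"
        using joinK xy by blast
      show "\<exists>s. greatest (order_of K') s (Lower (order_of K') {X, Y})"
        using meetK xy by blast
    qed
  qed
  have lgrp: "l_group K'"
  proof -
    interpret group K' by (rule grp)
    show ?thesis
    proof (intro l_group.intro po_group.intro po_group_axioms.intro l_group_axioms.intro grp po lat)
      fix a b s t
      assume "a \<in> carrier K'" "b \<in> carrier K'" "s \<in> carrier K'" "t \<in> carrier K'" "a \<preceq>\<^bsub>K'\<^esub> b"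
      then show "s \<otimes>\<^bsub>K'\<^esub> a \<otimes>\<^bsub>K'\<^esub> t \<preceq>\<^bsub>K'\<^esub> s \<otimes>\<^bsub>K'\<^esub> b \<otimes>\<^bsub>K'\<^esub> t"
        by (auto simp: psi intro!: K.translation intro: SK)
    qed
  qed
  interpret K': l_group K' by (rule lgrp)
  have join': "gjoin K' (\<phi> x) (\<phi> y) = \<phi> (gjoin K x y)" if "x \<in> S" "y \<in> S" for x y
    using that
    by (intro K'.gjoin_eqI)
      (auto simp: psi S_join SK intro: K.gjoin_left K.gjoin_right K.gjoin_least)
  have meet': "gmeet K' (\<phi> x) (\<phi> y) = \<phi> (gmeet K x y)" if "x \<in> S" "y \<in> S" for x y
    using that
    by (intro K'.gmeet_eqI)
      (auto simp: psi S_meet SK intro: K.gmeet_left K.gmeet_right K.gmeet_greatest)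
  have psi_hom: "\<psi> \<in> l_hom K' K"
    by (auto simp: l_hom_def hom_def psi SK join' meet' S_join S_meet)
  have var: "in_variety K' V"
    unfolding in_variety_def
  proof (intro conjI lgrp ballI, clarify)
    fix s t and e :: "nat \<Rightarrow> 'b"
    assume st: "(s, t) \<in> V" and e: "range e \<subseteq> carrier K'"
    have "range (\<psi> \<circ> e) \<subseteq> carrier K"
    proof clarify
      fix v
      have "e v \<in> \<phi> ` S" using e by auto
      then show "(\<psi> \<circ> e) v \<in> carrier K" by (auto simp: psi SK)
    qed
    then have "leval K (\<psi> \<circ> e) s = leval K (\<psi> \<circ> e) t"
      using K st by (auto simp: in_variety_def)
    moreover have sub: "e ` lvars u \<subseteq> carrier K'" for u using e by auto
    ultimately have "\<psi> (leval K' e s) = \<psi> (leval K' e t)"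
      using l_hom_leval[OF lgrp K.l_group_axioms psi_hom] by metis
    moreover have "leval K' e s \<in> \<phi> ` S" "leval K' e t \<in> \<phi> ` S"
      using K'.leval_closed[OF sub] by simp_all
    ultimately show "leval K' e s = leval K' e t"
      by (auto simp: psi)
  qed
  have po_homs: "\<phi> \<circ> p \<in> po_hom G K'" if "p \<in> po_hom G K" "p ` carrier G \<subseteq> S"
    for p and G :: "('x, 'y) ordered_group_scheme"
  proof -
    have pS: "p a \<in> S" if "a \<in> carrier G" for a using that \<open>p ` carrier G \<subseteq> S\<close> by auto
    show ?thesis
      using \<open>p \<in> po_hom G K\<close> by (auto simp: po_hom_def hom_def psi pS)
  qed
  show ?thesis
    by (rule that[OF var _ psi_hom psi po_homs]) auto
qed

lemma extension_into_generated:
  fixes G :: "'g ordered_group" and K :: "('k, 'l) ordered_group_scheme"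
  assumes G: "po_group G" and free: "free_l_group V G H \<eta>" and K: "in_variety K V"
    and p: "p \<in> po_hom G K"
  obtains h where "h \<in> l_hom H K" "\<And>a. a \<in> carrier G \<Longrightarrow> h (\<eta> a) = p a"
    "\<And>x. x \<in> carrier H \<Longrightarrow> \<exists>t. lvars t \<subseteq> carrier G \<and> h x = leval K p t"
proof -
  interpret K: l_group K using K by (simp add: in_variety_def)
  define S where "S = {leval K p t |t. lvars t \<subseteq> carrier G}"
  define \<phi> where "\<phi> x = {t. lvars t \<subseteq> carrier G \<and> leval K p t = x}" for x
  have p_closed: "p a \<in> carrier K" if "a \<in> carrier G" for a
    using p that by (auto simp: po_hom_def hom_def)
  have S_I: "leval K p t \<in> S" if "lvars t \<subseteq> carrier G" for t
    using that by (auto simp: S_def)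
  have S_K: "S \<subseteq> carrier K"
  proof
    fix x assume "x \<in> S"
    then obtain t where "lvars t \<subseteq> carrier G" "x = leval K p t" by (auto simp: S_def)
    then show "x \<in> carrier K"
      using K.leval_closed[of p t] p_closed by blast
  qed
  have "x \<otimes>\<^bsub>K\<^esub> y \<in> S \<and> gjoin K x y \<in> S \<and> gmeet K x y \<in> S" if "x \<in> S" "y \<in> S" for x y
  proof -
    obtain s t where "lvars s \<subseteq> carrier G" "x = leval K p s" "lvars t \<subseteq> carrier G" "y = leval K p t"
      using \<open>x \<in> S\<close> \<open>y \<in> S\<close> by (auto simp: S_def)
    then show ?thesis
      using S_I[of "LMult s t"] S_I[of "LJoin s t"] S_I[of "LMeet s t"] by simp
  qed
  moreover have "inv\<^bsub>K\<^esub> x \<in> S" if x: "x \<in> S" for x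
  proof -
    obtain s where "lvars s \<subseteq> carrier G" "x = leval K p s"
      using x by (auto simp: S_def)
    then show ?thesis using S_I[of "LInv s"] by simp
  qed
  moreover have "\<one>\<^bsub>K\<^esub> \<in> S" using S_I[of LOne] by simp
  ultimately have S: "l_subgroup S K"
    using S_K by (simp add: l_subgroup_def subgroup_def)
  have inj: "inj_on \<phi> S"
  proof (rule inj_onI)
    fix x y assume "x \<in> S" "y \<in> S" "\<phi> x = \<phi> y"
    then show "x = y" by (auto simp: S_def \<phi>_def)
  qed
  obtain K' :: "'g lterm set ordered_group" and \<psi> where
    K': "in_variety K' V" "carrier K' = \<phi> ` S" and \<psi>: "\<psi> \<in> l_hom K' K" "\<And>x. x \<in> S \<Longrightarrow> \<psi> (\<phi> x) = x"
    and po: "\<And>p (G :: 'g ordered_group).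
      p \<in> po_hom G K \<Longrightarrow> p ` carrier G \<subseteq> S \<Longrightarrow> \<phi> \<circ> p \<in> po_hom G K'"
    using transport[OF K S inj] by metis
  have pS: "p a \<in> S" if "a \<in> carrier G" for a
    using S_I[of "LVar a"] that by simp
  have "\<phi> \<circ> p \<in> po_hom G K'" using po[OF p] pS by blast
  then obtain h where h: "h \<in> l_hom H K'" "\<And>a. a \<in> carrier G \<Longrightarrow> h (\<eta> a) = \<phi> (p a)"
    using free K'(1) unfolding free_l_group_def unique_extension_def by (metis comp_apply)
  show ?thesis
  proof (rule that[of "\<psi> \<circ> h"])
    show "\<psi> \<circ> h \<in> l_hom H K" using h(1) \<psi>(1) by (rule l_hom_comp)
    show "(\<psi> \<circ> h) (\<eta> a) = p a" if "a \<in> carrier G" for a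
      using that by (simp add: h(2) \<psi>(2) pS)
    show "\<exists>t. lvars t \<subseteq> carrier G \<and> (\<psi> \<circ> h) x = leval K p t" if "x \<in> carrier H" for x
    proof -
      have "h x \<in> \<phi> ` S" using h(1) that K'(2) by (auto simp: l_hom_def hom_def)
      then have "\<psi> (h x) \<in> S" using \<psi>(2) by auto
      then show ?thesis by (auto simp: S_def)
    qed
  qed
qed

theorem free_l_groupD:
  fixes G :: "'g ordered_group" and K :: "('k, 'l) ordered_group_scheme"
  assumes G: "po_group G" and free: "free_l_group V G H \<eta>" and K: "in_variety K V"
  shows "unique_extension G H \<eta> K"
proof -
  have H: "in_variety H V" and \<eta>: "\<eta> \<in> po_hom G H" and HH: "unique_extension G H \<eta> H"
    using free by (auto simp: free_l_group_def)
  have lH: "l_group H" and lK: "l_group K" using H K by (simp_all add: in_variety_def)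
  interpret H: l_group H by (rule lH)
  have \<eta>_closed: "\<eta> a \<in> carrier H" if "a \<in> carrier G" for a
    using \<eta> that by (auto simp: po_hom_def hom_def)
  have generated: "\<exists>t. lvars t \<subseteq> carrier G \<and> x = leval H \<eta> t" if x: "x \<in> carrier H" for x
  proof -
    obtain h where h: "h \<in> l_hom H H" "\<And>a. a \<in> carrier G \<Longrightarrow> h (\<eta> a) = \<eta> a"
      "\<And>x. x \<in> carrier H \<Longrightarrow> \<exists>t. lvars t \<subseteq> carrier G \<and> h x = leval H \<eta> t"
      using extension_into_generated[OF G free H \<eta>] by metis
    have "(\<lambda>x. x) \<in> l_hom H H" by (simp add: l_hom_def hom_def)
    then have "restrict h (carrier H) = restrict (\<lambda>x. x) (carrier H)"
      using HH \<eta> h(1,2) l_hom_restrict[OF lH] \<eta>_closed unfolding unique_extension_def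
      by (smt (verit, ccfv_threshold) restrict_apply' restrict_extensional)
    then have "h x = x" using x by (metis restrict_apply')
    then show ?thesis using h(3)[OF x] by simp
  qed
  show ?thesis
    unfolding unique_extension_def
  proof (intro ballI ex_ex1I)
    fix p assume p: "p \<in> po_hom G K"
    obtain h where "h \<in> l_hom H K" "\<And>a. a \<in> carrier G \<Longrightarrow> h (\<eta> a) = p a"
      using extension_into_generated[OF G free K p] by metis
    then show "\<exists>h. h \<in> extensional (carrier H) \<and> h \<in> l_hom H K \<and> (\<forall>a\<in>carrier G. h (\<eta> a) = p a)"
      by (intro exI[of _ "restrict h (carrier H)"]) (simp add: l_hom_restrict[OF lH] \<eta>_closed)
  next
    fix p h h'
    assume h: "h \<in> extensional (carrier H) \<and> h \<in> l_hom H K \<and> (\<forall>a\<in>carrier G. h (\<eta> a) = p a)"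
      and h': "h' \<in> extensional (carrier H) \<and> h' \<in> l_hom H K \<and> (\<forall>a\<in>carrier G. h' (\<eta> a) = p a)"
    show "h = h'"
    proof (rule extensionalityI)
      fix x assume "x \<in> carrier H"
      then obtain t where t: "lvars t \<subseteq> carrier G" "x = leval H \<eta> t"
        using generated by blast
      have sub: "\<eta> ` lvars t \<subseteq> carrier H" using t(1) \<eta>_closed by blast
      have "leval K (h \<circ> \<eta>) t = leval K (h' \<circ> \<eta>) t"
        by (rule leval_cong) (use h h' t(1) in auto)
      then show "h x = h' x"
        using l_hom_leval[OF lH lK _ sub] h h' t(2) by metis
    qed (use h h' in auto)
  qed
qed

section \<open>Right pre-orders\<close>

definition right_preorder :: "('a, 'm) ordered_group_scheme \<Rightarrow> 'a rel \<Rightarrow> bool" where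
  "right_preorder G R \<longleftrightarrow>
     R \<subseteq> carrier G \<times> carrier G \<and> R \<noteq> carrier G \<times> carrier G \<and>
     refl_on (carrier G) R \<and> trans R \<and> total_on (carrier G) R \<and>
     (\<forall>a\<in>carrier G. \<forall>b\<in>carrier G. a \<preceq>\<^bsub>G\<^esub> b \<longrightarrow> (a, b) \<in> R) \<and>
     (\<forall>a b. \<forall>t\<in>carrier G. (a, b) \<in> R \<longrightarrow> (a \<otimes>\<^bsub>G\<^esub> t, b \<otimes>\<^bsub>G\<^esub> t) \<in> R)"

definition pre_cone :: "('a, 'm) ordered_group_scheme \<Rightarrow> 'a rel \<Rightarrow> 'a set" where
  "pre_cone G R = {a \<in> carrier G. (\<one>\<^bsub>G\<^esub>, a) \<in> R}"

definition cone_rel :: "('a, 'm) ordered_group_scheme \<Rightarrow> 'a set \<Rightarrow> 'a rel" where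
  "cone_rel G C = {(a, b) \<in> carrier G \<times> carrier G. b \<otimes>\<^bsub>G\<^esub> inv\<^bsub>G\<^esub> a \<in> C}"

definition cone_equiv :: "('a, 'm) ordered_group_scheme \<Rightarrow> 'a set \<Rightarrow> 'a rel" where
  "cone_equiv G C = cone_rel G C \<inter> (cone_rel G C)\<inverse>"

definition Omega :: "('a, 'm) ordered_group_scheme \<Rightarrow> 'a set \<Rightarrow> 'a set gorder" where
  "Omega G C = \<lparr>carrier = carrier G // cone_equiv G C, eq = (=),
     le = (\<lambda>X Y. \<exists>a\<in>X. \<exists>b\<in>Y. (a, b) \<in> cone_rel G C)\<rparr>"

text \<open>The pointwise order below induces the pointwise lattice operations, \<open>L\<close> being a chain.\<close>

definition Aut :: "'b gorder \<Rightarrow> ('b \<Rightarrow> 'b) ordered_group" where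
  "Aut L = \<lparr>carrier = {f \<in> Bij (carrier L). \<forall>x\<in>carrier L. \<forall>y\<in>carrier L. x \<sqsubseteq>\<^bsub>L\<^esub> y \<longrightarrow> f x \<sqsubseteq>\<^bsub>L\<^esub> f y},
     mult = (\<lambda>f g. compose (carrier L) g f),
     one = (\<lambda>x\<in>carrier L. x),
     leq = (\<lambda>f g. \<forall>x\<in>carrier L. f x \<sqsubseteq>\<^bsub>L\<^esub> g x)\<rparr>"

definition right_translation ::
  "('a, 'm) ordered_group_scheme \<Rightarrow> 'a set \<Rightarrow> 'a \<Rightarrow> 'a set \<Rightarrow> 'a set" where
  "right_translation G C a =
     (\<lambda>X\<in>carrier (Omega G C). \<Union>b\<in>X. cone_equiv G C `` {b \<otimes>\<^bsub>G\<^esub> a})"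

definition H_of ::
  "('a, 'm) ordered_group_scheme \<Rightarrow> 'a set \<Rightarrow> ('a set \<Rightarrow> 'a set) ordered_group" where
  "H_of G C = (Aut (Omega G C))\<lparr>carrier :=
     l_subgroup_generated (Aut (Omega G C)) (right_translation G C ` carrier G)\<rparr>"

definition PreOrd :: "variety \<Rightarrow> ('a, 'm) ordered_group_scheme \<Rightarrow> 'a set set" where
  "PreOrd V G = {pre_cone G R |R. right_preorder G R \<and> in_variety (H_of G (pre_cone G R)) V}"

text \<open>The sets \<open>{C. a \<in> C \<and> inv a \<notin> C}\<close> cover \<open>PreOrd V G\<close> already, since a pre-cone is a proper
  subset; the whole space is inserted only to make this evident.\<close>

definition PreOrd_topology ::
  "variety \<Rightarrow> ('a, 'm) ordered_group_scheme \<Rightarrow> 'a set topology" where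
  "PreOrd_topology V G = topology_generated_by (insert (PreOrd V G)
     {{C \<in> PreOrd V G. a \<in> C \<and> inv\<^bsub>G\<^esub> a \<notin> C} |a. a \<in> carrier G})"

definition inclusion_minimal :: "'a set set \<Rightarrow> 'a set set" where
  "inclusion_minimal F = {C \<in> F. \<forall>D\<in>F. D \<subseteq> C \<longrightarrow> D = C}"

definition minimal_layer :: "variety \<Rightarrow> ('a, 'm) ordered_group_scheme \<Rightarrow> 'a set topology" where
  "minimal_layer V G = subtopology (PreOrd_topology V G) (inclusion_minimal (PreOrd V G))"


section \<open>The spectrum\<close>

definition convex_l_subgroup :: "'a set \<Rightarrow> ('a, 'm) ordered_group_scheme \<Rightarrow> bool" where
  "convex_l_subgroup k H \<longleftrightarrow> l_subgroup k H \<and>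
     (\<forall>a\<in>k. \<forall>b\<in>k. \<forall>x\<in>carrier H. a \<preceq>\<^bsub>H\<^esub> x \<and> x \<preceq>\<^bsub>H\<^esub> b \<longrightarrow> x \<in> k)"

definition coset_order :: "('a, 'm) ordered_group_scheme \<Rightarrow> 'a set \<Rightarrow> 'a set gorder" where
  "coset_order H k = \<lparr>carrier = rcosets\<^bsub>H\<^esub> k, eq = (=),
     le = (\<lambda>X Y. \<exists>x\<in>carrier H. \<exists>y\<in>carrier H. X = k #>\<^bsub>H\<^esub> x \<and> Y = k #>\<^bsub>H\<^esub> y \<and>
       (\<exists>t\<in>k. x \<preceq>\<^bsub>H\<^esub> t \<otimes>\<^bsub>H\<^esub> y))\<rparr>"

definition Spec :: "('a, 'm) ordered_group_scheme \<Rightarrow> 'a set set" where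
  "Spec H = {p. convex_l_subgroup p H \<and> p \<noteq> carrier H \<and> total_order (coset_order H p)}"

text \<open>The generating sets are already closed under unions and finite intersections, so they are
  exactly the open sets.\<close>

definition Spec_topology :: "('a, 'm) ordered_group_scheme \<Rightarrow> 'a set topology" where
  "Spec_topology H = topology_generated_by {{p \<in> Spec H. \<not> A \<subseteq> p} |A. A \<subseteq> carrier H}"

definition Min_space :: "('a, 'm) ordered_group_scheme \<Rightarrow> 'a set topology" where
  "Min_space H = subtopology (Spec_topology H) (inclusion_minimal (Spec H))"


section \<open>Polars\<close>

definition gabs :: "('a, 'm) ordered_group_scheme \<Rightarrow> 'a \<Rightarrow> 'a" where
  "gabs H x = gjoin H x (inv\<^bsub>H\<^esub> x)"

definition perp :: "('a, 'm) ordered_group_scheme \<Rightarrow> 'a set \<Rightarrow> 'a set" where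
  "perp H S = {x \<in> carrier H. \<forall>y\<in>S. gmeet H (gabs H x) (gabs H y) = \<one>\<^bsub>H\<^esub>}"

definition Pol :: "('a, 'm) ordered_group_scheme \<Rightarrow> 'a set set" where
  "Pol H = {T. T \<subseteq> carrier H \<and> T = perp H (perp H T)}"

definition Pol_p :: "('a, 'm) ordered_group_scheme \<Rightarrow> 'a set set" where
  "Pol_p H = {perp H (perp H {x}) |x. x \<in> carrier H}"

definition boolean_subalgebra_Pol :: "'a set set \<Rightarrow> ('a, 'm) ordered_group_scheme \<Rightarrow> bool" where
  "boolean_subalgebra_Pol B H \<longleftrightarrow> B \<subseteq> Pol H \<and> carrier H \<in> B \<and> {\<one>\<^bsub>H\<^esub>} \<in> B \<and>
     (\<forall>S\<in>B. \<forall>T\<in>B. S \<inter> T \<in> B \<and> perp H (perp H (S \<union> T)) \<in> B) \<and>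
     (\<forall>T\<in>B. perp H T \<in> B)"

definition weak_unit :: "('a, 'm) ordered_group_scheme \<Rightarrow> 'a \<Rightarrow> bool" where
  "weak_unit H w \<longleftrightarrow> w \<in> positive_cone H \<and>
     (\<forall>x\<in>carrier H. gmeet H w (gabs H x) = \<one>\<^bsub>H\<^esub> \<longrightarrow> x = \<one>\<^bsub>H\<^esub>)"

definition positive_cone_complemented :: "('a, 'm) ordered_group_scheme \<Rightarrow> bool" where
  "positive_cone_complemented H \<longleftrightarrow>
     (\<forall>x\<in>positive_cone H. \<exists>y\<in>positive_cone H. gmeet H x y = \<one>\<^bsub>H\<^esub> \<and> weak_unit H (gjoin H x y))"

end

(* An element of H is a lattice combination of elements of G, so every coset of a prime subgroup p is
represented in G: the chain H/p is the chain of the right pre-order "pa <= pb" on G, and p can be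
recovered from its pre-cone. Right multiplication lets H act on this chain, which places the pre-order
in P_V(G); conversely a right pre-order C in P_V(G) extends to an action of H on Omega_C by freeness,
and C comes from the stabilizer of the class of e. This bijection is an order isomorphism and a
homeomorphism from Spec H to P_V(G), so the minimal layer is Min H.

For an arbitrary l-group H, minimal primes correspond to the maximal subsets of H^+ - {e} closed under
meets, whence a minimal prime contains x exactly if it omits some y orthogonal to x. So for fixed x the
elements x and those orthogonal to x yield an open cover of Min H; a finite subcover gives a complement
of x. Conversely, complements turn a family of basic open sets without finite subcover into a family
closed under meets that avoids e, which extends to a minimal prime lying outside all the sets. *)

theory Submission
  imports Defs
begin

text \<open>That \<open>H\<close> consists of lattice combinations comes from applying the universal
  property to \<open>\<eta>\<close> itself: the resulting endomorphism has only term values and must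
  be the identity. Claims about \<open>H\<close> are then proved by induction over joins and meets
  alone, and the induction steps close because modulo a prime a join or meet is equivalent to one of
  its two arguments. The condition that H_C lies in V is what makes freeness applicable: the full
  automorphism group of Omega_C may violate the equations of V, so the action is obtained in H_C
  first and only then regarded as one by automorphisms. The topological obstacle is that the
  subbasic sets of pre-orders speak of elements of \<open>G\<close> only. The set given by
  \<open>a\<close> says that the coset of \<open>\<eta> a\<close> lies strictly above p,
  equivalently that the join of \<open>\<eta> a\<close> and the identity is outside p. Conversely, x
  outside p splits into a coset strictly above and a coset strictly below p, and both conditions are
  open by the same induction.\<close>

no_notation join (infixl \<open>\<squnion>\<index>\<close> 65)
no_notation meet (infixl \<open>\<sqinter>\<index>\<close> 70)
unbundle no abs_syntax

section \<open>Arithmetic of lattice-ordered groups\<close>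

context l_group
begin

abbreviation join_G (infixl \<open>\<squnion>\<close> 65) where "x \<squnion> y \<equiv> gjoin G x y"
abbreviation meet_G (infixl \<open>\<sqinter>\<close> 70) where "x \<sqinter> y \<equiv> gmeet G x y"
abbreviation abs_G (\<open>(\<open>open_block notation=\<open>mixfix abs\<close>\<close>\<bar>_\<bar>)\<close>) where "\<bar>x\<bar> \<equiv> gabs G x"

declare gjoin_closed [simp] gmeet_closed [simp] order_refl [simp]

lemma gabs_closed [simp]: "x \<in> carrier G \<Longrightarrow> \<bar>x\<bar> \<in> carrier G"
  by (simp add: gabs_def)

lemma positive_coneI: "\<lbrakk>x \<in> carrier G; \<one> \<preceq> x\<rbrakk> \<Longrightarrow> x \<in> positive_cone G"
  and positive_cone_closed: "x \<in> positive_cone G \<Longrightarrow> x \<in> carrier G"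
  and positive_cone_ge: "x \<in> positive_cone G \<Longrightarrow> \<one> \<preceq> x"
  by (auto simp: positive_cone_def)

lemma gmeet_comm: "x \<in> carrier G \<Longrightarrow> y \<in> carrier G \<Longrightarrow> x \<sqinter> y = y \<sqinter> x"
  by (rule gmeet_eqI) (auto intro: gmeet_left gmeet_right gmeet_greatest)

lemma gjoin_comm: "x \<in> carrier G \<Longrightarrow> y \<in> carrier G \<Longrightarrow> x \<squnion> y = y \<squnion> x"
  by (rule gjoin_eqI) (auto intro: gjoin_left gjoin_right gjoin_least)

lemma gmeet_absorb: "\<lbrakk>x \<preceq> y; x \<in> carrier G; y \<in> carrier G\<rbrakk> \<Longrightarrow> x \<sqinter> y = x"
  by (rule gmeet_eqI) auto

lemma gjoin_absorb: "\<lbrakk>x \<preceq> y; x \<in> carrier G; y \<in> carrier G\<rbrakk> \<Longrightarrow> x \<squnion> y = y"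
  by (rule gjoin_eqI) auto

lemma le_gmeet_iff:
  "\<lbrakk>x \<in> carrier G; y \<in> carrier G; z \<in> carrier G\<rbrakk> \<Longrightarrow> z \<preceq> x \<sqinter> y \<longleftrightarrow> z \<preceq> x \<and> z \<preceq> y"
  by (meson gmeet_closed gmeet_greatest gmeet_left gmeet_right order_trans)

lemma gjoin_le_iff:
  "\<lbrakk>x \<in> carrier G; y \<in> carrier G; z \<in> carrier G\<rbrakk> \<Longrightarrow> x \<squnion> y \<preceq> z \<longleftrightarrow> x \<preceq> z \<and> y \<preceq> z"
  by (meson gjoin_closed gjoin_least gjoin_left gjoin_right order_trans)

lemma gmeet_assoc:
  assumes "x \<in> carrier G" "y \<in> carrier G" "z \<in> carrier G"
  shows "x \<sqinter> y \<sqinter> z = x \<sqinter> (y \<sqinter> z)"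
proof (rule order_antisym)
  show "x \<sqinter> y \<sqinter> z \<preceq> x \<sqinter> (y \<sqinter> z)"
    using assms order_refl[of "x \<sqinter> y \<sqinter> z"] by (simp add: le_gmeet_iff del: order_refl)
  show "x \<sqinter> (y \<sqinter> z) \<preceq> x \<sqinter> y \<sqinter> z"
    using assms order_refl[of "x \<sqinter> (y \<sqinter> z)"] by (simp add: le_gmeet_iff del: order_refl)
qed (use assms in auto)

lemma gmeet_left_comm:
  "\<lbrakk>x \<in> carrier G; y \<in> carrier G; z \<in> carrier G\<rbrakk> \<Longrightarrow> x \<sqinter> (y \<sqinter> z) = y \<sqinter> (x \<sqinter> z)"
  by (metis gmeet_assoc gmeet_comm)

lemma gmeet_mono:
  assumes "x \<preceq> x'" "y \<preceq> y'" "x \<in> carrier G" "y \<in> carrier G" "x' \<in> carrier G" "y' \<in> carrier G"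
  shows "x \<sqinter> y \<preceq> x' \<sqinter> y'"
  using assms by (meson gmeet_closed gmeet_greatest gmeet_left gmeet_right order_trans)

lemma mult_left_mono:
  assumes "x \<preceq> y" "x \<in> carrier G" "y \<in> carrier G" "a \<in> carrier G" shows "a \<otimes> x \<preceq> a \<otimes> y"
  using translation[of x y a \<one>] assms by simp

lemma mult_right_mono:
  assumes "x \<preceq> y" "x \<in> carrier G" "y \<in> carrier G" "a \<in> carrier G" shows "x \<otimes> a \<preceq> y \<otimes> a"
  using translation[of x y \<one> a] assms by simp

lemma mult_mono:
  assumes "x \<preceq> y" "u \<preceq> v" "x \<in> carrier G" "y \<in> carrier G" "u \<in> carrier G" "v \<in> carrier G"
  shows "x \<otimes> u \<preceq> y \<otimes> v"
  using assms by (meson m_closed mult_left_mono mult_right_mono order_trans)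

lemma mult_left_le_iff:
  assumes "x \<in> carrier G" "y \<in> carrier G" "a \<in> carrier G"
  shows "a \<otimes> x \<preceq> a \<otimes> y \<longleftrightarrow> x \<preceq> y"
  using mult_left_mono[of "a \<otimes> x" "a \<otimes> y" "inv a"] mult_left_mono[of x y a] assms
  by (auto simp flip: m_assoc)

lemma mult_right_le_iff:
  assumes "x \<in> carrier G" "y \<in> carrier G" "a \<in> carrier G"
  shows "x \<otimes> a \<preceq> y \<otimes> a \<longleftrightarrow> x \<preceq> y"
  using mult_right_mono[of "x \<otimes> a" "y \<otimes> a" "inv a"] mult_right_mono[of x y a] assms
  by (auto simp: m_assoc)

lemma inv_mono:
  assumes "x \<preceq> y" "x \<in> carrier G" "y \<in> carrier G" shows "inv y \<preceq> inv x"
  using translation[of x y "inv x" "inv y"] assms by (simp add: m_assoc)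

lemma mult_inv_le_iff:
  assumes "x \<in> carrier G" "y \<in> carrier G" "a \<in> carrier G"
  shows "inv a \<otimes> x \<preceq> y \<longleftrightarrow> x \<preceq> a \<otimes> y"
  using mult_left_le_iff[of "inv a \<otimes> x" y a] assms by (simp flip: m_assoc)

lemma le_mult_inv_iff:
  assumes "x \<in> carrier G" "y \<in> carrier G" "a \<in> carrier G"
  shows "x \<preceq> inv a \<otimes> y \<longleftrightarrow> a \<otimes> x \<preceq> y"
  using mult_left_le_iff[of x "inv a \<otimes> y" a] assms by (simp flip: m_assoc)

lemma mult_inv_right_le_iff:
  assumes "x \<in> carrier G" "y \<in> carrier G" "a \<in> carrier G"
  shows "x \<otimes> inv a \<preceq> y \<longleftrightarrow> x \<preceq> y \<otimes> a"
  using mult_right_le_iff[of "x \<otimes> inv a" y a] assms by (simp add: m_assoc)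

lemma le_mult_inv_right_iff:
  assumes "x \<in> carrier G" "y \<in> carrier G" "a \<in> carrier G"
  shows "x \<preceq> y \<otimes> inv a \<longleftrightarrow> x \<otimes> a \<preceq> y"
  using mult_right_le_iff[of x "y \<otimes> inv a" a] assms by (simp add: m_assoc)

lemma mult_gmeet_left:
  assumes "x \<in> carrier G" "y \<in> carrier G" "a \<in> carrier G"
  shows "a \<otimes> (x \<sqinter> y) = (a \<otimes> x) \<sqinter> (a \<otimes> y)"
proof (rule gmeet_eqI[symmetric])
  fix z assume z: "z \<in> carrier G" "z \<preceq> a \<otimes> x" "z \<preceq> a \<otimes> y"
  then have "inv a \<otimes> z \<preceq> x \<sqinter> y"
    using assms by (simp add: le_gmeet_iff mult_inv_le_iff)
  then show "z \<preceq> a \<otimes> (x \<sqinter> y)"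
    using assms z by (simp add: mult_inv_le_iff)
qed (use assms in \<open>auto simp: mult_left_le_iff gmeet_left gmeet_right\<close>)

lemma mult_gmeet_right:
  assumes "x \<in> carrier G" "y \<in> carrier G" "a \<in> carrier G"
  shows "(x \<sqinter> y) \<otimes> a = (x \<otimes> a) \<sqinter> (y \<otimes> a)"
proof (rule gmeet_eqI[symmetric])
  fix z assume z: "z \<in> carrier G" "z \<preceq> x \<otimes> a" "z \<preceq> y \<otimes> a"
  then have "z \<otimes> inv a \<preceq> x \<sqinter> y"
    using assms by (simp add: le_gmeet_iff mult_inv_right_le_iff)
  then show "z \<preceq> (x \<sqinter> y) \<otimes> a"
    using assms z by (simp add: mult_inv_right_le_iff)
qed (use assms in \<open>auto simp: mult_right_le_iff gmeet_left gmeet_right\<close>)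

lemma mult_gjoin_left:
  assumes "x \<in> carrier G" "y \<in> carrier G" "a \<in> carrier G"
  shows "a \<otimes> (x \<squnion> y) = (a \<otimes> x) \<squnion> (a \<otimes> y)"
proof (rule gjoin_eqI[symmetric])
  fix z assume z: "z \<in> carrier G" "a \<otimes> x \<preceq> z" "a \<otimes> y \<preceq> z"
  then have "x \<squnion> y \<preceq> inv a \<otimes> z"
    using assms by (intro gjoin_least) (simp_all add: le_mult_inv_iff)
  then show "a \<otimes> (x \<squnion> y) \<preceq> z"
    using assms z le_mult_inv_iff[of "x \<squnion> y" z a] by simp
qed (use assms in \<open>auto simp: mult_left_le_iff gjoin_left gjoin_right\<close>)

lemma mult_gjoin_right:
  assumes "x \<in> carrier G" "y \<in> carrier G" "a \<in> carrier G"
  shows "(x \<squnion> y) \<otimes> a = (x \<otimes> a) \<squnion> (y \<otimes> a)"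
proof (rule gjoin_eqI[symmetric])
  fix z assume z: "z \<in> carrier G" "x \<otimes> a \<preceq> z" "y \<otimes> a \<preceq> z"
  then have "x \<squnion> y \<preceq> z \<otimes> inv a"
    using assms by (intro gjoin_least) (simp_all add: le_mult_inv_right_iff)
  then show "(x \<squnion> y) \<otimes> a \<preceq> z"
    using assms z le_mult_inv_right_iff[of "x \<squnion> y" z a] by simp
qed (use assms in \<open>auto simp: mult_right_le_iff gjoin_left gjoin_right\<close>)

lemma inv_le_iff:
  assumes "x \<in> carrier G" "y \<in> carrier G" shows "inv x \<preceq> y \<longleftrightarrow> inv y \<preceq> x"
  using inv_mono[of "inv x" y] inv_mono[of "inv y" x] assms by auto

lemma le_inv_iff:
  assumes "x \<in> carrier G" "y \<in> carrier G" shows "x \<preceq> inv y \<longleftrightarrow> y \<preceq> inv x"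
  using inv_mono[of x "inv y"] inv_mono[of y "inv x"] assms by auto

lemma inv_gjoin:
  assumes "x \<in> carrier G" "y \<in> carrier G" shows "inv (x \<squnion> y) = inv x \<sqinter> inv y"
proof (rule gmeet_eqI[symmetric])
  fix z assume "z \<in> carrier G" "z \<preceq> inv x" "z \<preceq> inv y"
  then show "z \<preceq> inv (x \<squnion> y)"
    using assms le_inv_iff[of z "x \<squnion> y"] le_inv_iff[of z x] le_inv_iff[of z y]
      gjoin_least[of x "inv z" y] by simp
qed (use assms in \<open>auto intro: inv_mono gjoin_left gjoin_right\<close>)

lemma inv_gmeet:
  assumes "x \<in> carrier G" "y \<in> carrier G" shows "inv (x \<sqinter> y) = inv x \<squnion> inv y"
  by (rule gjoin_eqI[symmetric])
    (use assms in \<open>auto intro: inv_mono gmeet_left gmeet_right simp: inv_le_iff le_gmeet_iff\<close>)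

text \<open>The meet of \<open>d\<close> with the identity is idempotent: its square is the meet of
  \<open>d \<otimes> d\<close>, \<open>d\<close> and the identity, and \<open>d \<otimes> d\<close>
  lies above the meet of the other two. An idempotent of a group is the identity.\<close>

lemma square_ge_one:
  assumes "d \<in> carrier G" "\<one> \<preceq> d \<otimes> d" shows "\<one> \<preceq> d"
proof -
  have "d \<sqinter> \<one> \<preceq> d \<otimes> d"
    using assms by (meson gmeet_closed gmeet_right m_closed one_closed order_trans)
  then have "(d \<sqinter> \<one>) \<otimes> (d \<sqinter> \<one>) = d \<sqinter> \<one>"
    using assms by (simp add: mult_gmeet_left mult_gmeet_right)
      (metis gmeet_absorb gmeet_assoc gmeet_closed gmeet_comm gmeet_left m_closed one_closed)
  then have "d \<sqinter> \<one> = \<one>"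
    using assms by (metis gmeet_closed l_cancel_one one_closed)
  then show ?thesis using assms by (metis gmeet_left one_closed)
qed

section \<open>Absolute values\<close>

lemma gabs_upper: "x \<in> carrier G \<Longrightarrow> x \<preceq> \<bar>x\<bar>" "x \<in> carrier G \<Longrightarrow> inv x \<preceq> \<bar>x\<bar>"
  by (simp_all add: gabs_def gjoin_left gjoin_right)

lemma gabs_least: "\<lbrakk>x \<preceq> y; inv x \<preceq> y; x \<in> carrier G; y \<in> carrier G\<rbrakk> \<Longrightarrow> \<bar>x\<bar> \<preceq> y"
  by (simp add: gabs_def gjoin_least)

lemma gabs_ge_one: assumes "x \<in> carrier G" shows "\<one> \<preceq> \<bar>x\<bar>"
proof (rule square_ge_one)
  show "\<one> \<preceq> \<bar>x\<bar> \<otimes> \<bar>x\<bar>"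
    using mult_mono[OF gabs_upper(1) gabs_upper(2), of x x] assms by simp
qed (use assms in simp)

lemma gabs_positive [simp]: "x \<in> carrier G \<Longrightarrow> \<bar>x\<bar> \<in> positive_cone G"
  by (simp add: positive_coneI gabs_ge_one)

lemma gabs_eq: assumes "x \<in> carrier G" "\<one> \<preceq> x" shows "\<bar>x\<bar> = x"
proof -
  have "inv x \<preceq> \<one>" using inv_mono[of \<one> x] assms by simp
  then have "inv x \<preceq> x" using assms by (meson inv_closed one_closed order_trans)
  then show ?thesis using assms by (simp add: gabs_def gjoin_comm[of x] gjoin_absorb)
qed

lemma gabs_gabs [simp]: "x \<in> carrier G \<Longrightarrow> \<bar>\<bar>x\<bar>\<bar> = \<bar>x\<bar>"
  by (simp add: gabs_eq gabs_ge_one)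

lemma gabs_one [simp]: "\<bar>\<one>\<bar> = \<one>"
  by (simp add: gabs_eq)

lemma gabs_inv: "x \<in> carrier G \<Longrightarrow> \<bar>inv x\<bar> = \<bar>x\<bar>"
  by (simp add: gabs_def gjoin_comm)

lemma gabs_eq_one: assumes "x \<in> carrier G" "\<bar>x\<bar> = \<one>" shows "x = \<one>"
proof (rule order_antisym)
  show "x \<preceq> \<one>" using gabs_upper(1)[of x] assms by simp
  show "\<one> \<preceq> x" using inv_mono[OF gabs_upper(2)[of x]] assms by simp
qed (use assms in auto)

lemma inv_gabs_le: assumes "x \<in> carrier G" shows "inv \<bar>x\<bar> \<preceq> x"
  using inv_mono[OF gabs_upper(2)[of x]] assms by simp

lemma le_mult_positive_right:
  assumes "\<one> \<preceq> y" "x \<in> carrier G" "y \<in> carrier G" shows "x \<preceq> x \<otimes> y"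
  using mult_left_mono[of \<one> y x] assms by simp

lemma le_mult_positive_left:
  assumes "\<one> \<preceq> y" "x \<in> carrier G" "y \<in> carrier G" shows "x \<preceq> y \<otimes> x"
  using mult_right_mono[of \<one> y x] assms by simp

lemma one_le_mult:
  assumes "\<one> \<preceq> x" "\<one> \<preceq> y" "x \<in> carrier G" "y \<in> carrier G" shows "\<one> \<preceq> x \<otimes> y"
  using mult_mono[of \<one> x \<one> y] assms by simp

text \<open>Without commutativity \<open>x \<otimes> y\<close> is bounded by |x||y| but its inverse
  by |y||x|; the palindrome dominates both.\<close>

lemma gabs_mult_le:
  assumes x: "x \<in> carrier G" and y: "y \<in> carrier G" shows "\<bar>x \<otimes> y\<bar> \<preceq> \<bar>x\<bar> \<otimes> \<bar>y\<bar> \<otimes> \<bar>x\<bar>"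
proof (rule gabs_least)
  have 1: "x \<otimes> y \<preceq> \<bar>x\<bar> \<otimes> \<bar>y\<bar>" "inv y \<otimes> inv x \<preceq> \<bar>y\<bar> \<otimes> \<bar>x\<bar>"
    using x y by (auto intro!: mult_mono gabs_upper)
  have 2: "\<bar>x\<bar> \<otimes> \<bar>y\<bar> \<preceq> \<bar>x\<bar> \<otimes> \<bar>y\<bar> \<otimes> \<bar>x\<bar>" "\<bar>y\<bar> \<otimes> \<bar>x\<bar> \<preceq> \<bar>x\<bar> \<otimes> \<bar>y\<bar> \<otimes> \<bar>x\<bar>"
    using x y le_mult_positive_right[OF gabs_ge_one[OF x], of "\<bar>x\<bar> \<otimes> \<bar>y\<bar>"]
      le_mult_positive_left[OF gabs_ge_one[OF x], of "\<bar>y\<bar> \<otimes> \<bar>x\<bar>"] by (auto simp: m_assoc)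
  show "x \<otimes> y \<preceq> \<bar>x\<bar> \<otimes> \<bar>y\<bar> \<otimes> \<bar>x\<bar>"
    by (rule order_trans[OF 1(1) 2(1)]) (use x y in auto)
  show "inv (x \<otimes> y) \<preceq> \<bar>x\<bar> \<otimes> \<bar>y\<bar> \<otimes> \<bar>x\<bar>"
    by (subst inv_mult_group, rule x, rule y, rule order_trans[OF 1(2) 2(2)]) (use x y in auto)
qed (use x y in auto)

text \<open>The estimate behind convexity: \<open>b\<close> bounds \<open>x\<close> and
  \<open>inv a\<close> bounds \<open>inv x\<close>, and the product of the two absolute values
  dominates both.\<close>

lemma gabs_between_le:
  assumes "a \<preceq> x" "x \<preceq> b" "a \<in> carrier G" "b \<in> carrier G" "x \<in> carrier G"
  shows "\<bar>x\<bar> \<preceq> \<bar>a\<bar> \<otimes> \<bar>b\<bar>"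
proof (rule gabs_least)
  have "b \<preceq> \<bar>b\<bar>" "\<bar>b\<bar> \<preceq> \<bar>a\<bar> \<otimes> \<bar>b\<bar>"
    using assms by (auto intro: gabs_upper le_mult_positive_left gabs_ge_one)
  then show "x \<preceq> \<bar>a\<bar> \<otimes> \<bar>b\<bar>" using assms by (meson gabs_closed m_closed order_trans)
  have "inv x \<preceq> inv a" "inv a \<preceq> \<bar>a\<bar>" "\<bar>a\<bar> \<preceq> \<bar>a\<bar> \<otimes> \<bar>b\<bar>"
    using assms by (auto intro: gabs_upper le_mult_positive_right gabs_ge_one inv_mono)
  then show "inv x \<preceq> \<bar>a\<bar> \<otimes> \<bar>b\<bar>" using assms by (meson gabs_closed m_closed inv_closed order_trans)
qed (use assms in auto)

text \<open>Expanding the right-hand side gives four terms. Those with a factor \<open>u\<close> lie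
  above \<open>u\<close> by positivity of the other factor, and the remaining one is
  \<open>x \<otimes> y\<close>.\<close>

lemma gmeet_mult_le:
  assumes u: "\<one> \<preceq> u" "u \<in> carrier G" and x: "\<one> \<preceq> x" "x \<in> carrier G"
    and y: "\<one> \<preceq> y" "y \<in> carrier G"
  shows "u \<sqinter> (x \<otimes> y) \<preceq> (u \<sqinter> x) \<otimes> (u \<sqinter> y)"
proof -
  have "u \<preceq> u \<otimes> u" "u \<preceq> x \<otimes> u" "u \<preceq> u \<otimes> y"
    using u x y by (auto intro: le_mult_positive_left le_mult_positive_right)
  moreover have "u \<sqinter> (x \<otimes> y) \<preceq> u" "u \<sqinter> (x \<otimes> y) \<preceq> x \<otimes> y"
    using u x y by (auto intro: gmeet_left gmeet_right)
  ultimately have "u \<sqinter> (x \<otimes> y) \<preceq> u \<otimes> u" "u \<sqinter> (x \<otimes> y) \<preceq> x \<otimes> u"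
      "u \<sqinter> (x \<otimes> y) \<preceq> u \<otimes> y" "u \<sqinter> (x \<otimes> y) \<preceq> x \<otimes> y"
    using u x y order_trans[of "u \<sqinter> (x \<otimes> y)" u] by auto
  then show ?thesis
    using u x y by (simp add: mult_gmeet_left mult_gmeet_right le_gmeet_iff)
qed

lemma one_le_gmeet: "\<lbrakk>\<one> \<preceq> x; \<one> \<preceq> y; x \<in> carrier G; y \<in> carrier G\<rbrakk> \<Longrightarrow> \<one> \<preceq> x \<sqinter> y"
  by (simp add: le_gmeet_iff)

lemma one_le_gjoin: "\<lbrakk>\<one> \<preceq> x; x \<in> carrier G; y \<in> carrier G\<rbrakk> \<Longrightarrow> \<one> \<preceq> x \<squnion> y"
  by (meson gjoin_closed gjoin_left one_closed order_trans)

lemma gjoin_le_mult: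
  "\<lbrakk>\<one> \<preceq> x; \<one> \<preceq> y; x \<in> carrier G; y \<in> carrier G\<rbrakk> \<Longrightarrow> x \<squnion> y \<preceq> x \<otimes> y"
  by (simp add: gjoin_le_iff le_mult_positive_left le_mult_positive_right)

section \<open>Disjoint positive elements\<close>

lemma disjoint_mono:
  assumes "u \<sqinter> y = \<one>" "\<one> \<preceq> u" "\<one> \<preceq> x" "x \<preceq> y" "u \<in> carrier G" "x \<in> carrier G" "y \<in> carrier G"
  shows "u \<sqinter> x = \<one>"
proof (rule order_antisym)
  show "u \<sqinter> x \<preceq> \<one>" using gmeet_mono[of u u x y] assms by simp
qed (use assms in \<open>auto intro: one_le_gmeet\<close>)

lemma disjoint_mult:
  assumes "u \<sqinter> x = \<one>" "u \<sqinter> y = \<one>" "\<one> \<preceq> u" "\<one> \<preceq> x" "\<one> \<preceq> y"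
    "u \<in> carrier G" "x \<in> carrier G" "y \<in> carrier G"
  shows "u \<sqinter> (x \<otimes> y) = \<one>"
proof (rule order_antisym)
  show "u \<sqinter> (x \<otimes> y) \<preceq> \<one>" using gmeet_mult_le[of u x y] assms by simp
qed (use assms in \<open>auto intro: one_le_gmeet one_le_mult\<close>)

text \<open>The join of positive elements lies below their product, so disjointness from
  \<open>x\<close> and \<open>y\<close> passes to the join through
  \<open>disjoint_mult\<close>.\<close>

lemma disjoint_gjoin_iff:
  assumes "\<one> \<preceq> u" "\<one> \<preceq> x" "\<one> \<preceq> y" "u \<in> carrier G" "x \<in> carrier G" "y \<in> carrier G"
  shows "u \<sqinter> (x \<squnion> y) = \<one> \<longleftrightarrow> u \<sqinter> x = \<one> \<and> u \<sqinter> y = \<one>"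
proof
  assume "u \<sqinter> (x \<squnion> y) = \<one>"
  then show "u \<sqinter> x = \<one> \<and> u \<sqinter> y = \<one>"
    using assms disjoint_mono[of u "x \<squnion> y"] by (auto intro: gjoin_left gjoin_right)
next
  assume "u \<sqinter> x = \<one> \<and> u \<sqinter> y = \<one>"
  then have "u \<sqinter> (x \<otimes> y) = \<one>" using assms by (auto intro: disjoint_mult)
  then show "u \<sqinter> (x \<squnion> y) = \<one>"
    by (rule disjoint_mono) (use assms in \<open>auto intro: one_le_gjoin gjoin_le_mult\<close>)
qed

text \<open>Cancelling the common part \<open>x \<sqinter> y\<close> on the right turns any pair
  into a disjoint positive one. This lets primeness, which concerns disjoint pairs, decide between
  arbitrary \<open>x\<close> and \<open>y\<close>.\<close>

lemma gmeet_translated: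
  assumes "x \<in> carrier G" "y \<in> carrier G"
  shows "(x \<otimes> inv (x \<sqinter> y)) \<sqinter> (y \<otimes> inv (x \<sqinter> y)) = \<one>"
    and "\<one> \<preceq> x \<otimes> inv (x \<sqinter> y)" and "\<one> \<preceq> y \<otimes> inv (x \<sqinter> y)"
  using assms
  by (simp_all add: le_mult_inv_right_iff gmeet_left gmeet_right flip: mult_gmeet_right)

section \<open>Prime subgroups\<close>

lemma
  assumes "l_subgroup S G"
  shows l_subgroup_subset: "S \<subseteq> carrier G"
    and l_subgroup_one: "\<one> \<in> S"
    and l_subgroup_mult: "\<lbrakk>x \<in> S; y \<in> S\<rbrakk> \<Longrightarrow> x \<otimes> y \<in> S"
    and l_subgroup_inv: "x \<in> S \<Longrightarrow> inv x \<in> S"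
    and l_subgroup_join: "\<lbrakk>x \<in> S; y \<in> S\<rbrakk> \<Longrightarrow> x \<squnion> y \<in> S"
    and l_subgroup_meet: "\<lbrakk>x \<in> S; y \<in> S\<rbrakk> \<Longrightarrow> x \<sqinter> y \<in> S"
  using assms
  by (auto simp: l_subgroup_def subgroup.one_closed subgroup.m_closed subgroup.m_inv_closed
      dest: subgroup.subset)

text \<open>\<open>gabs_mult_le\<close> and \<open>gabs_between_le\<close> bound the absolute values
  in question by products from \<open>I\<close>; closure under products and downward closure then
  keep them in \<open>I\<close>.\<close>

lemma convex_l_subgroup_of_ideal:
  assumes one: "\<one> \<in> I" and pos: "I \<subseteq> positive_cone G"
    and mult: "\<And>x y. \<lbrakk>x \<in> I; y \<in> I\<rbrakk> \<Longrightarrow> x \<otimes> y \<in> I"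
    and down: "\<And>x y. \<lbrakk>x \<in> positive_cone G; y \<in> I; x \<preceq> y\<rbrakk> \<Longrightarrow> x \<in> I"
  shows "convex_l_subgroup {z \<in> carrier G. \<bar>z\<bar> \<in> I} G"
proof -
  let ?k = "{z \<in> carrier G. \<bar>z\<bar> \<in> I}"
  have between: "x \<in> ?k" if "a \<in> ?k" "b \<in> ?k" "a \<preceq> x" "x \<preceq> b" "x \<in> carrier G" for a b x
    using down[OF _ mult[of "\<bar>a\<bar>" "\<bar>b\<bar>"], of "\<bar>x\<bar>"] gabs_between_le[of a x b] that by simp
  have mult_k: "x \<otimes> y \<in> ?k" if "x \<in> ?k" "y \<in> ?k" for x y
    using down[OF _ mult[OF mult[of "\<bar>x\<bar>" "\<bar>y\<bar>"], of "\<bar>x\<bar>"], of "\<bar>x \<otimes> y\<bar>"]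
      gabs_mult_le[of x y] that by simp
  have abs_k: "\<bar>x\<bar> \<in> ?k" "inv x \<in> ?k" if "x \<in> ?k" for x
    using that by (auto simp: gabs_inv)
  \<comment> \<open>Both are squeezed between known members: the join between \<open>x\<close> and
    |x||y|, the meet between the product of the inverses of |x| and |y| and
    \<open>x\<close>.\<close>
  have "x \<squnion> y \<in> ?k \<and> x \<sqinter> y \<in> ?k" if xy: "x \<in> ?k" "y \<in> ?k" for x y
  proof
    have c: "x \<in> carrier G" "y \<in> carrier G" using xy by auto
    have "x \<preceq> \<bar>x\<bar> \<otimes> \<bar>y\<bar>" "y \<preceq> \<bar>x\<bar> \<otimes> \<bar>y\<bar>"
      using c order_trans[OF gabs_upper(1)[of x] le_mult_positive_right[of "\<bar>y\<bar>" "\<bar>x\<bar>"]]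
        order_trans[OF gabs_upper(1)[of y] le_mult_positive_left[of "\<bar>x\<bar>" "\<bar>y\<bar>"]]
      by (auto simp: gabs_ge_one)
    then show "x \<squnion> y \<in> ?k"
      using c by (intro between[OF xy(1) mult_k[OF abs_k(1)[OF xy(1)] abs_k(1)[OF xy(2)]]])
        (auto intro: gjoin_left gjoin_least)
    have "inv \<bar>x\<bar> \<otimes> inv \<bar>y\<bar> \<preceq> x" "inv \<bar>x\<bar> \<otimes> inv \<bar>y\<bar> \<preceq> y"
    proof -
      have "inv \<bar>x\<bar> \<preceq> \<one>" "inv \<bar>y\<bar> \<preceq> \<one>"
        using c inv_mono[OF gabs_ge_one[of x]] inv_mono[OF gabs_ge_one[of y]] by auto
      then show "inv \<bar>x\<bar> \<otimes> inv \<bar>y\<bar> \<preceq> x" "inv \<bar>x\<bar> \<otimes> inv \<bar>y\<bar> \<preceq> y"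
        using c mult_mono[of "inv \<bar>x\<bar>" x "inv \<bar>y\<bar>" \<one>] mult_mono[of "inv \<bar>x\<bar>" \<one> "inv \<bar>y\<bar>" y]
        by (auto simp: inv_gabs_le)
    qed
    then show "x \<sqinter> y \<in> ?k"
      using c
      by (intro between[OF mult_k[OF abs_k(2)[OF abs_k(1)[OF xy(1)]]
              abs_k(2)[OF abs_k(1)[OF xy(2)]]] xy(1)])
        (auto intro: gmeet_left gmeet_greatest)
  qed
  moreover have "subgroup ?k G"
    by (rule subgroupI) (use one abs_k mult_k in auto)
  ultimately show ?thesis
    unfolding convex_l_subgroup_def l_subgroup_def using between by blast
qed

lemma convex_l_subgroup_l_subgroup: "convex_l_subgroup k G \<Longrightarrow> l_subgroup k G"
  unfolding convex_l_subgroup_def by blast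

lemma convex_l_subgroupD:
  "\<lbrakk>convex_l_subgroup k G; a \<in> k; b \<in> k; x \<in> carrier G; a \<preceq> x; x \<preceq> b\<rbrakk> \<Longrightarrow> x \<in> k"
  unfolding convex_l_subgroup_def by blast

lemmas convex_l_subgroup_subset = l_subgroup_subset[OF convex_l_subgroup_l_subgroup]
  and convex_l_subgroup_one = l_subgroup_one[OF convex_l_subgroup_l_subgroup]
  and convex_l_subgroup_mult = l_subgroup_mult[OF convex_l_subgroup_l_subgroup]
  and convex_l_subgroup_inv = l_subgroup_inv[OF convex_l_subgroup_l_subgroup]
  and convex_l_subgroup_join = l_subgroup_join[OF convex_l_subgroup_l_subgroup]

lemma convex_l_subgroup_down:
  "\<lbrakk>convex_l_subgroup k G; \<one> \<preceq> x; x \<preceq> y; y \<in> k; x \<in> carrier G\<rbrakk> \<Longrightarrow> x \<in> k"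
  by (meson convex_l_subgroupD convex_l_subgroup_one)

lemma convex_l_subgroup_gabs_iff:
  assumes k: "convex_l_subgroup k G" and x: "x \<in> carrier G"
  shows "\<bar>x\<bar> \<in> k \<longleftrightarrow> x \<in> k"
proof
  assume "\<bar>x\<bar> \<in> k"
  then show "x \<in> k"
    using convex_l_subgroupD[OF k convex_l_subgroup_inv[OF k], of "\<bar>x\<bar>" "\<bar>x\<bar>" x] x
    by (simp add: gabs_upper inv_gabs_le)
next
  assume "x \<in> k"
  then show "\<bar>x\<bar> \<in> k"
    unfolding gabs_def by (intro convex_l_subgroup_join[OF k] convex_l_subgroup_inv[OF k])
qed

text \<open>The order of the right cosets of \<open>p\<close>, read as a pre-order on group
  elements; later arguments thus need no choice of representatives.\<close>

definition coset_le :: "'a set \<Rightarrow> 'a \<Rightarrow> 'a \<Rightarrow> bool" where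
  "coset_le p x y \<longleftrightarrow> (\<exists>t\<in>p. x \<preceq> t \<otimes> y)"

lemma coset_le_of_le:
  assumes "l_subgroup p G" "x \<preceq> y" "y \<in> carrier G" shows "coset_le p x y"
  unfolding coset_le_def using l_subgroup_one[OF assms(1)] assms by (intro bexI[of _ \<one>]) auto

lemma coset_le_trans:
  assumes p: "l_subgroup p G" and le: "coset_le p x y" "coset_le p y z"
    and c: "x \<in> carrier G" "y \<in> carrier G" "z \<in> carrier G"
  shows "coset_le p x z"
proof -
  obtain s t where st: "s \<in> p" "x \<preceq> s \<otimes> y" "t \<in> p" "y \<preceq> t \<otimes> z"
    using le by (auto simp: coset_le_def)
  then have sc: "s \<in> carrier G" "t \<in> carrier G" using l_subgroup_subset[OF p] by auto
  have "s \<otimes> y \<preceq> s \<otimes> (t \<otimes> z)" using st sc c by (simp add: mult_left_mono)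
  then have "x \<preceq> (s \<otimes> t) \<otimes> z"
    using order_trans[of x "s \<otimes> y" "s \<otimes> (t \<otimes> z)"] st sc c by (simp add: m_assoc)
  then show ?thesis
    unfolding coset_le_def using l_subgroup_mult[OF p, of s t] st by blast
qed

lemma coset_le_mult_right:
  assumes p: "l_subgroup p G" and le: "coset_le p x y"
    and c: "x \<in> carrier G" "y \<in> carrier G" "z \<in> carrier G"
  shows "coset_le p (x \<otimes> z) (y \<otimes> z)"
proof -
  obtain t where t: "t \<in> p" "x \<preceq> t \<otimes> y" using le by (auto simp: coset_le_def)
  then have "t \<in> carrier G" using l_subgroup_subset[OF p] by auto
  then have "x \<otimes> z \<preceq> t \<otimes> (y \<otimes> z)"
    using mult_right_mono[of x "t \<otimes> y" z] t c by (simp add: m_assoc)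
  then show ?thesis unfolding coset_le_def using t by blast
qed

text \<open>Both inequalities survive when the witnesses \<open>s\<close> and \<open>t\<close> are
  replaced by \<open>s \<squnion> t\<close>, which stays in \<open>p\<close>; with a common witness,
  multiplication distributes over the meet.\<close>

lemma coset_le_gmeet_iff:
  assumes p: "l_subgroup p G" and c: "x \<in> carrier G" "y \<in> carrier G" "z \<in> carrier G"
  shows "coset_le p x (y \<sqinter> z) \<longleftrightarrow> coset_le p x y \<and> coset_le p x z"
proof (intro iffI conjI)
  assume "coset_le p x y \<and> coset_le p x z"
  then obtain s t where st: "s \<in> p" "x \<preceq> s \<otimes> y" "t \<in> p" "x \<preceq> t \<otimes> z"
    by (auto simp: coset_le_def)
  then have sc: "s \<in> carrier G" "t \<in> carrier G" using l_subgroup_subset[OF p] by auto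
  have "s \<otimes> y \<preceq> (s \<squnion> t) \<otimes> y" "t \<otimes> z \<preceq> (s \<squnion> t) \<otimes> z"
    using sc c by (auto simp: mult_right_mono gjoin_left gjoin_right)
  then have "x \<preceq> (s \<squnion> t) \<otimes> y" "x \<preceq> (s \<squnion> t) \<otimes> z"
    using st sc c order_trans[of x "s \<otimes> y"] order_trans[of x "t \<otimes> z"] by auto
  then have "x \<preceq> (s \<squnion> t) \<otimes> (y \<sqinter> z)"
    using sc c by (simp add: mult_gmeet_left le_gmeet_iff)
  then show "coset_le p x (y \<sqinter> z)"
    unfolding coset_le_def using st l_subgroup_join[OF p] by blast
next
  assume *: "coset_le p x (y \<sqinter> z)"
  show "coset_le p x y"
    by (rule coset_le_trans[OF p * coset_le_of_le[OF p gmeet_left]]) (use c in simp_all)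
  show "coset_le p x z"
    by (rule coset_le_trans[OF p * coset_le_of_le[OF p gmeet_right]]) (use c in simp_all)
qed

lemma gjoin_coset_le_iff:
  assumes p: "l_subgroup p G" and c: "x \<in> carrier G" "y \<in> carrier G" "z \<in> carrier G"
  shows "coset_le p (y \<squnion> z) x \<longleftrightarrow> coset_le p y x \<and> coset_le p z x"
proof (intro iffI conjI)
  assume "coset_le p y x \<and> coset_le p z x"
  then obtain s t where st: "s \<in> p" "y \<preceq> s \<otimes> x" "t \<in> p" "z \<preceq> t \<otimes> x"
    by (auto simp: coset_le_def)
  then have sc: "s \<in> carrier G" "t \<in> carrier G" using l_subgroup_subset[OF p] by auto
  have "s \<otimes> x \<preceq> (s \<squnion> t) \<otimes> x" "t \<otimes> x \<preceq> (s \<squnion> t) \<otimes> x"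
    using sc c by (auto simp: mult_right_mono gjoin_left gjoin_right)
  then have "y \<preceq> (s \<squnion> t) \<otimes> x" "z \<preceq> (s \<squnion> t) \<otimes> x"
    using st sc c order_trans[of y "s \<otimes> x"] order_trans[of z "t \<otimes> x"] by auto
  then have "y \<squnion> z \<preceq> (s \<squnion> t) \<otimes> x"
    using sc c by (simp add: gjoin_le_iff)
  then show "coset_le p (y \<squnion> z) x"
    unfolding coset_le_def using st l_subgroup_join[OF p] by blast
next
  assume *: "coset_le p (y \<squnion> z) x"
  show "coset_le p y x"
    by (rule coset_le_trans[OF p coset_le_of_le[OF p gjoin_left] *]) (use c in simp_all)
  show "coset_le p z x"
    by (rule coset_le_trans[OF p coset_le_of_le[OF p gjoin_right] *]) (use c in simp_all)
qed

text \<open>The two witnesses enclose \<open>x \<otimes> inv y\<close> between \<open>inv t\<close>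
  and \<open>s\<close>, and convexity puts it into \<open>p\<close>. Hence equivalence under
  \<open>coset_le\<close> is equality of right cosets.\<close>

lemma coset_le_both_iff:
  assumes p: "convex_l_subgroup p G" and c: "x \<in> carrier G" "y \<in> carrier G"
  shows "coset_le p x y \<and> coset_le p y x \<longleftrightarrow> x \<otimes> inv y \<in> p"
proof
  assume "coset_le p x y \<and> coset_le p y x"
  then obtain s t where st: "s \<in> p" "x \<preceq> s \<otimes> y" "t \<in> p" "y \<preceq> t \<otimes> x"
    by (auto simp: coset_le_def)
  then have sc: "s \<in> carrier G" "t \<in> carrier G" using convex_l_subgroup_subset[OF p] by auto
  have "x \<otimes> inv y \<preceq> s" using st sc c by (simp add: mult_inv_right_le_iff)
  moreover have "inv t \<preceq> x \<otimes> inv y"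
    using st sc c by (simp add: le_mult_inv_right_iff mult_inv_le_iff)
  ultimately show "x \<otimes> inv y \<in> p"
    using convex_l_subgroupD[OF p convex_l_subgroup_inv[OF p st(3)] st(1)] c by simp
next
  assume *: "x \<otimes> inv y \<in> p"
  have "inv (x \<otimes> inv y) \<otimes> x = y" using c by (simp add: inv_mult_group m_assoc)
  moreover have "(x \<otimes> inv y) \<otimes> y = x" using c by (simp add: m_assoc)
  ultimately show "coset_le p x y \<and> coset_le p y x"
    unfolding coset_le_def using * convex_l_subgroup_inv[OF p *] c order_refl by metis
qed

lemma coset_le_one_both_iff:
  assumes "convex_l_subgroup p G" "x \<in> carrier G"
  shows "coset_le p x \<one> \<and> coset_le p \<one> x \<longleftrightarrow> x \<in> p"
  using coset_le_both_iff[OF assms one_closed] assms by simp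

lemma rcoset_eq_iff:
  assumes "subgroup p G" "x \<in> carrier G" "y \<in> carrier G"
  shows "p #> x = p #> y \<longleftrightarrow> x \<otimes> inv y \<in> p"
proof
  assume "p #> x = p #> y"
  then have "x \<in> p #> y" using rcos_self[OF assms(2,1)] by simp
  then show "x \<otimes> inv y \<in> p"
    using subgroup.rcos_module_imp[OF assms(1) is_group assms(3)] by blast
next
  assume "x \<otimes> inv y \<in> p"
  then have "x \<in> p #> y"
    using subgroup.rcos_module_rev[OF assms(1) is_group assms(3,2)] by blast
  then show "p #> x = p #> y"
    using repr_independence[OF _ assms(3,1)] by blast
qed

text \<open>\<open>coset_order\<close> asks for some pair of representatives. Changing
  representatives replaces elements by equivalent ones, so transitivity moves the inequality to the
  given pair.\<close>

lemma coset_order_le_iff: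
  assumes p: "convex_l_subgroup p G" and c: "x \<in> carrier G" "y \<in> carrier G"
  shows "(p #> x) \<sqsubseteq>\<^bsub>coset_order G p\<^esub> (p #> y) \<longleftrightarrow> coset_le p x y"
proof
  assume "(p #> x) \<sqsubseteq>\<^bsub>coset_order G p\<^esub> (p #> y)"
  then obtain x' y' where *: "x' \<in> carrier G" "y' \<in> carrier G" "p #> x = p #> x'" "p #> y = p #> y'"
      "coset_le p x' y'"
    unfolding coset_order_def coset_le_def gorder.simps by auto
  have lp: "l_subgroup p G" and sp: "subgroup p G"
    using p unfolding convex_l_subgroup_def l_subgroup_def by blast+
  have "coset_le p x x'" "coset_le p y' y"
    using *(3,4) coset_le_both_iff[OF p c(1) *(1)] coset_le_both_iff[OF p c(2) *(2)]
      rcoset_eq_iff[OF sp c(1) *(1)] rcoset_eq_iff[OF sp c(2) *(2)] by blast+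
  then show "coset_le p x y"
    using *(1,2,5) c coset_le_trans[OF lp, of x x' y'] coset_le_trans[OF lp, of x y' y] by blast
qed (use c in \<open>auto simp: coset_order_def coset_le_def\<close>)

lemma coset_order_total_iff:
  assumes p: "convex_l_subgroup p G"
  shows "total_order (coset_order G p) \<longleftrightarrow>
    (\<forall>x\<in>carrier G. \<forall>y\<in>carrier G. coset_le p x y \<or> coset_le p y x)"
proof -
  have lp: "l_subgroup p G" and sp: "subgroup p G"
    using p unfolding convex_l_subgroup_def l_subgroup_def by blast+
  have car: "X \<in> carrier (coset_order G p) \<longleftrightarrow> (\<exists>x\<in>carrier G. X = p #> x)" for X
    by (auto simp: coset_order_def RCOSETS_def)
  have eq: "(.=\<^bsub>coset_order G p\<^esub>) = (=)" by (simp add: coset_order_def)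
  have "partial_order (coset_order G p)"
  proof
    show "(.=\<^bsub>coset_order G p\<^esub>) = (=)" by (rule eq)
    fix X Y Z
    assume "X \<in> carrier (coset_order G p)" "Y \<in> carrier (coset_order G p)"
      "Z \<in> carrier (coset_order G p)"
    then obtain x y z where xyz: "x \<in> carrier G" "y \<in> carrier G" "z \<in> carrier G"
      "X = p #> x" "Y = p #> y" "Z = p #> z"
      unfolding car by blast
    show "X \<sqsubseteq>\<^bsub>coset_order G p\<^esub> Z" if "X \<sqsubseteq>\<^bsub>coset_order G p\<^esub> Y" "Y \<sqsubseteq>\<^bsub>coset_order G p\<^esub> Z"
      using that xyz coset_le_trans[OF lp, of x y z] by (auto simp: coset_order_le_iff[OF p])
  next
    fix X Y
    assume "X \<in> carrier (coset_order G p)" "Y \<in> carrier (coset_order G p)"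
    then obtain x y where xy: "x \<in> carrier G" "y \<in> carrier G" "X = p #> x" "Y = p #> y"
      unfolding car by blast
    show "X .=\<^bsub>coset_order G p\<^esub> Y"
      if "X \<sqsubseteq>\<^bsub>coset_order G p\<^esub> Y" "Y \<sqsubseteq>\<^bsub>coset_order G p\<^esub> X"
      using that xy coset_le_both_iff[OF p, of x y] rcoset_eq_iff[OF sp, of x y]
      by (auto simp: coset_order_le_iff[OF p] eq)
  next
    fix X assume "X \<in> carrier (coset_order G p)"
    then obtain x where "x \<in> carrier G" "X = p #> x" unfolding car by blast
    then show "X \<sqsubseteq>\<^bsub>coset_order G p\<^esub> X"
      using coset_le_of_le[OF lp order_refl] by (simp add: coset_order_le_iff[OF p])
  qed (simp_all add: eq)
  then have "total_order (coset_order G p) \<longleftrightarrow> (\<forall>X\<in>carrier (coset_order G p).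
      \<forall>Y\<in>carrier (coset_order G p). X \<sqsubseteq>\<^bsub>coset_order G p\<^esub> Y \<or> Y \<sqsubseteq>\<^bsub>coset_order G p\<^esub> X)"
    unfolding total_order_def total_order_axioms_def by blast
  also have "\<dots> \<longleftrightarrow> (\<forall>x\<in>carrier G. \<forall>y\<in>carrier G.
      (p #> x) \<sqsubseteq>\<^bsub>coset_order G p\<^esub> (p #> y) \<or> (p #> y) \<sqsubseteq>\<^bsub>coset_order G p\<^esub> (p #> x))"
    unfolding Ball_def car by blast
  finally show ?thesis
    by (simp add: coset_order_le_iff[OF p])
qed

text \<open>The working form of primeness. Under totality, a comparison of disjoint elements forces
  the smaller one into \<open>p\<close>. Conversely, dividing \<open>x\<close> and \<open>y\<close>
  by their meet gives a disjoint pair, and whichever member lies in \<open>p\<close> witnesses a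
  comparison.\<close>

lemma Spec_iff:
  "p \<in> Spec G \<longleftrightarrow> convex_l_subgroup p G \<and> p \<noteq> carrier G \<and>
    (\<forall>x\<in>carrier G. \<forall>y\<in>carrier G. x \<sqinter> y = \<one> \<longrightarrow> x \<in> p \<or> y \<in> p)"
proof -
  have "(\<forall>x\<in>carrier G. \<forall>y\<in>carrier G. coset_le p x y \<or> coset_le p y x) \<longleftrightarrow>
    (\<forall>x\<in>carrier G. \<forall>y\<in>carrier G. x \<sqinter> y = \<one> \<longrightarrow> x \<in> p \<or> y \<in> p)"
    if p: "convex_l_subgroup p G"
  proof (intro iffI ballI impI)
    fix x y
    assume tot: "\<forall>x\<in>carrier G. \<forall>y\<in>carrier G. coset_le p x y \<or> coset_le p y x"
      and c: "x \<in> carrier G" "y \<in> carrier G" and d: "x \<sqinter> y = \<one>"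
    have pos: "\<one> \<preceq> x" "\<one> \<preceq> y" using gmeet_left[of x y] gmeet_right[of x y] c d by auto
    \<comment> \<open>With |t| in place of \<open>t\<close>, \<open>u\<close> lies below the product
      of its meets with |t| and with \<open>v\<close>. The second meet is trivial, so
      \<open>u\<close> lies below |t|, and convexity applies.\<close>
    have mem: "u \<in> p" if le: "coset_le p u v" and uv: "u \<in> carrier G" "v \<in> carrier G"
      "\<one> \<preceq> u" "\<one> \<preceq> v" "u \<sqinter> v = \<one>" for u v
    proof -
      obtain t where t: "t \<in> p" "u \<preceq> t \<otimes> v" using le by (auto simp: coset_le_def)
      have tc: "t \<in> carrier G" using t convex_l_subgroup_subset[OF p] by auto
      have "t \<otimes> v \<preceq> \<bar>t\<bar> \<otimes> v" using tc uv by (simp add: mult_right_mono gabs_upper)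
      then have "u \<preceq> \<bar>t\<bar> \<otimes> v" using order_trans[OF t(2)] tc uv by simp
      then have "u \<preceq> (u \<sqinter> \<bar>t\<bar>) \<otimes> (u \<sqinter> v)"
        using gmeet_mult_le[of u "\<bar>t\<bar>" v] gmeet_absorb[of u "\<bar>t\<bar> \<otimes> v"] tc uv
        by (simp add: gabs_ge_one)
      then have "u \<preceq> u \<sqinter> \<bar>t\<bar>" using uv tc by simp
      then have "u \<preceq> \<bar>t\<bar>" using uv tc by (simp add: le_gmeet_iff)
      then show ?thesis
        using convex_l_subgroup_down[OF p uv(3)] convex_l_subgroup_gabs_iff[OF p tc] t(1) uv(1)
        by blast
    qed
    show "x \<in> p \<or> y \<in> p"
      using tot[rule_format, OF c] mem[of x y] mem[of y x] c pos d gmeet_comm[OF c] by auto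
  next
    fix x y
    assume pr: "\<forall>x\<in>carrier G. \<forall>y\<in>carrier G. x \<sqinter> y = \<one> \<longrightarrow> x \<in> p \<or> y \<in> p"
      and c: "x \<in> carrier G" "y \<in> carrier G"
    have le: "coset_le p u v"
      if "u \<otimes> inv (u \<sqinter> v) \<in> p" "u \<in> carrier G" "v \<in> carrier G" for u v
      unfolding coset_le_def
    proof (rule bexI[OF _ that(1)])
      have "\<one> \<preceq> u \<otimes> inv (u \<sqinter> v)" using that by (simp add: gmeet_translated)
      have "u \<preceq> (u \<otimes> inv (u \<sqinter> v)) \<otimes> (u \<sqinter> v)"
        using that by (simp add: m_assoc)
      moreover have "(u \<otimes> inv (u \<sqinter> v)) \<otimes> (u \<sqinter> v) \<preceq> (u \<otimes> inv (u \<sqinter> v)) \<otimes> v"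
        using that by (intro mult_left_mono gmeet_right) auto
      ultimately show "u \<preceq> (u \<otimes> inv (u \<sqinter> v)) \<otimes> v"
        using that by (meson gmeet_closed inv_closed m_closed order_trans)
    qed
    have "x \<otimes> inv (x \<sqinter> y) \<in> p \<or> y \<otimes> inv (x \<sqinter> y) \<in> p"
      using pr gmeet_translated(1)[OF c] c by (meson gmeet_closed inv_closed m_closed)
    then show "coset_le p x y \<or> coset_le p y x"
      using le[of x y] le[of y x] c gmeet_comm[OF c] by auto
  qed
  note * = this
  show ?thesis
  proof (cases "convex_l_subgroup p G")
    case True
    then show ?thesis
      unfolding Spec_def mem_Collect_eq coset_order_total_iff[OF True] *[OF True] by simp
  next
    case False
    then show ?thesis unfolding Spec_def mem_Collect_eq by simp
  qed
qed

lemma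
  assumes "p \<in> Spec G"
  shows Spec_convex: "convex_l_subgroup p G"
    and Spec_proper: "p \<noteq> carrier G"
    and Spec_l_subgroup: "l_subgroup p G"
    and Spec_disjoint: "\<lbrakk>x \<sqinter> y = \<one>; x \<in> carrier G; y \<in> carrier G\<rbrakk> \<Longrightarrow> x \<in> p \<or> y \<in> p"
  using assms[unfolded Spec_iff] convex_l_subgroup_l_subgroup by blast+

lemma Spec_coset_le_total:
  "\<lbrakk>p \<in> Spec G; x \<in> carrier G; y \<in> carrier G\<rbrakk> \<Longrightarrow> coset_le p x y \<or> coset_le p y x"
  using coset_order_total_iff[of p] unfolding Spec_def by simp

text \<open>Each of \<open>x\<close> and \<open>y\<close> is its disjoint part times
  \<open>x \<sqinter> y\<close>. One disjoint part lies in \<open>p\<close>, and the second factor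
  does by assumption.\<close>

lemma Spec_gmeet:
  assumes p: "p \<in> Spec G" and c: "x \<in> carrier G" "y \<in> carrier G" and m: "x \<sqinter> y \<in> p"
  shows "x \<in> p \<or> y \<in> p"
proof -
  have mem: "u \<in> p" if "u \<otimes> inv (x \<sqinter> y) \<in> p" "u \<in> carrier G" for u
    using convex_l_subgroup_mult[OF Spec_convex[OF p] that(1) m] that(2) c by (simp add: m_assoc)
  show ?thesis
    using Spec_disjoint[OF p gmeet_translated(1)[OF c]] mem c by auto
qed

text \<open>Here totality enters: the join is equivalent to one of its arguments, which makes the
  condition a disjunction. With the join on the left, \<open>gjoin_coset_le_iff\<close> gives a
  conjunction for every l-subgroup.\<close>

lemma Spec_coset_le_gjoin_iff:
  assumes p: "p \<in> Spec G" and c: "x \<in> carrier G" "y \<in> carrier G" "z \<in> carrier G"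
  shows "coset_le p x (y \<squnion> z) \<longleftrightarrow> coset_le p x y \<or> coset_le p x z"
proof -
  note lp = Spec_l_subgroup[OF p]
  have "coset_le p (y \<squnion> z) y \<or> coset_le p (y \<squnion> z) z"
    using Spec_coset_le_total[OF p c(2,3)] gjoin_coset_le_iff[OF lp c(2) c(2,3)]
      gjoin_coset_le_iff[OF lp c(3) c(2,3)] coset_le_of_le[OF lp order_refl, of y]
      coset_le_of_le[OF lp order_refl, of z] c by argo
  moreover have "coset_le p y (y \<squnion> z)" "coset_le p z (y \<squnion> z)"
    using c by (auto intro!: coset_le_of_le[OF lp] gjoin_left gjoin_right)
  ultimately show ?thesis
    using coset_le_trans[OF lp, of x "y \<squnion> z" y] coset_le_trans[OF lp, of x "y \<squnion> z" z]
      coset_le_trans[OF lp, of x y "y \<squnion> z"] coset_le_trans[OF lp, of x z "y \<squnion> z"]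
      c gjoin_closed[OF c(2,3)] by argo
qed

lemma Spec_gmeet_coset_le_iff:
  assumes p: "p \<in> Spec G" and c: "x \<in> carrier G" "y \<in> carrier G" "z \<in> carrier G"
  shows "coset_le p (y \<sqinter> z) x \<longleftrightarrow> coset_le p y x \<or> coset_le p z x"
proof -
  note lp = Spec_l_subgroup[OF p]
  have "coset_le p y (y \<sqinter> z) \<or> coset_le p z (y \<sqinter> z)"
    using Spec_coset_le_total[OF p c(2,3)] coset_le_gmeet_iff[OF lp c(2) c(2,3)]
      coset_le_gmeet_iff[OF lp c(3) c(2,3)] coset_le_of_le[OF lp order_refl, of y]
      coset_le_of_le[OF lp order_refl, of z] c by argo
  moreover have "coset_le p (y \<sqinter> z) y" "coset_le p (y \<sqinter> z) z"
    using c by (auto intro!: coset_le_of_le[OF lp] gmeet_left gmeet_right)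
  ultimately show ?thesis
    using coset_le_trans[OF lp, of y "y \<sqinter> z" x] coset_le_trans[OF lp, of z "y \<sqinter> z" x]
      coset_le_trans[OF lp, of "y \<sqinter> z" y x] coset_le_trans[OF lp, of "y \<sqinter> z" z x]
      c gmeet_closed[OF c(2,3)] by argo
qed

section \<open>Minimal primes and polars\<close>

text \<open>A filter base of the positive cone. Excluding the identity is properness: two disjoint
  elements can never both belong.\<close>

definition meet_system :: "'a set \<Rightarrow> bool" where
  "meet_system U \<longleftrightarrow> U \<noteq> {} \<and> U \<subseteq> positive_cone G \<and> \<one> \<notin> U \<and> (\<forall>x\<in>U. \<forall>y\<in>U. x \<sqinter> y \<in> U)"

text \<open>If \<open>U\<close> is a maximal meet system, this is the corresponding minimal prime.\<close>

definition annihilated :: "'a set \<Rightarrow> 'a set" where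
  "annihilated U = {z \<in> carrier G. \<exists>u\<in>U. \<bar>z\<bar> \<sqinter> u = \<one>}"

lemma positive_cone_gmeet: "\<lbrakk>x \<in> positive_cone G; y \<in> positive_cone G\<rbrakk> \<Longrightarrow> x \<sqinter> y \<in> positive_cone G"
  by (simp add: positive_cone_def one_le_gmeet)

lemma positive_cone_gjoin: "\<lbrakk>x \<in> positive_cone G; y \<in> positive_cone G\<rbrakk> \<Longrightarrow> x \<squnion> y \<in> positive_cone G"
  by (simp add: positive_cone_def one_le_gjoin)

lemma positive_cone_mult: "\<lbrakk>x \<in> positive_cone G; y \<in> positive_cone G\<rbrakk> \<Longrightarrow> x \<otimes> y \<in> positive_cone G"
  by (simp add: positive_cone_def one_le_mult)

text \<open>The enlargement step for Zorn's lemma: the meets with \<open>x\<close> are adjoined.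
  None of them is trivial, and meets of new elements again have the form
  \<open>x \<sqinter> (u \<sqinter> v)\<close>.\<close>

lemma meet_system_extend:
  assumes M: "meet_system M" and x: "x \<in> positive_cone G" and ne: "\<And>u. u \<in> M \<Longrightarrow> x \<sqinter> u \<noteq> \<one>"
  shows "meet_system (M \<union> (\<lambda>u. x \<sqinter> u) ` M)"
proof -
  have xc: "x \<in> carrier G" using x by (rule positive_cone_closed)
  have M': "\<And>u. u \<in> M \<Longrightarrow> u \<in> carrier G" "\<And>u. u \<in> M \<Longrightarrow> u \<in> positive_cone G"
    "\<And>u v. u \<in> M \<Longrightarrow> v \<in> M \<Longrightarrow> u \<sqinter> v \<in> M"
    using M by (auto simp: meet_system_def positive_cone_def)
  have idem: "x \<sqinter> u \<sqinter> (x \<sqinter> v) = x \<sqinter> (u \<sqinter> v)" if "u \<in> M" "v \<in> M" for u v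
    using that xc M'(1)
    by (metis gmeet_absorb gmeet_assoc gmeet_closed gmeet_left_comm order_refl)
  have l: "x \<sqinter> u \<sqinter> v = x \<sqinter> (u \<sqinter> v)" "v \<sqinter> (x \<sqinter> u) = x \<sqinter> (v \<sqinter> u)" if "u \<in> M" "v \<in> M" for u v
    using that xc M'(1) by (auto simp: gmeet_assoc gmeet_left_comm[of v x])
  show ?thesis
    unfolding meet_system_def
  proof (intro conjI ballI)
    fix a b assume "a \<in> M \<union> (\<lambda>u. x \<sqinter> u) ` M" "b \<in> M \<union> (\<lambda>u. x \<sqinter> u) ` M"
    then show "a \<sqinter> b \<in> M \<union> (\<lambda>u. x \<sqinter> u) ` M"
      using M'(3) by (elim UnE imageE) (simp_all add: idem l)
  next
    show "\<one> \<notin> M \<union> (\<lambda>u. x \<sqinter> u) ` M"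
      using M ne by (force simp: meet_system_def)
  qed (use M M' x in \<open>auto simp: meet_system_def positive_cone_gmeet\<close>)
qed

text \<open>Maximality is recorded in the form that \<open>meet_system_extend\<close> yields: an
  \<open>x\<close> disjoint from no member of \<open>U\<close> has all its meets with members in
  \<open>U\<close>.\<close>

lemma maximal_meet_system:
  assumes M: "meet_system M"
  obtains U where "M \<subseteq> U" "meet_system U"
    "\<forall>x\<in>positive_cone G. (\<forall>v\<in>U. x \<sqinter> v \<noteq> \<one>) \<longrightarrow> (\<forall>u\<in>U. x \<sqinter> u \<in> U)"
proof -
  let ?A = "{U. meet_system U \<and> M \<subseteq> U}"
  have "\<exists>U\<in>?A. \<forall>X\<in>?A. U \<subseteq> X \<longrightarrow> X = U"
  proof (rule subset_Zorn_nonempty)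
    fix C assume C: "C \<noteq> {}" "subset.chain ?A C"
    then have CA: "\<And>X. X \<in> C \<Longrightarrow> meet_system X \<and> M \<subseteq> X"
      by (auto simp: subset_chain_def)
    have "x \<sqinter> y \<in> \<Union>C" if "x \<in> \<Union>C" "y \<in> \<Union>C" for x y
    proof -
      obtain X Y where XY: "X \<in> C" "x \<in> X" "Y \<in> C" "y \<in> Y" using \<open>x \<in> \<Union>C\<close> \<open>y \<in> \<Union>C\<close> by blast
      moreover have "X \<subseteq> Y \<or> Y \<subseteq> X" using C(2) XY by (auto simp: subset_chain_def)
      ultimately obtain Z where "Z \<in> C" "x \<in> Z" "y \<in> Z" by blast
      then show ?thesis using CA[of Z] unfolding meet_system_def by blast
    qed
    moreover have "\<Union>C \<subseteq> positive_cone G" "\<one> \<notin> \<Union>C" "\<Union>C \<noteq> {}" "M \<subseteq> \<Union>C"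
      using CA C(1) by (fastforce simp: meet_system_def)+
    ultimately show "\<Union>C \<in> ?A"
      unfolding meet_system_def by blast
  qed (use M in blast)
  then obtain U where U: "meet_system U" "M \<subseteq> U"
    and max: "\<And>X. \<lbrakk>meet_system X; M \<subseteq> X; U \<subseteq> X\<rbrakk> \<Longrightarrow> X = U" by auto
  show ?thesis
  proof (rule that[OF U(2,1)], intro ballI impI)
    fix x u assume x: "x \<in> positive_cone G" and ne: "\<forall>v\<in>U. x \<sqinter> v \<noteq> \<one>" and u: "u \<in> U"
    have "U \<union> (\<lambda>u. x \<sqinter> u) ` U = U"
      by (rule max[OF meet_system_extend[OF U(1) x]]) (use U(2) ne in auto)
    then show "x \<sqinter> u \<in> U" using u by blast
  qed
qed

text \<open>\<open>annihilated U\<close> is the union of the polars of the members of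
  \<open>U\<close>. Closure of \<open>U\<close> under meets makes this union directed, hence a
  subgroup; maximality makes it prime.\<close>

lemma Min_annihilated:
  assumes U: "meet_system U"
    and max: "\<forall>x\<in>positive_cone G. (\<forall>v\<in>U. x \<sqinter> v \<noteq> \<one>) \<longrightarrow> (\<forall>u\<in>U. x \<sqinter> u \<in> U)"
  shows "annihilated U \<in> inclusion_minimal (Spec G)" and "u \<in> U \<Longrightarrow> u \<notin> annihilated U"
proof -
  have U': "\<And>u. u \<in> U \<Longrightarrow> u \<in> carrier G" "\<And>u. u \<in> U \<Longrightarrow> \<one> \<preceq> u"
    "\<And>u v. u \<in> U \<Longrightarrow> v \<in> U \<Longrightarrow> u \<sqinter> v \<in> U" "\<one> \<notin> U" "U \<noteq> {}"
    using U by (auto simp: meet_system_def positive_cone_def)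
  let ?I = "{z \<in> positive_cone G. \<exists>u\<in>U. z \<sqinter> u = \<one>}"
  have pc: "z \<in> positive_cone G \<longleftrightarrow> z \<in> carrier G \<and> \<one> \<preceq> z" for z
    by (simp add: positive_cone_def)
  have "convex_l_subgroup {z \<in> carrier G. \<bar>z\<bar> \<in> ?I} G"
  proof (rule convex_l_subgroup_of_ideal)
    obtain u where "u \<in> U" using U' by auto
    then show "\<one> \<in> ?I"
      using U' gmeet_absorb[of \<one> u] by (auto simp: pc)
  next
    fix x y assume "x \<in> ?I" "y \<in> ?I"
    then obtain u v where xy: "x \<in> positive_cone G" "u \<in> U" "x \<sqinter> u = \<one>"
      "y \<in> positive_cone G" "v \<in> U" "y \<sqinter> v = \<one>" by blast
    have m: "(u \<sqinter> v) \<sqinter> w = \<one>" if "w \<sqinter> u = \<one> \<or> w \<sqinter> v = \<one>" "w \<in> positive_cone G" for w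
      using that disjoint_mono[of w u "u \<sqinter> v"] disjoint_mono[of w v "u \<sqinter> v"] xy U'
        gmeet_comm[of w "u \<sqinter> v"]
      by (auto simp: pc gmeet_left gmeet_right)
    have "(u \<sqinter> v) \<sqinter> (x \<otimes> y) = \<one>"
      by (rule disjoint_mult) (use m[of x] m[of y] xy U' in \<open>auto simp: pc\<close>)
    then have "(x \<otimes> y) \<sqinter> (u \<sqinter> v) = \<one>"
      using gmeet_comm[of "x \<otimes> y" "u \<sqinter> v"] xy U' by (simp add: pc)
    moreover have "x \<otimes> y \<in> positive_cone G" using xy by (simp add: positive_cone_mult)
    ultimately show "x \<otimes> y \<in> ?I" using U'(3)[OF xy(2,5)] by blast
  next
    fix x y assume x: "x \<in> positive_cone G" "y \<in> ?I" "x \<preceq> y"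
    then obtain u where y: "y \<in> positive_cone G" "u \<in> U" "y \<sqinter> u = \<one>" by blast
    then have "u \<sqinter> x = \<one>"
      using disjoint_mono[of u y x] x(1,3) U' gmeet_comm[of u y] by (auto simp: pc)
    then show "x \<in> ?I" using x(1) y U' gmeet_comm[of u x] by (auto simp: pc)
  qed blast
  moreover have "{z \<in> carrier G. \<bar>z\<bar> \<in> ?I} = annihilated U"
    by (auto simp: annihilated_def)
  ultimately have conv: "convex_l_subgroup (annihilated U) G" by simp
  show notin: "u \<notin> annihilated U" if "u \<in> U" for u
    using that U' gabs_eq[of u] by (auto simp: annihilated_def) metis
  have "x \<in> annihilated U \<or> y \<in> annihilated U"
    if c: "x \<in> carrier G" "y \<in> carrier G" and d: "x \<sqinter> y = \<one>" for x y
  proof (cases "\<exists>v\<in>U. x \<sqinter> v = \<one>")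
    have pos: "\<one> \<preceq> x" "\<one> \<preceq> y" using gmeet_left[of x y] gmeet_right[of x y] c d by auto
    case True
    then show ?thesis using c pos by (auto simp: annihilated_def gabs_eq)
  next
    have pos: "\<one> \<preceq> x" "\<one> \<preceq> y" using gmeet_left[of x y] gmeet_right[of x y] c d by auto
    case False
    obtain u where u: "u \<in> U" using U' by auto
    \<comment> \<open>As \<open>x\<close> is disjoint from no member, maximality puts
      \<open>x \<sqinter> u\<close> into \<open>U\<close>; \<open>y\<close>, being disjoint from
      \<open>x\<close>, is disjoint from this member.\<close>
    then have "x \<sqinter> u \<in> U" using max False pos c by (auto simp: pc)
    moreover have "y \<sqinter> (x \<sqinter> u) = \<one>"
      using disjoint_mono[of y x "x \<sqinter> u"] pos c U' u d gmeet_comm[of x y]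
      by (auto simp: one_le_gmeet gmeet_left)
    ultimately show ?thesis using c pos by (auto simp: annihilated_def gabs_eq)
  qed
  moreover have "annihilated U \<noteq> carrier G" using notin U' by blast
  ultimately have spec: "annihilated U \<in> Spec G"
    using conv by (simp add: Spec_iff)
  show "annihilated U \<in> inclusion_minimal (Spec G)"
    unfolding inclusion_minimal_def
  proof (intro CollectI conjI spec ballI impI subset_antisym)
    fix q assume q: "q \<in> Spec G" "q \<subseteq> annihilated U"
    show "annihilated U \<subseteq> q"
    proof
      fix z assume "z \<in> annihilated U"
      then obtain u where z: "z \<in> carrier G" "u \<in> U" "\<bar>z\<bar> \<sqinter> u = \<one>" by (auto simp: annihilated_def)
      \<comment> \<open>A prime below \<open>annihilated U\<close> omits every member of
        \<open>U\<close>, so primeness forces into it whatever is disjoint from one of them.\<close>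
      then have "u \<notin> q" using notin q(2) by blast
      then have "\<bar>z\<bar> \<in> q" using Spec_disjoint[OF q(1) z(3)] z U' by auto
      then show "z \<in> q" using convex_l_subgroup_gabs_iff[OF Spec_convex[OF q(1)] z(1)] by blast
    qed
  qed
qed

lemma Min_Spec: "p \<in> inclusion_minimal (Spec G) \<Longrightarrow> p \<in> Spec G"
  by (simp add: inclusion_minimal_def)

text \<open>A maximal meet system through |x| gives a minimal prime omitting |x|. This converts
  statements about all minimal primes into equations in the group.\<close>

lemma Min_separates:
  assumes "x \<in> carrier G" "x \<noteq> \<one>"
  obtains p where "p \<in> inclusion_minimal (Spec G)" "x \<notin> p"
proof -
  have "meet_system {\<bar>x\<bar>}"
    using assms gabs_eq_one[of x] gmeet_absorb[of "\<bar>x\<bar>" "\<bar>x\<bar>"] by (auto simp: meet_system_def)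
  then obtain U where U: "{\<bar>x\<bar>} \<subseteq> U" "meet_system U"
    "\<forall>x\<in>positive_cone G. (\<forall>v\<in>U. x \<sqinter> v \<noteq> \<one>) \<longrightarrow> (\<forall>u\<in>U. x \<sqinter> u \<in> U)"
    by (rule maximal_meet_system)
  note min = Min_annihilated[OF U(2,3)]
  have "\<bar>x\<bar> \<notin> annihilated U" using min(2)[of "\<bar>x\<bar>"] U(1) by simp
  then have "x \<notin> annihilated U"
    using convex_l_subgroup_gabs_iff[OF Spec_convex[OF Min_Spec[OF min(1)]] assms(1)] by simp
  with min(1) show ?thesis by (rule that)
qed

text \<open>If every positive element outside \<open>p\<close> met |x| nontrivially, these elements
  and their meets with |x| would lie in a maximal meet system \<open>U\<close>. Then
  \<open>annihilated U\<close> is contained in \<open>p\<close>, hence equal to it by minimality,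
  although it omits the meets of |x| with such elements, which convexity puts into
  \<open>p\<close>.\<close>

lemma Min_mem_iff:
  assumes p: "p \<in> inclusion_minimal (Spec G)" and x: "x \<in> carrier G"
  shows "x \<in> p \<longleftrightarrow> (\<exists>y\<in>positive_cone G. y \<notin> p \<and> \<bar>x\<bar> \<sqinter> y = \<one>)"
proof
  note sp = Min_Spec[OF p]
  note conv = Spec_convex[OF sp]
  assume xp: "x \<in> p"
  show "\<exists>y\<in>positive_cone G. y \<notin> p \<and> \<bar>x\<bar> \<sqinter> y = \<one>"
  proof (rule ccontr)
    assume no: "\<not> ?thesis"
    let ?M = "positive_cone G - p"
    have "?M \<noteq> {}"
    proof -
      obtain z where z: "z \<in> carrier G" "z \<notin> p"
        using Spec_proper[OF sp] convex_l_subgroup_subset[OF conv] by blast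
      then have "\<bar>z\<bar> \<in> ?M" using convex_l_subgroup_gabs_iff[OF conv z(1)] by simp
      then show ?thesis by blast
    qed
    moreover have "u \<sqinter> v \<in> ?M" if "u \<in> ?M" "v \<in> ?M" for u v
      using that Spec_gmeet[OF sp, of u v] positive_cone_gmeet[of u v]
      by (auto dest: positive_cone_closed)
    ultimately have "meet_system ?M"
      using convex_l_subgroup_one[OF conv] by (simp add: meet_system_def)
    then have "meet_system (?M \<union> (\<lambda>u. \<bar>x\<bar> \<sqinter> u) ` ?M)"
      by (rule meet_system_extend) (use no x in auto)
    then obtain U where U: "?M \<union> (\<lambda>u. \<bar>x\<bar> \<sqinter> u) ` ?M \<subseteq> U" "meet_system U"
      "\<forall>x\<in>positive_cone G. (\<forall>v\<in>U. x \<sqinter> v \<noteq> \<one>) \<longrightarrow> (\<forall>u\<in>U. x \<sqinter> u \<in> U)"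
      by (rule maximal_meet_system)
    note min = Min_annihilated[OF U(2,3)]
    have "annihilated U \<subseteq> p"
    proof
      fix z assume "z \<in> annihilated U"
      then obtain u where z: "z \<in> carrier G" "u \<in> U" "\<bar>z\<bar> \<sqinter> u = \<one>" by (auto simp: annihilated_def)
      have "\<bar>z\<bar> \<notin> U" using U(2) z(2,3) unfolding meet_system_def by metis
      then have "\<bar>z\<bar> \<in> p" using U(1) gabs_positive[OF z(1)] by blast
      then show "z \<in> p" using convex_l_subgroup_gabs_iff[OF conv z(1)] by simp
    qed
    then have eq: "annihilated U = p"
      using p Min_Spec[OF min(1)] by (auto simp: inclusion_minimal_def)
    obtain u where u: "u \<in> ?M" using \<open>?M \<noteq> {}\<close> by blast
    then have "\<bar>x\<bar> \<sqinter> u \<notin> p" using min(2)[of "\<bar>x\<bar> \<sqinter> u"] U(1) eq by blast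
    moreover have uc: "u \<in> carrier G" "\<one> \<preceq> u" using u by (auto simp: positive_cone_def)
    moreover have "\<bar>x\<bar> \<in> p" using xp convex_l_subgroup_gabs_iff[OF conv x] by simp
    ultimately show False
      using convex_l_subgroup_down[OF conv, of "\<bar>x\<bar> \<sqinter> u" "\<bar>x\<bar>"] x
      by (simp add: one_le_gmeet gabs_ge_one gmeet_left)
  qed
next
  assume "\<exists>y\<in>positive_cone G. y \<notin> p \<and> \<bar>x\<bar> \<sqinter> y = \<one>"
  then show "x \<in> p"
    using Spec_disjoint[OF Min_Spec[OF p], of "\<bar>x\<bar>"] x
      convex_l_subgroup_gabs_iff[OF Spec_convex[OF Min_Spec[OF p]] x]
    by (auto dest: positive_cone_closed)
qed

section \<open>Polars and complements\<close>

lemma perp_subset: "perp G S \<subseteq> carrier G"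
  by (auto simp: perp_def)

lemma perp_antimono: "S \<subseteq> T \<Longrightarrow> perp G T \<subseteq> perp G S"
  by (auto simp: perp_def)

lemma perp_Un: "perp G (S \<union> T) = perp G S \<inter> perp G T"
  by (auto simp: perp_def)

lemma subset_perp_perp: "S \<subseteq> carrier G \<Longrightarrow> S \<subseteq> perp G (perp G S)"
  unfolding perp_def using gmeet_comm gabs_closed by (fastforce simp: subset_iff)

lemma perp_perp_perp: "S \<subseteq> carrier G \<Longrightarrow> perp G (perp G (perp G S)) = perp G S"
  by (meson perp_antimono perp_subset subset_antisym subset_perp_perp)

lemma mem_perp_singleton:
  "x \<in> positive_cone G \<Longrightarrow> z \<in> perp G {x} \<longleftrightarrow> z \<in> carrier G \<and> \<bar>z\<bar> \<sqinter> x = \<one>"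
  by (simp add: perp_def positive_cone_def gabs_eq)

lemma perp_gabs: "x \<in> carrier G \<Longrightarrow> perp G {\<bar>x\<bar>} = perp G {x}"
  by (simp add: perp_def)

lemma perp_carrier: "perp G (carrier G) = {\<one>}"
proof -
  have "z = \<one>" if "z \<in> perp G (carrier G)" for z
    using that gmeet_absorb[of "\<bar>z\<bar>" "\<bar>z\<bar>"] gabs_eq_one[of z] by (auto simp: perp_def)
  moreover have "\<one> \<in> perp G (carrier G)"
    by (auto simp: perp_def gabs_ge_one gmeet_absorb)
  ultimately show ?thesis by blast
qed

lemma perp_one: "perp G {\<one>} = carrier G"
proof -
  have "\<bar>z\<bar> \<sqinter> \<one> = \<one>" if "z \<in> carrier G" for z
    using that gmeet_absorb[of \<one> "\<bar>z\<bar>"] gmeet_comm[of \<one> "\<bar>z\<bar>"] by (simp add: gabs_ge_one)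
  then show ?thesis by (auto simp: perp_def)
qed

lemma perp_gjoin:
  assumes "x \<in> positive_cone G" "y \<in> positive_cone G"
  shows "perp G {x \<squnion> y} = perp G {x} \<inter> perp G {y}"
  using assms positive_cone_gjoin[OF assms]
  by (auto simp: mem_perp_singleton disjoint_gjoin_iff gabs_ge_one positive_cone_closed positive_cone_ge)

lemma perp_perp_gmeet:
  assumes x: "x \<in> positive_cone G" and y: "y \<in> positive_cone G"
  shows "perp G (perp G {x \<sqinter> y}) = perp G (perp G {x}) \<inter> perp G (perp G {y})"
proof (intro subset_antisym Int_greatest)
  note c = positive_cone_closed[OF x] positive_cone_closed[OF y]
  note ge = positive_cone_ge[OF x] positive_cone_ge[OF y]
  note xy = positive_cone_gmeet[OF x y]
  have "z \<in> perp G {x \<sqinter> y}" if "z \<in> perp G {x} \<or> z \<in> perp G {y}" for z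
    using that disjoint_mono[of "\<bar>z\<bar>" x "x \<sqinter> y"] disjoint_mono[of "\<bar>z\<bar>" y "x \<sqinter> y"] c ge
    by (auto simp: mem_perp_singleton x y xy gabs_ge_one one_le_gmeet gmeet_left gmeet_right)
  then show "perp G (perp G {x \<sqinter> y}) \<subseteq> perp G (perp G {x})"
    "perp G (perp G {x \<sqinter> y}) \<subseteq> perp G (perp G {y})"
    by (blast intro: perp_antimono[THEN subsetD])+
  show "perp G (perp G {x}) \<inter> perp G (perp G {y}) \<subseteq> perp G (perp G {x \<sqinter> y})"
  proof
    fix z assume z: "z \<in> perp G (perp G {x}) \<inter> perp G (perp G {y})"
    then have zc: "z \<in> carrier G" using perp_subset by blast
    have zx: "\<bar>z\<bar> \<sqinter> \<bar>w\<bar> = \<one>" if "w \<in> perp G {x} \<or> w \<in> perp G {y}" for w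
      using that z by (auto simp: perp_def)
    \<comment> \<open>Disjointness is used twice. The meet of |w| and \<open>x\<close> is disjoint
      from \<open>y\<close>, so \<open>z\<close>, in the double polar of \<open>y\<close>, is
      disjoint from it. Hence the meet of |z| and |w| is disjoint from \<open>x\<close>, and the
      double polar of \<open>x\<close> makes it disjoint from |z|, which lies above it.\<close>
    have "\<bar>z\<bar> \<sqinter> \<bar>w\<bar> = \<one>" if "w \<in> perp G {x \<sqinter> y}" for w
    proof -
      have w: "w \<in> carrier G" "\<bar>w\<bar> \<sqinter> (x \<sqinter> y) = \<one>" using that by (auto simp: mem_perp_singleton xy)
      have pos: "\<one> \<preceq> \<bar>w\<bar> \<sqinter> x" using w c ge by (simp add: one_le_gmeet gabs_ge_one)
      then have "\<bar>w\<bar> \<sqinter> x \<in> perp G {y}"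
        using w c by (simp add: mem_perp_singleton y gabs_eq gmeet_assoc)
      then have "\<bar>z\<bar> \<sqinter> (\<bar>w\<bar> \<sqinter> x) = \<one>"
        using zx[of "\<bar>w\<bar> \<sqinter> x"] w c pos by (simp add: gabs_eq)
      moreover have pos': "\<one> \<preceq> \<bar>z\<bar> \<sqinter> \<bar>w\<bar>" using w zc by (simp add: one_le_gmeet gabs_ge_one)
      ultimately have "\<bar>z\<bar> \<sqinter> \<bar>w\<bar> \<in> perp G {x}"
        using w c zc by (simp add: mem_perp_singleton x gabs_eq gmeet_assoc)
      then have "\<bar>z\<bar> \<sqinter> (\<bar>z\<bar> \<sqinter> \<bar>w\<bar>) = \<one>"
        using zx[of "\<bar>z\<bar> \<sqinter> \<bar>w\<bar>"] w zc pos' by (simp add: gabs_eq)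
      then show ?thesis
        using w zc gmeet_absorb[of "\<bar>z\<bar>" "\<bar>z\<bar>"] by (simp flip: gmeet_assoc)
    qed
    then show "z \<in> perp G (perp G {x \<sqinter> y})"
      using zc by (auto simp: perp_def)
  qed
qed

text \<open>The bridge from elements to polars: \<open>x \<sqinter> y = \<one>\<close> places
  \<open>y\<close> in the polar of \<open>x\<close>, and \<open>x \<squnion> y\<close> is a weak
  unit exactly if the polars of \<open>x\<close> and \<open>y\<close> intersect trivially, because
  the polar of a join is that intersection.\<close>

lemma complement_iff_perp:
  assumes x: "x \<in> positive_cone G" and y: "y \<in> positive_cone G"
  shows "x \<sqinter> y = \<one> \<and> weak_unit G (x \<squnion> y) \<longleftrightarrow> perp G {x} = perp G (perp G {y})"
proof
  note c = positive_cone_closed[OF x] positive_cone_closed[OF y]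
  have wu: "weak_unit G (x \<squnion> y) \<longleftrightarrow> perp G {x} \<inter> perp G {y} \<subseteq> {\<one>}"
  proof -
    have "weak_unit G (x \<squnion> y) \<longleftrightarrow> perp G {x \<squnion> y} \<subseteq> {\<one>}"
      using positive_cone_gjoin[OF x y] c
      by (auto simp: weak_unit_def mem_perp_singleton gmeet_comm)
    then show ?thesis by (simp add: perp_gjoin x y)
  qed
  have d: "x \<sqinter> y = \<one> \<longleftrightarrow> y \<in> perp G {x}"
    using c x y by (auto simp: mem_perp_singleton gabs_eq positive_cone_ge gmeet_comm)
  show "perp G {x} = perp G (perp G {y})" if *: "x \<sqinter> y = \<one> \<and> weak_unit G (x \<squnion> y)"
  proof
    have "{y} \<subseteq> perp G {x}" using * d by blast
    then have "perp G (perp G {y}) \<subseteq> perp G (perp G (perp G {x}))"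
      by (intro perp_antimono)
    then show "perp G (perp G {y}) \<subseteq> perp G {x}" using c by (simp add: perp_perp_perp)
    show "perp G {x} \<subseteq> perp G (perp G {y})"
    proof
      fix z assume z: "z \<in> perp G {x}"
      have "\<bar>z\<bar> \<sqinter> \<bar>w\<bar> = \<one>" if w: "w \<in> perp G {y}" for w
      proof -
        have zw: "z \<in> carrier G" "w \<in> carrier G" "\<bar>z\<bar> \<sqinter> x = \<one>" "\<bar>w\<bar> \<sqinter> y = \<one>"
          using z w by (auto simp: mem_perp_singleton x y)
        have pos: "\<one> \<preceq> \<bar>z\<bar> \<sqinter> \<bar>w\<bar>" using zw by (simp add: one_le_gmeet gabs_ge_one)
        have "x \<sqinter> (\<bar>z\<bar> \<sqinter> \<bar>w\<bar>) = \<one>" "y \<sqinter> (\<bar>z\<bar> \<sqinter> \<bar>w\<bar>) = \<one>"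
          using zw c pos positive_cone_ge[OF x] positive_cone_ge[OF y]
            disjoint_mono[of x "\<bar>z\<bar>" "\<bar>z\<bar> \<sqinter> \<bar>w\<bar>"] disjoint_mono[of y "\<bar>w\<bar>" "\<bar>z\<bar> \<sqinter> \<bar>w\<bar>"]
            gmeet_comm[of x "\<bar>z\<bar>"] gmeet_comm[of y "\<bar>w\<bar>"]
          by (auto simp: gmeet_left gmeet_right)
        then have "\<bar>z\<bar> \<sqinter> \<bar>w\<bar> \<in> perp G {x} \<inter> perp G {y}"
          using zw c pos gmeet_comm[of x "\<bar>z\<bar> \<sqinter> \<bar>w\<bar>"] gmeet_comm[of y "\<bar>z\<bar> \<sqinter> \<bar>w\<bar>"]
          by (simp add: mem_perp_singleton x y gabs_eq)
        then show ?thesis using * wu by blast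
      qed
      then show "z \<in> perp G (perp G {y})" using z perp_subset by (auto simp: perp_def)
    qed
  qed
  show "x \<sqinter> y = \<one> \<and> weak_unit G (x \<squnion> y)" if *: "perp G {x} = perp G (perp G {y})"
  proof
    show "x \<sqinter> y = \<one>" using d * subset_perp_perp[of "{y}"] c by auto
    have "perp G {x} \<inter> perp G {y} \<subseteq> {\<one>}"
    proof
      fix z assume "z \<in> perp G {x} \<inter> perp G {y}"
      then have z: "z \<in> perp G (perp G {y})" "z \<in> perp G {y}" using * by auto
      then have "\<bar>z\<bar> \<sqinter> \<bar>z\<bar> = \<one>" "z \<in> carrier G" unfolding perp_def[of G "perp G {y}"] by auto
      then show "z \<in> {\<one>}" using gmeet_absorb[of "\<bar>z\<bar>" "\<bar>z\<bar>"] gabs_eq_one[of z] by simp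
    qed
    then show "weak_unit G (x \<squnion> y)" using wu by blast
  qed
qed

lemma Pol_p_eq: "Pol_p G = (\<lambda>x. perp G (perp G {x})) ` positive_cone G"
proof
  show "Pol_p G \<subseteq> (\<lambda>x. perp G (perp G {x})) ` positive_cone G"
  proof
    fix T assume "T \<in> Pol_p G"
    then obtain x where "x \<in> carrier G" "T = perp G (perp G {\<bar>x\<bar>})"
      by (auto simp: Pol_p_def perp_gabs)
    then show "T \<in> (\<lambda>x. perp G (perp G {x})) ` positive_cone G" by auto
  qed
qed (auto simp: Pol_p_def dest: positive_cone_closed)

text \<open>Principal polars always contain the bottom and are closed under meets and joins of
  \<open>Pol\<close>, which come from meets and joins of positive generators. Only complements are
  at stake, and the top is the complement of the bottom.\<close>

theorem boolean_subalgebra_iff_complemented: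
  "boolean_subalgebra_Pol (Pol_p G) G \<longleftrightarrow> positive_cone_complemented G"
proof -
  have compl: "positive_cone_complemented G \<longleftrightarrow>
      (\<forall>x\<in>positive_cone G. \<exists>y\<in>positive_cone G. perp G {x} = perp G (perp G {y}))"
    unfolding positive_cone_complemented_def using complement_iff_perp by simp
  have "perp G (perp G (perp G {x})) = perp G {x}" if "x \<in> positive_cone G" for x
    using that by (intro perp_perp_perp) (auto dest: positive_cone_closed)
  then have compl': "positive_cone_complemented G \<longleftrightarrow> (\<forall>T\<in>Pol_p G. perp G T \<in> Pol_p G)"
    unfolding compl Pol_p_eq by (simp add: image_iff)
  show ?thesis
  proof
    assume "boolean_subalgebra_Pol (Pol_p G) G"
    then show "positive_cone_complemented G"
      unfolding compl' by (simp add: boolean_subalgebra_Pol_def)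
  next
    assume *: "positive_cone_complemented G"
    show "boolean_subalgebra_Pol (Pol_p G) G"
      unfolding boolean_subalgebra_Pol_def
    proof (intro conjI ballI)
      show "Pol_p G \<subseteq> Pol G"
        using perp_subset by (auto simp: Pol_p_def Pol_def perp_perp_perp)
      have "{\<one>} = perp G (perp G {\<one>})" by (simp add: perp_one perp_carrier)
      then show one: "{\<one>} \<in> Pol_p G"
        unfolding Pol_p_def using one_closed by blast
      show "carrier G \<in> Pol_p G"
        using *[unfolded compl', rule_format, OF one] perp_one by simp
      show "perp G T \<in> Pol_p G" if "T \<in> Pol_p G" for T
        using * that unfolding compl' by blast
      fix S T assume "S \<in> Pol_p G" "T \<in> Pol_p G"
      then obtain x y where xy: "x \<in> positive_cone G" "y \<in> positive_cone G"
        and ST: "S = perp G (perp G {x})" "T = perp G (perp G {y})"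
        unfolding Pol_p_eq by blast
      show "S \<inter> T \<in> Pol_p G"
        unfolding Pol_p_eq ST perp_perp_gmeet[OF xy, symmetric]
        using positive_cone_gmeet[OF xy] by blast
      have "perp G (S \<union> T) = perp G {x \<squnion> y}"
        unfolding perp_Un ST perp_gjoin[OF xy] using xy
        by (simp add: perp_perp_perp positive_cone_closed)
      then show "perp G (perp G (S \<union> T)) \<in> Pol_p G"
        unfolding Pol_p_eq by (simp add: imageI positive_cone_gjoin[OF xy])
    qed
  qed
qed

section \<open>Topology of the spectrum and compactness of the minimal primes\<close>

lemma topspace_Spec [simp]: "topspace (Spec_topology G) = Spec G"
proof -
  have "\<not> carrier G \<subseteq> p" if "p \<in> Spec G" for p
    using Spec_proper[OF that] convex_l_subgroup_subset[OF Spec_convex[OF that]] by blast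
  then show ?thesis by (auto simp: Spec_topology_def)
qed

lemma openin_Spec_basic: "x \<in> carrier G \<Longrightarrow> openin (Spec_topology G) {p \<in> Spec G. x \<notin> p}"
  unfolding Spec_topology_def
  by (rule topology_generated_by_Basis) (auto intro!: exI[of _ "{x}"])

text \<open>The sets of primes omitting one positive element form a base, since a prime omits both
  \<open>x\<close> and \<open>y\<close> exactly if it omits \<open>x \<sqinter> y\<close>. The
  induction follows the generation of the topology.\<close>

lemma Spec_neighbourhood_basic:
  assumes "openin (Spec_topology G) W" "p \<in> W"
  obtains x where "x \<in> positive_cone G" "x \<notin> p" "{q \<in> Spec G. x \<notin> q} \<subseteq> W"
proof -
  have "generate_topology_on {{p \<in> Spec G. \<not> A \<subseteq> p} |A. A \<subseteq> carrier G} W"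
    using assms(1) unfolding Spec_topology_def by (rule openin_topology_generated_by)
  then have "\<forall>p\<in>W. \<exists>x\<in>positive_cone G. p \<in> Spec G \<and> x \<notin> p \<and> {q \<in> Spec G. x \<notin> q} \<subseteq> W"
  proof induction
    case (Int a b)
    show ?case
    proof
      fix p assume p: "p \<in> a \<inter> b"
      obtain x where x: "x \<in> positive_cone G" "p \<in> Spec G" "x \<notin> p" "{q \<in> Spec G. x \<notin> q} \<subseteq> a"
        using Int.IH(1) p by blast
      obtain y where y: "y \<in> positive_cone G" "y \<notin> p" "{q \<in> Spec G. y \<notin> q} \<subseteq> b"
        using Int.IH(2) p by blast
      have c: "x \<in> carrier G" "y \<in> carrier G" "\<one> \<preceq> x" "\<one> \<preceq> y"
        using x(1) y(1) by (auto simp: positive_cone_def)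
      have "x \<in> q \<or> y \<in> q \<longrightarrow> x \<sqinter> y \<in> q" if "q \<in> Spec G" for q
        using convex_l_subgroup_down[OF Spec_convex[OF that], of "x \<sqinter> y" x]
          convex_l_subgroup_down[OF Spec_convex[OF that], of "x \<sqinter> y" y] c
        by (auto simp: one_le_gmeet gmeet_left gmeet_right)
      then have "{q \<in> Spec G. x \<sqinter> y \<notin> q} \<subseteq> a \<inter> b" using x(4) y(3) by blast
      moreover have "x \<sqinter> y \<notin> p" using Spec_gmeet[OF x(2) c(1,2)] x(3) y(2) by blast
      ultimately show "\<exists>x\<in>positive_cone G. p \<in> Spec G \<and> x \<notin> p \<and> {q \<in> Spec G. x \<notin> q} \<subseteq> a \<inter> b"
        using positive_cone_gmeet[OF x(1) y(1)] x(2) by blast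
    qed
  next
    case (UN K)
    show ?case
    proof
      fix p assume "p \<in> \<Union>K"
      then obtain k where k: "k \<in> K" "p \<in> k" by blast
      obtain x where "x \<in> positive_cone G" "p \<in> Spec G" "x \<notin> p" "{q \<in> Spec G. x \<notin> q} \<subseteq> k"
        using UN.IH[OF k(1)] k(2) by blast
      then show "\<exists>x\<in>positive_cone G. p \<in> Spec G \<and> x \<notin> p \<and> {q \<in> Spec G. x \<notin> q} \<subseteq> \<Union>K"
        using k(1) by (intro bexI[of _ x]) auto
    qed
  next
    case (Basis s)
    then obtain A where A: "A \<subseteq> carrier G" "s = {p \<in> Spec G. \<not> A \<subseteq> p}" by blast
    show ?case
    proof
      fix p assume "p \<in> s"
      then obtain x where x: "x \<in> A" "x \<notin> p" "p \<in> Spec G" using A(2) by blast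
      then have *: "\<bar>x\<bar> \<in> q \<longleftrightarrow> x \<in> q" if "q \<in> Spec G" for q
        using convex_l_subgroup_gabs_iff[OF Spec_convex[OF that]] A(1) by blast
      moreover have "\<bar>x\<bar> \<in> positive_cone G" using x(1) A(1) by auto
      moreover have "{q \<in> Spec G. \<bar>x\<bar> \<notin> q} \<subseteq> s"
        using x(1) A(2) * by blast
      ultimately show "\<exists>x\<in>positive_cone G. p \<in> Spec G \<and> x \<notin> p \<and> {q \<in> Spec G. x \<notin> q} \<subseteq> s"
        using x(2,3) by blast
    qed
  qed simp
  then obtain x where "x \<in> positive_cone G" "x \<notin> p" "{q \<in> Spec G. x \<notin> q} \<subseteq> W"
    using assms(2) by blast
  then show thesis by (rule that)
qed

text \<open>Compactness stated without open sets: covers by basic sets suffice, and such a cover is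
  a set of positive elements that no minimal prime contains entirely.\<close>

lemma compact_Min_iff:
  "compact_space (Min_space G) \<longleftrightarrow>
    (\<forall>F\<subseteq>positive_cone G. (\<forall>p\<in>inclusion_minimal (Spec G). \<exists>x\<in>F. x \<notin> p) \<longrightarrow>
      (\<exists>F'\<subseteq>F. finite F' \<and> (\<forall>p\<in>inclusion_minimal (Spec G). \<exists>x\<in>F'. x \<notin> p)))"
  (is "_ \<longleftrightarrow> ?R")
proof -
  let ?M = "inclusion_minimal (Spec G)" and ?U = "\<lambda>x. {p \<in> Spec G. x \<notin> p}"
  have sub: "?M \<subseteq> Spec G" by (auto simp: inclusion_minimal_def)
  have "compact_space (Min_space G) \<longleftrightarrow> compactin (Spec_topology G) ?M"
    by (simp add: Min_space_def compactin_subspace sub)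
  also have "\<dots> \<longleftrightarrow> (\<forall>\<U>. (\<forall>U\<in>\<U>. openin (Spec_topology G) U) \<and> ?M \<subseteq> \<Union>\<U> \<longrightarrow>
      (\<exists>\<F>. finite \<F> \<and> \<F> \<subseteq> \<U> \<and> ?M \<subseteq> \<Union>\<F>))"
    by (simp add: compactin_def sub)
  also have "\<dots> \<longleftrightarrow> ?R"
  proof (intro iffI allI impI)
    fix F assume
      cpt: "\<forall>\<U>. (\<forall>U\<in>\<U>. openin (Spec_topology G) U) \<and> ?M \<subseteq> \<Union>\<U> \<longrightarrow>
        (\<exists>\<F>. finite \<F> \<and> \<F> \<subseteq> \<U> \<and> ?M \<subseteq> \<Union>\<F>)"
      and F: "F \<subseteq> positive_cone G" and cov: "\<forall>p\<in>?M. \<exists>x\<in>F. x \<notin> p"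
    have "\<forall>U\<in>?U ` F. openin (Spec_topology G) U"
      using F positive_cone_closed openin_Spec_basic by blast
    moreover have "?M \<subseteq> \<Union>(?U ` F)" using cov sub by blast
    ultimately have "\<exists>\<F>. finite \<F> \<and> \<F> \<subseteq> ?U ` F \<and> ?M \<subseteq> \<Union>\<F>"
      by (intro cpt[THEN spec, THEN mp] conjI)
    then obtain \<F> where \<F>: "finite \<F>" "\<F> \<subseteq> ?U ` F" "?M \<subseteq> \<Union>\<F>"
      by blast
    obtain F' where F': "F' \<subseteq> F" "finite F'" "\<F> = ?U ` F'"
      using finite_subset_image[OF \<F>(1,2)] by blast
    have "\<forall>p\<in>?M. \<exists>x\<in>F'. x \<notin> p" using \<F>(3) unfolding F'(3) by blast
    then show "\<exists>F'\<subseteq>F. finite F' \<and> (\<forall>p\<in>?M. \<exists>x\<in>F'. x \<notin> p)"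
      using F'(1,2) by blast
  next
    fix \<U> assume R: ?R and \<U>: "(\<forall>U\<in>\<U>. openin (Spec_topology G) U) \<and> ?M \<subseteq> \<Union>\<U>"
    \<comment> \<open>All basic sets that refine the given cover; the finitely many selected ones
      are afterwards enlarged to members of the cover.\<close>
    let ?F = "{x \<in> positive_cone G. \<exists>W\<in>\<U>. ?U x \<subseteq> W}"
    have "\<exists>x\<in>?F. x \<notin> p" if p: "p \<in> ?M" for p
    proof -
      obtain W where W: "W \<in> \<U>" "p \<in> W" using \<U> p by blast
      then obtain x where "x \<in> positive_cone G" "x \<notin> p" "?U x \<subseteq> W"
        using Spec_neighbourhood_basic[of W p] \<U> by blast
      then show ?thesis using W(1) by blast
    qed
    then have "\<exists>F'\<subseteq>?F. finite F' \<and> (\<forall>p\<in>?M. \<exists>x\<in>F'. x \<notin> p)"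
      by (intro R[THEN spec, THEN mp, THEN mp] ballI subsetI) simp_all
    then obtain F' where F': "F' \<subseteq> ?F" "finite F'" "\<forall>p\<in>?M. \<exists>x\<in>F'. x \<notin> p" by blast
    then have "\<forall>x\<in>F'. \<exists>W. W \<in> \<U> \<and> ?U x \<subseteq> W" by blast
    then obtain W where W: "\<forall>x\<in>F'. W x \<in> \<U> \<and> ?U x \<subseteq> W x" using bchoice by meson
    have "?M \<subseteq> \<Union>(W ` F')"
    proof
      fix p assume p: "p \<in> ?M"
      then obtain x where x: "x \<in> F'" "x \<notin> p" using F'(3) by blast
      then have "p \<in> W x" using W p sub by blast
      then show "p \<in> \<Union>(W ` F')" using x(1) by blast
    qed
    then show "\<exists>\<F>. finite \<F> \<and> \<F> \<subseteq> \<U> \<and> ?M \<subseteq> \<Union>\<F>"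
      using F'(2) W by (intro exI[of _ "W ` F'"]) auto
  qed
  finally show ?thesis .
qed

text \<open>By \<open>Min_mem_iff\<close> a minimal prime containing \<open>w\<close> would omit
  some \<open>y\<close> disjoint from \<open>w\<close>; a weak unit leaves only
  \<open>y = \<one>\<close>, which no subgroup omits.\<close>

lemma weak_unit_notin_Min:
  assumes p: "p \<in> inclusion_minimal (Spec G)" and w: "weak_unit G w"
  shows "w \<notin> p"
proof
  have wp: "w \<in> positive_cone G" using w by (simp add: weak_unit_def)
  note wc = positive_cone_closed[OF wp] positive_cone_ge[OF wp]
  assume "w \<in> p"
  then obtain y where y: "y \<in> positive_cone G" "y \<notin> p" "w \<sqinter> y = \<one>"
    using Min_mem_iff[OF p wc(1)] gabs_eq[OF wc] by auto
  then have "w \<sqinter> \<bar>y\<bar> = \<one>" "y \<in> carrier G"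
    by (simp_all add: positive_cone_def gabs_eq)
  then have "y = \<one>"
    using w unfolding weak_unit_def by blast
  then show False
    using y(2) convex_l_subgroup_one[OF Spec_convex[OF Min_Spec[OF p]]] by blast
qed

text \<open>Joins of elements disjoint from \<open>x\<close> stay disjoint from \<open>x\<close>,
  and the identity serves for the empty set. This condenses a finite subcover into a single
  complement.\<close>

lemma finite_disjoint_upper_bound:
  assumes "finite F" "F \<subseteq> positive_cone G" "x \<in> positive_cone G" "\<forall>y\<in>F. x \<sqinter> y = \<one>"
  obtains y where "y \<in> positive_cone G" "x \<sqinter> y = \<one>" "\<And>z. z \<in> F \<Longrightarrow> z \<preceq> y"
proof -
  note x = positive_cone_closed[OF assms(3)] positive_cone_ge[OF assms(3)]
  from assms(1,2,4) have "\<exists>y\<in>positive_cone G. x \<sqinter> y = \<one> \<and> (\<forall>z\<in>F. z \<preceq> y)"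
  proof (induction F)
    case empty
    then show ?case
      using x gmeet_absorb[of \<one> x] gmeet_comm[of \<one> x] by (intro bexI[of _ \<one>]) (auto intro: positive_coneI)
  next
    case (insert z F)
    then obtain y where y: "y \<in> positive_cone G" "x \<sqinter> y = \<one>" "\<forall>z\<in>F. z \<preceq> y" by auto
    have c: "y \<in> carrier G" "\<one> \<preceq> y" "z \<in> carrier G" "\<one> \<preceq> z"
      using y(1) insert.prems by (auto simp: positive_cone_def)
    show ?case
    proof (intro bexI[of _ "y \<squnion> z"] conjI ballI)
      show "x \<sqinter> (y \<squnion> z) = \<one>" using x c y(2) insert.prems by (simp add: disjoint_gjoin_iff)
      fix w assume "w \<in> insert z F"
      then show "w \<preceq> y \<squnion> z"
      proof
        assume w: "w \<in> F"
        then have "w \<in> carrier G" using insert.prems by (auto simp: positive_cone_def)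
        then show ?thesis using order_trans[OF _ gjoin_left[of y z]] y(3) w c by simp
      qed (use c gjoin_right in simp)
    qed (use c in \<open>simp add: positive_coneI one_le_gjoin\<close>)
  qed
  then show thesis using that by blast
qed

theorem compact_Min_iff_complemented:
  "compact_space (Min_space G) \<longleftrightarrow> positive_cone_complemented G"
proof
  assume cpt: "compact_space (Min_space G)"
  show "positive_cone_complemented G"
    unfolding positive_cone_complemented_def
  proof
    fix x assume x: "x \<in> positive_cone G"
    note xc = positive_cone_closed[OF x] positive_cone_ge[OF x]
    let ?F = "insert x {y \<in> positive_cone G. x \<sqinter> y = \<one>}"
    have "\<forall>p\<in>inclusion_minimal (Spec G). \<exists>z\<in>?F. z \<notin> p"
      using Min_mem_iff[OF _ xc(1)] gabs_eq[OF xc] by auto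
    moreover have "?F \<subseteq> positive_cone G" using x by blast
    ultimately have "\<exists>F'\<subseteq>?F. finite F' \<and> (\<forall>p\<in>inclusion_minimal (Spec G). \<exists>x\<in>F'. x \<notin> p)"
      using cpt unfolding compact_Min_iff by blast
    then obtain F' where F': "F' \<subseteq> ?F" "finite F'"
      and cov: "\<forall>p\<in>inclusion_minimal (Spec G). \<exists>x\<in>F'. x \<notin> p" by blast
    obtain y where y: "y \<in> positive_cone G" "x \<sqinter> y = \<one>" "\<And>z. z \<in> F' - {x} \<Longrightarrow> z \<preceq> y"
      by (rule finite_disjoint_upper_bound[of "F' - {x}" x]) (use F' x in auto)
    note yc = positive_cone_closed[OF y(1)] positive_cone_ge[OF y(1)]
    \<comment> \<open>A nontrivial \<open>z\<close> disjoint from \<open>x \<squnion> y\<close>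
      would be omitted by some minimal prime. That prime contains \<open>x \<squnion> y\<close>,
      hence by convexity all of \<open>F'\<close>, against the covering property.\<close>
    have "z = \<one>" if z: "z \<in> carrier G" "(x \<squnion> y) \<sqinter> \<bar>z\<bar> = \<one>" for z
    proof (rule ccontr)
      assume "z \<noteq> \<one>"
      then obtain p where p: "p \<in> inclusion_minimal (Spec G)" "z \<notin> p"
        using Min_separates z(1) by blast
      note conv = Spec_convex[OF Min_Spec[OF p(1)]]
      have "\<bar>z\<bar> \<notin> p" using convex_l_subgroup_gabs_iff[OF conv z(1)] p(2) by simp
      then have xy: "x \<squnion> y \<in> p"
        using Spec_disjoint[OF Min_Spec[OF p(1)] z(2)] z(1) xc yc by auto
      have xp: "x \<in> p" by (rule convex_l_subgroup_down[OF conv _ _ xy]) (use xc yc gjoin_left in auto)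
      have yp: "y \<in> p" by (rule convex_l_subgroup_down[OF conv _ _ xy]) (use xc yc gjoin_right in auto)
      have "w \<in> p" if "w \<in> F'" for w
      proof (cases "w = x")
        case False
        then have "w \<preceq> y" "w \<in> positive_cone G" using y(3) that F'(1) by auto
        then show ?thesis
          using convex_l_subgroup_down[OF conv _ _ yp, of w] by (simp add: positive_cone_def)
      qed (use xp in simp)
      then show False using cov p(1) by blast
    qed
    then have "weak_unit G (x \<squnion> y)"
      using positive_cone_gjoin[OF x y(1)] by (simp add: weak_unit_def)
    then show "\<exists>y\<in>positive_cone G. x \<sqinter> y = \<one> \<and> weak_unit G (x \<squnion> y)" using y(1,2) by blast
  qed
next
  let ?Min = "inclusion_minimal (Spec G)"
  assume "positive_cone_complemented G"
  then have "\<forall>x\<in>positive_cone G. \<exists>y. y \<in> positive_cone G \<and> x \<sqinter> y = \<one> \<and> weak_unit G (x \<squnion> y)"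
    unfolding positive_cone_complemented_def by blast
  then obtain c where c: "\<And>x. x \<in> positive_cone G \<Longrightarrow> c x \<in> positive_cone G"
    "\<And>x. x \<in> positive_cone G \<Longrightarrow> x \<sqinter> c x = \<one>"
    "\<And>x. x \<in> positive_cone G \<Longrightarrow> weak_unit G (x \<squnion> c x)" by metis
  show "compact_space (Min_space G)"
    unfolding compact_Min_iff
  proof (intro allI impI, rule ccontr)
    fix F assume F: "F \<subseteq> positive_cone G" and cov: "\<forall>p\<in>?Min. \<exists>x\<in>F. x \<notin> p"
      and no: "\<not> (\<exists>F'\<subseteq>F. finite F' \<and> (\<forall>p\<in>?Min. \<exists>x\<in>F'. x \<notin> p))"
    \<comment> \<open>The \<open>m\<close> for which finitely many members of \<open>F\<close> cover all minimal primes containing \<open>m\<close>. As every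
      prime contains \<open>\<one>\<close>, having \<open>\<one> \<in> ?M\<close> would mean a finite subcover.\<close>
    let ?M = "{m \<in> positive_cone G. \<exists>F'\<subseteq>F. finite F' \<and> (\<forall>p\<in>?Min. m \<in> p \<longrightarrow> (\<exists>x\<in>F'. x \<notin> p))}"
    \<comment> \<open>No minimal prime contains both \<open>x\<close> and \<open>c x\<close>, as
      their join is a weak unit; so \<open>x\<close> alone covers the minimal primes containing
      \<open>c x\<close>.\<close>
    have cM: "c x \<in> ?M" if x: "x \<in> F" for x
    proof -
      have xp: "x \<in> positive_cone G" using x F by blast
      have "x \<notin> p" if p: "p \<in> ?Min" "c x \<in> p" for p
      proof
        assume "x \<in> p"
        then have "x \<squnion> c x \<in> p"
          using p(2) by (rule convex_l_subgroup_join[OF Spec_convex[OF Min_Spec[OF p(1)]]])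
        then show False using weak_unit_notin_Min[OF p(1) c(3)[OF xp]] by contradiction
      qed
      then have "\<forall>p\<in>?Min. c x \<in> p \<longrightarrow> (\<exists>z\<in>{x}. z \<notin> p)" by simp
      then show ?thesis using c(1)[OF xp] x by (intro CollectI conjI exI[of _ "{x}"]) simp_all
    qed
    have "m \<sqinter> n \<in> ?M" if mn: "m \<in> ?M" "n \<in> ?M" for m n
    proof -
      obtain F1 F2 where F12: "F1 \<subseteq> F" "finite F1" "\<forall>p\<in>?Min. m \<in> p \<longrightarrow> (\<exists>x\<in>F1. x \<notin> p)"
        "F2 \<subseteq> F" "finite F2" "\<forall>p\<in>?Min. n \<in> p \<longrightarrow> (\<exists>x\<in>F2. x \<notin> p)"
        using mn[unfolded mem_Collect_eq] by (elim conjE exE) (rule that)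
      have "m \<in> p \<or> n \<in> p" if "p \<in> ?Min" "m \<sqinter> n \<in> p" for p
        using Spec_gmeet[OF Min_Spec[OF that(1)] _ _ that(2)] mn by (auto simp: positive_cone_def)
      then have "\<forall>p\<in>?Min. m \<sqinter> n \<in> p \<longrightarrow> (\<exists>x\<in>F1 \<union> F2. x \<notin> p)"
        using F12(3,6) by blast
      moreover have "F1 \<union> F2 \<subseteq> F" "finite (F1 \<union> F2)" using F12(1,2,4,5) by simp_all
      moreover have "m \<sqinter> n \<in> positive_cone G"
        using mn by (intro positive_cone_gmeet) simp_all
      ultimately show ?thesis
        by (intro CollectI conjI exI[of _ "F1 \<union> F2"])
    qed
    moreover have "\<one> \<notin> ?M"
    proof
      assume "\<one> \<in> ?M"
      then obtain F' where F': "F' \<subseteq> F" "finite F'"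
        "\<forall>p\<in>?Min. \<one> \<in> p \<longrightarrow> (\<exists>x\<in>F'. x \<notin> p)"
        unfolding mem_Collect_eq by (elim conjE exE) (rule that)
      have "\<forall>p\<in>?Min. \<exists>x\<in>F'. x \<notin> p"
        using F'(3) convex_l_subgroup_one[OF Spec_convex[OF Min_Spec]] by simp
      then have "\<exists>F'\<subseteq>F. finite F' \<and> (\<forall>p\<in>?Min. \<exists>x\<in>F'. x \<notin> p)"
        using F'(1,2) by (intro exI[of _ F'] conjI)
      with no show False by (rule notE)
    qed
    moreover have "?M \<noteq> {}"
    proof -
      have "F \<noteq> {}"
      proof
        assume "F = {}"
        then have "\<exists>F'\<subseteq>F. finite F' \<and> (\<forall>p\<in>?Min. \<exists>x\<in>F'. x \<notin> p)"
          using cov by (intro exI[of _ F] conjI) simp_all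
        with no show False by (rule notE)
      qed
      then obtain x where "x \<in> F" by blast
      then have "c x \<in> ?M" by (rule cM)
      then show ?thesis by (metis empty_iff)
    qed
    moreover have "?M \<subseteq> positive_cone G" by (rule subsetI) simp
    ultimately have "meet_system ?M" unfolding meet_system_def by (intro conjI ballI)
    then obtain U where U: "?M \<subseteq> U" "meet_system U"
      "\<forall>x\<in>positive_cone G. (\<forall>v\<in>U. x \<sqinter> v \<noteq> \<one>) \<longrightarrow> (\<forall>u\<in>U. x \<sqinter> u \<in> U)"
      by (rule maximal_meet_system)
    \<comment> \<open>The cover must also reach the new minimal prime, but \<open>c x\<close>
      belongs to \<open>U\<close> for every \<open>x\<close> in \<open>F\<close> and is disjoint
      from \<open>x\<close>, so \<open>x\<close> is annihilated.\<close>
    obtain x where x: "x \<in> F" "x \<notin> annihilated U"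
      using cov Min_annihilated(1)[OF U(2,3)] by blast
    have xp: "x \<in> positive_cone G" using x F by blast
    have "c x \<in> U" using cM[OF x(1)] U(1) by blast
    then have "x \<in> annihilated U"
      using c(2)[OF xp] xp gabs_eq[of x] unfolding annihilated_def positive_cone_def by auto
    with x(2) show False by blast
  qed
qed

end

section \<open>Automorphisms of a chain\<close>

text \<open>Joins and meets are least upper and greatest lower bounds within the carrier, so
  shrinking the carrier could change them; closure under the ambient operations excludes
  this.\<close>

lemma l_subgroup_l_group:
  assumes K: "l_group K" and S: "l_subgroup S K"
  shows "l_group (K\<lparr>carrier := S\<rparr>)"
    and "\<lbrakk>x \<in> S; y \<in> S\<rbrakk> \<Longrightarrow> gjoin (K\<lparr>carrier := S\<rparr>) x y = gjoin K x y"
    and "\<lbrakk>x \<in> S; y \<in> S\<rbrakk> \<Longrightarrow> gmeet (K\<lparr>carrier := S\<rparr>) x y = gmeet K x y"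
proof -
  interpret K: l_group K by (rule K)
  interpret S: subgroup S K using S by (simp add: l_subgroup_def)
  let ?K = "K\<lparr>carrier := S\<rparr>"
  have SK: "x \<in> carrier K" if "x \<in> S" for x using S.subset that by blast
  have SJ: "gjoin K x y \<in> S" "gmeet K x y \<in> S" if "x \<in> S" "y \<in> S" for x y
    using S that by (simp_all add: l_subgroup_def)
  have po: "partial_order (order_of ?K)"
  proof
    fix x y z
    assume "x \<in> carrier (order_of ?K)" "y \<in> carrier (order_of ?K)" "z \<in> carrier (order_of ?K)"
      "x \<sqsubseteq>\<^bsub>order_of ?K\<^esub> y" "y \<sqsubseteq>\<^bsub>order_of ?K\<^esub> z"
    then show "x \<sqsubseteq>\<^bsub>order_of ?K\<^esub> z" using K.order_trans[of x y z] by (simp add: SK)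
  next
    fix x y
    assume "x \<in> carrier (order_of ?K)" "y \<in> carrier (order_of ?K)"
      "x \<sqsubseteq>\<^bsub>order_of ?K\<^esub> y" "y \<sqsubseteq>\<^bsub>order_of ?K\<^esub> x"
    then show "x .=\<^bsub>order_of ?K\<^esub> y" using K.order_antisym[of x y] by (simp add: SK)
  qed (simp_all add: SK)
  have join: "least (order_of ?K) (gjoin K x y) (Upper (order_of ?K) {x, y})"
    and meet: "greatest (order_of ?K) (gmeet K x y) (Lower (order_of ?K) {x, y})"
    if "x \<in> S" "y \<in> S" for x y
    using that
    by (auto simp: least_def Upper_def greatest_def Lower_def SJ SK
        intro: K.gjoin_left K.gjoin_right K.gjoin_least K.gmeet_left K.gmeet_right K.gmeet_greatest)
  have lat: "lattice (order_of ?K)"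
  proof -
    interpret P: partial_order "order_of ?K" by (rule po)
    show ?thesis
      by unfold_locales (use join meet in \<open>force+\<close>)
  qed
  have grp: "group ?K" using S.subgroup_is_group[OF K.is_group] .
  show l: "l_group ?K"
    by (intro l_group.intro po_group.intro po_group_axioms.intro l_group_axioms.intro grp po lat)
      (simp add: K.translation SK)
  interpret S: l_group ?K by (rule l)
  show "gjoin ?K x y = gjoin K x y" if "x \<in> S" "y \<in> S"
    by (rule S.gjoin_eqI)
      (use that in \<open>simp_all add: SJ SK K.gjoin_left K.gjoin_right K.gjoin_least\<close>)
  show "gmeet ?K x y = gmeet K x y" if "x \<in> S" "y \<in> S"
    by (rule S.gmeet_eqI)
      (use that in \<open>simp_all add: SJ SK K.gmeet_left K.gmeet_right K.gmeet_greatest\<close>)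
qed

lemma l_subgroup_inclusion:
  assumes K: "l_group K" and S: "l_subgroup S K"
  shows "(\<lambda>x. x) \<in> l_hom (K\<lparr>carrier := S\<rparr>) K"
proof -
  have "S \<subseteq> carrier K" using S by (simp add: l_subgroup_def subgroup.subset)
  then show ?thesis
    using l_subgroup_l_group[OF assms] by (auto simp: l_hom_def hom_def)
qed

lemma l_subgroup_carrier:
  assumes "l_group K" shows "l_subgroup (carrier K) K"
proof -
  interpret l_group K by fact
  show ?thesis by (simp add: l_subgroup_def subgroup_self)
qed

lemma l_subgroup_generated:
  assumes K: "l_group K" and A: "A \<subseteq> carrier K"
  shows "l_subgroup (l_subgroup_generated K A) K"
    and "A \<subseteq> l_subgroup_generated K A"
    and "\<lbrakk>l_subgroup S K; A \<subseteq> S\<rbrakk> \<Longrightarrow> l_subgroup_generated K A \<subseteq> S"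
proof -
  interpret K: l_group K by (rule K)
  let ?F = "{S. l_subgroup S K \<and> A \<subseteq> S}"
  have "carrier K \<in> ?F" using l_subgroup_carrier[OF K] A by simp
  moreover have "subgroup S K" if "S \<in> ?F" for S using that by (simp add: l_subgroup_def)
  ultimately have "subgroup (\<Inter>?F) K"
    using K.subgroups_Inter[of ?F] by blast
  then show "l_subgroup (l_subgroup_generated K A) K"
    unfolding l_subgroup_def[of "l_subgroup_generated K A"] unfolding l_subgroup_generated_def
    by (auto simp: K.l_subgroup_join K.l_subgroup_meet)
qed (auto simp: l_subgroup_generated_def)

lemma Aut_simps:
  "\<one>\<^bsub>Aut L\<^esub> = (\<lambda>x\<in>carrier L. x)"
  "f \<otimes>\<^bsub>Aut L\<^esub> g = compose (carrier L) g f"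
  "f \<preceq>\<^bsub>Aut L\<^esub> g \<longleftrightarrow> (\<forall>x\<in>carrier L. f x \<sqsubseteq>\<^bsub>L\<^esub> g x)"
  by (simp_all add: Aut_def)

lemma Aut_carrier_iff:
  "f \<in> carrier (Aut L) \<longleftrightarrow> f \<in> extensional (carrier L) \<and> bij_betw f (carrier L) (carrier L) \<and>
    (\<forall>x\<in>carrier L. \<forall>y\<in>carrier L. x \<sqsubseteq>\<^bsub>L\<^esub> y \<longrightarrow> f x \<sqsubseteq>\<^bsub>L\<^esub> f y)"
  by (auto simp: Aut_def Bij_def)

locale chain = total_order L for L :: "'a gorder" (structure)
begin

lemma Aut_closed: "\<lbrakk>f \<in> carrier (Aut L); x \<in> carrier L\<rbrakk> \<Longrightarrow> f x \<in> carrier L"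
  by (auto simp: Aut_carrier_iff dest: bij_betwE)

text \<open>Reflection of the order uses totality: if \<open>x \<sqsubseteq> y\<close> failed, the
  reverse comparison with antisymmetry and injectivity would identify \<open>x\<close> and
  \<open>y\<close>.\<close>

lemma Aut_le_iff:
  assumes f: "f \<in> carrier (Aut L)" and x: "x \<in> carrier L" and y: "y \<in> carrier L"
  shows "f x \<sqsubseteq> f y \<longleftrightarrow> x \<sqsubseteq> y"
proof
  assume *: "f x \<sqsubseteq> f y"
  show "x \<sqsubseteq> y"
  proof (rule ccontr)
    assume n: "\<not> x \<sqsubseteq> y"
    then have "y \<sqsubseteq> x" using total_order_total[OF x y] by blast
    then have "f y \<sqsubseteq> f x" using f x y by (simp add: Aut_carrier_iff)
    then have "f x = f y" using * Aut_closed[OF f] x y le_antisym by blast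
    then have "x = y" using f x y by (auto simp: Aut_carrier_iff bij_betw_def dest: inj_onD)
    then show False using n x by simp
  qed
qed (use f x y in \<open>simp add: Aut_carrier_iff\<close>)

lemma AutI:
  assumes "f \<in> extensional (carrier L)"
    and "\<And>x. x \<in> carrier L \<Longrightarrow> f x \<in> carrier L"
    and "\<And>y. y \<in> carrier L \<Longrightarrow> \<exists>x\<in>carrier L. f x = y"
    and le: "\<And>x y. \<lbrakk>x \<in> carrier L; y \<in> carrier L\<rbrakk> \<Longrightarrow> f x \<sqsubseteq> f y \<longleftrightarrow> x \<sqsubseteq> y"
  shows "f \<in> carrier (Aut L)"
proof -
  have "x = y" if "x \<in> carrier L" "y \<in> carrier L" "f x = f y" for x y
    using that le[of x y] le[of y x] assms(2) by (intro le_antisym) auto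
  then have "bij_betw f (carrier L) (carrier L)"
    using assms(2,3) by (auto simp: bij_betw_def inj_on_def image_iff) metis
  then show ?thesis using assms by (simp add: Aut_carrier_iff)
qed

lemma Aut_surj: "\<lbrakk>f \<in> carrier (Aut L); y \<in> carrier L\<rbrakk> \<Longrightarrow> \<exists>x\<in>carrier L. f x = y"
  unfolding Aut_carrier_iff bij_betw_def by (metis imageE)

lemma Aut_group: "group (Aut L)"
proof (rule groupI)
  fix f assume f: "f \<in> carrier (Aut L)"
  then have "\<forall>y\<in>carrier L. \<exists>x. x \<in> carrier L \<and> f x = y" using Aut_surj by blast
  then obtain g where g: "\<And>y. y \<in> carrier L \<Longrightarrow> g y \<in> carrier L" "\<And>y. y \<in> carrier L \<Longrightarrow> f (g y) = y"
    by metis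
  let ?g = "restrict g (carrier L)"
  have "?g \<in> carrier (Aut L)"
  proof (rule AutI)
    show "\<exists>y\<in>carrier L. ?g y = x" if x: "x \<in> carrier L" for x
    proof (rule bexI)
      show "f x \<in> carrier L" using f x by (rule Aut_closed)
      then show "?g (f x) = x"
        using g x f inj_onD[of f "carrier L" "g (f x)" x] by (simp add: Aut_carrier_iff bij_betw_def)
    qed
    show "?g x \<sqsubseteq> ?g y \<longleftrightarrow> x \<sqsubseteq> y" if "x \<in> carrier L" "y \<in> carrier L" for x y
      using Aut_le_iff[OF f, of "g x" "g y"] g that by simp
  qed (use g in auto)
  moreover have "?g \<otimes>\<^bsub>Aut L\<^esub> f = \<one>\<^bsub>Aut L\<^esub>"
    using g by (auto simp: Aut_simps compose_def)
  ultimately show "\<exists>g\<in>carrier (Aut L). g \<otimes>\<^bsub>Aut L\<^esub> f = \<one>\<^bsub>Aut L\<^esub>" by blast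
next
  fix f g assume fg: "f \<in> carrier (Aut L)" "g \<in> carrier (Aut L)"
  show "f \<otimes>\<^bsub>Aut L\<^esub> g \<in> carrier (Aut L)"
  proof (rule AutI)
    fix y assume "y \<in> carrier L"
    then obtain z where z: "z \<in> carrier L" "g z = y" using Aut_surj[OF fg(2)] by blast
    then obtain x where x: "x \<in> carrier L" "f x = z" using Aut_surj[OF fg(1)] by blast
    show "\<exists>x\<in>carrier L. (f \<otimes>\<^bsub>Aut L\<^esub> g) x = y"
      by (rule bexI[OF _ x(1)]) (use x z in \<open>simp add: Aut_simps compose_def\<close>)
  qed (use fg in \<open>simp_all add: Aut_simps compose_def Aut_closed Aut_le_iff\<close>)
next
  show "\<one>\<^bsub>Aut L\<^esub> \<in> carrier (Aut L)"
    by (rule AutI) (auto simp: Aut_simps)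
next
  fix f g h assume "f \<in> carrier (Aut L)" "g \<in> carrier (Aut L)" "h \<in> carrier (Aut L)"
  then show "f \<otimes>\<^bsub>Aut L\<^esub> g \<otimes>\<^bsub>Aut L\<^esub> h = f \<otimes>\<^bsub>Aut L\<^esub> (g \<otimes>\<^bsub>Aut L\<^esub> h)"
    by (auto simp: Aut_simps compose_def Aut_closed)
next
  fix f assume f: "f \<in> carrier (Aut L)"
  then show "\<one>\<^bsub>Aut L\<^esub> \<otimes>\<^bsub>Aut L\<^esub> f = f"
    by (auto simp: Aut_simps compose_def Aut_carrier_iff extensional_def)
qed

text \<open>The pointwise maximum and minimum. Reflection of the order is inherited from whichever
  of \<open>f\<close>, \<open>g\<close> attains the value; surjectivity requires comparing preimages
  under both.\<close>

lemma Aut_pick: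
  assumes f: "f \<in> carrier (Aut L)" and g: "g \<in> carrier (Aut L)"
  shows "(\<lambda>x\<in>carrier L. if f x \<sqsubseteq> g x then g x else f x) \<in> carrier (Aut L)" (is "?s \<in> _")
    and "(\<lambda>x\<in>carrier L. if f x \<sqsubseteq> g x then f x else g x) \<in> carrier (Aut L)" (is "?i \<in> _")
proof -
  have cl: "?s x \<in> carrier L" "?i x \<in> carrier L" if "x \<in> carrier L" for x
    using that f g by (simp_all add: Aut_closed)
  have bd: "f x \<sqsubseteq> ?s x" "g x \<sqsubseteq> ?s x" "?i x \<sqsubseteq> f x" "?i x \<sqsubseteq> g x" if "x \<in> carrier L" for x
    using that f g total_order_total[of "f x" "g x"] by (auto simp: Aut_closed)
  have reflect_f: "y \<sqsubseteq> x" if "f y \<sqsubseteq> z" "z \<sqsubseteq> f x" "x \<in> carrier L" "y \<in> carrier L" "z \<in> carrier L" for x y z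
    using that le_trans[of "f y" z "f x"] Aut_le_iff[OF f, of y x] Aut_closed[OF f] by blast
  have reflect_g: "y \<sqsubseteq> x" if "g y \<sqsubseteq> z" "z \<sqsubseteq> g x" "x \<in> carrier L" "y \<in> carrier L" "z \<in> carrier L" for x y z
    using that le_trans[of "g y" z "g x"] Aut_le_iff[OF g, of y x] Aut_closed[OF g] by blast
  have reflect_s: "y \<sqsubseteq> x" if xy: "x \<in> carrier L" "y \<in> carrier L" "?s y \<sqsubseteq> ?s x" for x y
  proof (cases "f x \<sqsubseteq> g x")
    case True
    then have "?s x = g x" using xy by simp
    then have "?s y \<sqsubseteq> g x" using xy by argo
    then show ?thesis using reflect_g[OF bd(2)[OF xy(2)]] cl xy by blast
  next
    case False
    then have "?s x = f x" using xy by simp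
    then have "?s y \<sqsubseteq> f x" using xy by argo
    then show ?thesis using reflect_f[OF bd(1)[OF xy(2)]] cl xy by blast
  qed
  have reflect_i: "y \<sqsubseteq> x" if xy: "x \<in> carrier L" "y \<in> carrier L" "?i y \<sqsubseteq> ?i x" for x y
  proof (cases "f y \<sqsubseteq> g y")
    case True
    then have "?i y = f y" using xy by simp
    then have "f y \<sqsubseteq> ?i x" using xy by argo
    then show ?thesis using reflect_f[OF _ bd(3)[OF xy(1)]] cl xy by blast
  next
    case False
    then have "?i y = g y" using xy by simp
    then have "g y \<sqsubseteq> ?i x" using xy by argo
    then show ?thesis using reflect_g[OF _ bd(4)[OF xy(1)]] cl xy by blast
  qed
  have surj: "\<exists>x\<in>carrier L. ?s x = z" "\<exists>x\<in>carrier L. ?i x = z" if z: "z \<in> carrier L" for z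
  proof -
    \<comment> \<open>Of these two preimages of \<open>z\<close>, the smaller is a preimage under
      the maximum and the larger one under the minimum.\<close>
    obtain a b where ab: "a \<in> carrier L" "f a = z" "b \<in> carrier L" "g b = z"
      using Aut_surj[OF f z] Aut_surj[OF g z] by blast
    have c: "f b \<in> carrier L" "g a \<in> carrier L" using ab f g by (simp_all add: Aut_closed)
    have "a \<sqsubseteq> b \<or> b \<sqsubseteq> a" using ab by (simp add: total_order_total)
    then have "?s a = z \<and> ?i b = z \<or> ?s b = z \<and> ?i a = z"
    proof
      assume "a \<sqsubseteq> b"
      then have "z \<sqsubseteq> f b" "g a \<sqsubseteq> z" using Aut_le_iff[OF f, of a b] Aut_le_iff[OF g, of a b] ab by auto
      then show ?thesis using ab c z le_antisym[of "f b" z] le_antisym[of z "g a"] by auto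
    next
      assume "b \<sqsubseteq> a"
      then have "f b \<sqsubseteq> z" "z \<sqsubseteq> g a" using Aut_le_iff[OF f, of b a] Aut_le_iff[OF g, of b a] ab by auto
      then show ?thesis using ab c z by auto
    qed
    then show "\<exists>x\<in>carrier L. ?s x = z" "\<exists>x\<in>carrier L. ?i x = z" using ab by blast+
  qed
  have le: "h x \<sqsubseteq> h y \<longleftrightarrow> x \<sqsubseteq> y"
    if refl: "\<And>x y. \<lbrakk>x \<in> carrier L; y \<in> carrier L; h y \<sqsubseteq> h x\<rbrakk> \<Longrightarrow> y \<sqsubseteq> x"
      and cl: "\<And>x. x \<in> carrier L \<Longrightarrow> h x \<in> carrier L"
      and xy: "x \<in> carrier L" "y \<in> carrier L" for h x y
  proof
    assume "x \<sqsubseteq> y"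
    moreover have "h x \<sqsubseteq> h y \<or> h y \<sqsubseteq> h x" using xy by (intro total_order_total cl)
    ultimately show "h x \<sqsubseteq> h y"
      using refl[OF xy] le_antisym[OF _ _ xy] le_refl[OF cl[OF xy(1)]] by blast
  qed (rule refl[OF xy(2,1)])
  show "?s \<in> carrier (Aut L)"
  proof (rule AutI)
    show "?s x \<sqsubseteq> ?s y \<longleftrightarrow> x \<sqsubseteq> y" if "x \<in> carrier L" "y \<in> carrier L" for x y
      by (rule le[of ?s, OF reflect_s cl(1) that])
  qed (rule restrict_extensional cl surj | assumption)+
  show "?i \<in> carrier (Aut L)"
  proof (rule AutI)
    show "?i x \<sqsubseteq> ?i y \<longleftrightarrow> x \<sqsubseteq> y" if "x \<in> carrier L" "y \<in> carrier L" for x y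
      by (rule le[of ?i, OF reflect_i cl(2) that])
  qed (rule restrict_extensional cl surj | assumption)+
qed

lemma Aut_join_meet:
  assumes f: "f \<in> carrier (Aut L)" and g: "g \<in> carrier (Aut L)"
  shows "least (order_of (Aut L)) (\<lambda>x\<in>carrier L. if f x \<sqsubseteq> g x then g x else f x)
      (Upper (order_of (Aut L)) {f, g})"
    and "greatest (order_of (Aut L)) (\<lambda>x\<in>carrier L. if f x \<sqsubseteq> g x then f x else g x)
      (Lower (order_of (Aut L)) {f, g})"
proof -
  have "f x \<sqsubseteq> g x \<or> g x \<sqsubseteq> f x" if "x \<in> carrier L" for x
    using that f g by (simp add: Aut_closed total_order_total)
  then show "least (order_of (Aut L)) (\<lambda>x\<in>carrier L. if f x \<sqsubseteq> g x then g x else f x)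
      (Upper (order_of (Aut L)) {f, g})"
    and "greatest (order_of (Aut L)) (\<lambda>x\<in>carrier L. if f x \<sqsubseteq> g x then f x else g x)
      (Lower (order_of (Aut L)) {f, g})"
    using f g Aut_pick[OF f g]
    by (auto simp: least_def Upper_def greatest_def Lower_def Aut_simps Aut_closed)
qed

lemma Aut_l_group: "l_group (Aut L)"
proof -
  have po: "partial_order (order_of (Aut L))"
  proof
    fix f g assume "f \<in> carrier (order_of (Aut L))" "g \<in> carrier (order_of (Aut L))"
      and le: "f \<sqsubseteq>\<^bsub>order_of (Aut L)\<^esub> g" "g \<sqsubseteq>\<^bsub>order_of (Aut L)\<^esub> f"
    then have fg: "f \<in> carrier (Aut L)" "g \<in> carrier (Aut L)" by auto
    have "f = g"
    proof (rule extensionalityI)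
      show "f \<in> extensional (carrier L)" "g \<in> extensional (carrier L)"
        using fg by (simp_all add: Aut_carrier_iff)
      show "f x = g x" if "x \<in> carrier L" for x
        using le that fg by (intro le_antisym) (simp_all add: Aut_simps Aut_closed)
    qed
    then show "f .=\<^bsub>order_of (Aut L)\<^esub> g" by simp
  next
    fix f g h assume "f \<in> carrier (order_of (Aut L))" "g \<in> carrier (order_of (Aut L))"
      "h \<in> carrier (order_of (Aut L))"
      and le: "f \<sqsubseteq>\<^bsub>order_of (Aut L)\<^esub> g" "g \<sqsubseteq>\<^bsub>order_of (Aut L)\<^esub> h"
    then show "f \<sqsubseteq>\<^bsub>order_of (Aut L)\<^esub> h"
      by (auto simp: Aut_simps Aut_closed intro: le_trans[of "f x" "g x" "h x" for x])
  qed (simp_all add: Aut_simps Aut_closed)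
  have lat: "lattice (order_of (Aut L))"
  proof -
    interpret P: partial_order "order_of (Aut L)" by (rule po)
    show ?thesis
      by unfold_locales (use Aut_join_meet in \<open>force+\<close>)
  qed
  show ?thesis
    by (intro l_group.intro po_group.intro po_group_axioms.intro l_group_axioms.intro Aut_group po lat)
      (simp add: Aut_simps compose_def Aut_le_iff Aut_closed)
qed

lemma Aut_gjoin_apply:
  assumes f: "f \<in> carrier (Aut L)" and g: "g \<in> carrier (Aut L)" and x: "x \<in> carrier L"
  shows "gjoin (Aut L) f g x = (if f x \<sqsubseteq> g x then g x else f x)"
    and "gmeet (Aut L) f g x = (if f x \<sqsubseteq> g x then f x else g x)"
proof -
  interpret A: l_group "Aut L" by (rule Aut_l_group)
  have t: "f x \<sqsubseteq> g x \<or> g x \<sqsubseteq> f x" if "x \<in> carrier L" for x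
    using that f g by (simp add: Aut_closed total_order_total)
  have "gjoin (Aut L) f g = (\<lambda>x\<in>carrier L. if f x \<sqsubseteq> g x then g x else f x)"
    by (rule A.gjoin_eqI)
      (use t f g Aut_pick[OF f g] in \<open>auto simp: Aut_simps Aut_closed\<close>)
  moreover have "gmeet (Aut L) f g = (\<lambda>x\<in>carrier L. if f x \<sqsubseteq> g x then f x else g x)"
    by (rule A.gmeet_eqI)
      (use t f g Aut_pick[OF f g] in \<open>auto simp: Aut_simps Aut_closed\<close>)
  ultimately show "gjoin (Aut L) f g x = (if f x \<sqsubseteq> g x then g x else f x)"
    "gmeet (Aut L) f g x = (if f x \<sqsubseteq> g x then f x else g x)" using x by simp_all
qed

end

section \<open>The chain of a right pre-order\<close>

locale right_preordered_group = po_group G for G :: "('a, 'm) ordered_group_scheme" (structure) +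
  fixes R :: "'a rel"
  assumes right_preorder: "right_preorder G R"
begin

abbreviation "cone \<equiv> pre_cone G R"
abbreviation "cls a \<equiv> cone_equiv G cone `` {a}"

lemma R_closed: "(a, b) \<in> R \<Longrightarrow> a \<in> carrier G" "(a, b) \<in> R \<Longrightarrow> b \<in> carrier G"
  and R_refl: "a \<in> carrier G \<Longrightarrow> (a, a) \<in> R"
  and R_trans: "\<lbrakk>(a, b) \<in> R; (b, c) \<in> R\<rbrakk> \<Longrightarrow> (a, c) \<in> R"
  and R_total: "\<lbrakk>a \<in> carrier G; b \<in> carrier G\<rbrakk> \<Longrightarrow> (a, b) \<in> R \<or> (b, a) \<in> R"
  and R_of_le: "\<lbrakk>a \<preceq> b; a \<in> carrier G; b \<in> carrier G\<rbrakk> \<Longrightarrow> (a, b) \<in> R"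
  and R_mult: "\<lbrakk>(a, b) \<in> R; t \<in> carrier G\<rbrakk> \<Longrightarrow> (a \<otimes> t, b \<otimes> t) \<in> R"
proof -
  have R: "R \<subseteq> carrier G \<times> carrier G" "refl_on (carrier G) R" "trans R" "total_on (carrier G) R"
    "\<forall>a\<in>carrier G. \<forall>b\<in>carrier G. a \<preceq> b \<longrightarrow> (a, b) \<in> R"
    "\<forall>a b. \<forall>t\<in>carrier G. (a, b) \<in> R \<longrightarrow> (a \<otimes> t, b \<otimes> t) \<in> R"
    using right_preorder unfolding right_preorder_def by simp_all
  show "(a, b) \<in> R \<Longrightarrow> a \<in> carrier G" "(a, b) \<in> R \<Longrightarrow> b \<in> carrier G" using R(1) by auto
  show refl: "a \<in> carrier G \<Longrightarrow> (a, a) \<in> R" using R(2) by (rule refl_onD)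
  show "\<lbrakk>(a, b) \<in> R; (b, c) \<in> R\<rbrakk> \<Longrightarrow> (a, c) \<in> R" using R(3) by (rule transD)
  show "\<lbrakk>a \<in> carrier G; b \<in> carrier G\<rbrakk> \<Longrightarrow> (a, b) \<in> R \<or> (b, a) \<in> R"
    using R(4) refl unfolding total_on_def by (cases "a = b") simp_all
  show "\<lbrakk>a \<preceq> b; a \<in> carrier G; b \<in> carrier G\<rbrakk> \<Longrightarrow> (a, b) \<in> R" using R(5) by simp
  show "\<lbrakk>(a, b) \<in> R; t \<in> carrier G\<rbrakk> \<Longrightarrow> (a \<otimes> t, b \<otimes> t) \<in> R" using R(6) by simp
qed

lemma R_mult_iff:
  assumes "a \<in> carrier G" "b \<in> carrier G" "t \<in> carrier G"
  shows "(a \<otimes> t, b \<otimes> t) \<in> R \<longleftrightarrow> (a, b) \<in> R"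
  using R_mult[of a b t] R_mult[of "a \<otimes> t" "b \<otimes> t" "inv t"] assms by (auto simp: m_assoc)

text \<open>Right multiplication by \<open>inv a\<close> and by \<open>a\<close> moves
  \<open>(a, b)\<close> to \<open>(\<one>, b \<otimes> inv a)\<close> and back. So everything
  defined from the cone may be computed with \<open>R\<close>.\<close>

lemma cone_rel_cone: "cone_rel G cone = R"
proof -
  have "(\<one>, b \<otimes> inv a) \<in> R \<longleftrightarrow> (a, b) \<in> R" if "a \<in> carrier G" "b \<in> carrier G" for a b
    using R_mult_iff[of \<one> "b \<otimes> inv a" a] that by (simp add: m_assoc)
  then show ?thesis
    using R_closed by (auto simp: cone_rel_def pre_cone_def)
qed

lemma cone_equiv_iff: "(a, b) \<in> cone_equiv G cone \<longleftrightarrow> (a, b) \<in> R \<and> (b, a) \<in> R"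
  by (simp add: cone_equiv_def cone_rel_cone)

lemma equiv_cone_equiv: "equiv (carrier G) (cone_equiv G cone)"
proof (rule equivI)
  show "refl_on (carrier G) (cone_equiv G cone)"
    by (rule refl_onI) (simp add: cone_equiv_iff R_refl)
  show "trans (cone_equiv G cone)"
    by (rule transI) (auto simp: cone_equiv_iff intro: R_trans)
  show "cone_equiv G cone \<subseteq> carrier G \<times> carrier G"
    by (auto simp: cone_equiv_iff R_closed)
qed (rule symI, simp add: cone_equiv_iff)

lemma cls_eq_iff:
  "\<lbrakk>a \<in> carrier G; b \<in> carrier G\<rbrakk> \<Longrightarrow> cls a = cls b \<longleftrightarrow> (a, b) \<in> R \<and> (b, a) \<in> R"
  using eq_equiv_class_iff[OF equiv_cone_equiv] by (simp add: cone_equiv_iff)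

lemma mem_cls: "b \<in> cls a \<longleftrightarrow> (a, b) \<in> R \<and> (b, a) \<in> R"
  by (simp add: cone_equiv_iff)

lemma carrier_Omega: "carrier (Omega G cone) = (\<lambda>a. cls a) ` carrier G"
  by (auto simp: Omega_def quotient_def)

lemma Omega_le_iff:
  assumes "a \<in> carrier G" "b \<in> carrier G"
  shows "cls a \<sqsubseteq>\<^bsub>Omega G cone\<^esub> cls b \<longleftrightarrow> (a, b) \<in> R"
proof
  assume "cls a \<sqsubseteq>\<^bsub>Omega G cone\<^esub> cls b"
  then obtain a' b' where "a' \<in> cls a" "b' \<in> cls b" "(a', b') \<in> R"
    by (auto simp: Omega_def cone_rel_cone)
  then show "(a, b) \<in> R" unfolding mem_cls by (meson R_trans)
next
  assume "(a, b) \<in> R"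
  moreover have "a \<in> cls a" "b \<in> cls b" using assms by (simp_all only: mem_cls R_refl)
  ultimately show "cls a \<sqsubseteq>\<^bsub>Omega G cone\<^esub> cls b"
    unfolding Omega_def gorder.simps cone_rel_cone by blast
qed

lemma Omega_chain: "chain (Omega G cone)"
proof -
  have eq: "(.=\<^bsub>Omega G cone\<^esub>) = (=)" by (simp add: Omega_def)
  have po: "partial_order (Omega G cone)"
  proof
    fix X assume "X \<in> carrier (Omega G cone)"
    then show "X \<sqsubseteq>\<^bsub>Omega G cone\<^esub> X" by (auto simp: carrier_Omega Omega_le_iff R_refl)
  next
    fix X Y assume "X \<in> carrier (Omega G cone)" "Y \<in> carrier (Omega G cone)"
      "X \<sqsubseteq>\<^bsub>Omega G cone\<^esub> Y" "Y \<sqsubseteq>\<^bsub>Omega G cone\<^esub> X"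
    then show "X .=\<^bsub>Omega G cone\<^esub> Y"
      unfolding eq carrier_Omega by (elim imageE) (simp only: Omega_le_iff cls_eq_iff)
  next
    fix X Y Z
    assume "X \<in> carrier (Omega G cone)" "Y \<in> carrier (Omega G cone)" "Z \<in> carrier (Omega G cone)"
      "X \<sqsubseteq>\<^bsub>Omega G cone\<^esub> Y" "Y \<sqsubseteq>\<^bsub>Omega G cone\<^esub> Z"
    then show "X \<sqsubseteq>\<^bsub>Omega G cone\<^esub> Z"
      unfolding carrier_Omega by (elim imageE) (simp only: Omega_le_iff, rule R_trans)
  qed (simp_all add: eq)
  show ?thesis
    unfolding chain_def total_order_def total_order_axioms_def
  proof (intro conjI po allI impI)
    fix X Y assume "X \<in> carrier (Omega G cone)" "Y \<in> carrier (Omega G cone)"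
    then show "X \<sqsubseteq>\<^bsub>Omega G cone\<^esub> Y \<or> Y \<sqsubseteq>\<^bsub>Omega G cone\<^esub> X"
      unfolding carrier_Omega by (elim imageE) (simp only: Omega_le_iff R_total)
  qed
qed

sublocale Omega: chain "Omega G cone"
  by (rule Omega_chain)

sublocale Aut_Omega: l_group "Aut (Omega G cone)"
  by (rule Omega.Aut_l_group)

text \<open>Right invariance of \<open>R\<close> makes the union over the class independent of the
  representative.\<close>

lemma right_translation_cls:
  assumes a: "a \<in> carrier G" and b: "b \<in> carrier G"
  shows "right_translation G cone a (cls b) = cls (b \<otimes> a)"
proof -
  have "cls b \<in> carrier (Omega G cone)" using b by (simp add: carrier_Omega)
  then have "right_translation G cone a (cls b) = (\<Union>b'\<in>cls b. cls (b' \<otimes> a))"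
    by (simp add: right_translation_def)
  also have "\<dots> = cls (b \<otimes> a)"
  proof (rule UN_equiv_class[OF equiv_cone_equiv _ b])
    show "(\<lambda>b. cls (b \<otimes> a)) respects cone_equiv G cone"
    proof (rule congruentI)
      fix x y assume "(x, y) \<in> cone_equiv G cone"
      then have xy: "(x, y) \<in> R" "(y, x) \<in> R" by (simp_all add: cone_equiv_iff)
      then show "cls (x \<otimes> a) = cls (y \<otimes> a)"
        using cls_eq_iff[of "x \<otimes> a" "y \<otimes> a"] R_mult[of x y a] R_mult[of y x a] R_closed[OF xy(1)] a
        by simp
    qed
  qed
  finally show ?thesis .
qed

lemma right_translation_Aut:
  assumes a: "a \<in> carrier G" shows "right_translation G cone a \<in> carrier (Aut (Omega G cone))"
proof (rule Omega.AutI)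
  show "right_translation G cone a \<in> extensional (carrier (Omega G cone))"
    by (simp add: right_translation_def)
  fix X assume "X \<in> carrier (Omega G cone)"
  then obtain b where b: "b \<in> carrier G" "X = cls b" unfolding carrier_Omega by blast
  then show "right_translation G cone a X \<in> carrier (Omega G cone)"
    using a by (simp add: right_translation_cls) (simp add: carrier_Omega)
  show "\<exists>Y\<in>carrier (Omega G cone). right_translation G cone a Y = X"
  proof (rule bexI)
    show "cls (b \<otimes> inv a) \<in> carrier (Omega G cone)" using a b by (simp add: carrier_Omega)
    show "right_translation G cone a (cls (b \<otimes> inv a)) = X"
      using a b by (simp add: right_translation_cls m_assoc)
  qed
  fix Y assume "Y \<in> carrier (Omega G cone)"
  then obtain c where c: "c \<in> carrier G" "Y = cls c" unfolding carrier_Omega by blast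
  show "right_translation G cone a X \<sqsubseteq>\<^bsub>Omega G cone\<^esub> right_translation G cone a Y
      \<longleftrightarrow> X \<sqsubseteq>\<^bsub>Omega G cone\<^esub> Y"
    using a b c by (simp only: right_translation_cls Omega_le_iff R_mult_iff m_closed)
qed

text \<open>The product in \<open>Aut\<close> applies its left factor first, so right
  multiplications give a homomorphism and not an anti-homomorphism. Monotonicity needs a left
  translation, available for the order of \<open>G\<close> but not in general for \<open>R\<close>:
  the inequality is translated in \<open>G\<close> and then transferred.\<close>

lemma right_translation_po_hom: "right_translation G cone \<in> po_hom G (Aut (Omega G cone))"
  unfolding po_hom_def
proof (intro CollectI conjI ballI impI)
  show "right_translation G cone \<in> hom G (Aut (Omega G cone))"
  proof (rule homI)
    fix a b assume ab: "a \<in> carrier G" "b \<in> carrier G"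
    show "right_translation G cone (a \<otimes> b) =
      right_translation G cone a \<otimes>\<^bsub>Aut (Omega G cone)\<^esub> right_translation G cone b"
    proof (rule extensionalityI)
      fix X assume X: "X \<in> carrier (Omega G cone)"
      then obtain c where c: "c \<in> carrier G" "X = cls c" unfolding carrier_Omega by blast
      show "right_translation G cone (a \<otimes> b) X =
        (right_translation G cone a \<otimes>\<^bsub>Aut (Omega G cone)\<^esub> right_translation G cone b) X"
        unfolding Aut_simps compose_eq[OF X]
        using ab c by (simp add: right_translation_cls m_assoc)
    qed (simp_all add: right_translation_def Aut_simps)
  qed (rule right_translation_Aut)
  fix a b assume ab: "a \<in> carrier G" "b \<in> carrier G" "a \<preceq> b"
  have "(c \<otimes> a, c \<otimes> b) \<in> R" if "c \<in> carrier G" for c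
    using translation[of a b c \<one>] ab that by (intro R_of_le) simp_all
  then show "right_translation G cone a \<preceq>\<^bsub>Aut (Omega G cone)\<^esub> right_translation G cone b"
    unfolding Aut_simps carrier_Omega using ab
    by (auto simp only: right_translation_cls Omega_le_iff m_closed)
qed

abbreviation "translations \<equiv> l_subgroup_generated (Aut (Omega G cone)) (right_translation G cone ` carrier G)"

lemma translations_l_subgroup: "l_subgroup translations (Aut (Omega G cone))"
  and right_translation_translations: "a \<in> carrier G \<Longrightarrow> right_translation G cone a \<in> translations"
  and translations_least: "\<lbrakk>l_subgroup S (Aut (Omega G cone)); right_translation G cone ` carrier G \<subseteq> S\<rbrakk>
    \<Longrightarrow> translations \<subseteq> S"
  using l_subgroup_generated[OF Omega.Aut_l_group, of "right_translation G cone ` carrier G"]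
    right_translation_Aut by blast+

lemma H_of_l_group: "l_group (H_of G cone)"
  and H_of_inclusion: "(\<lambda>f. f) \<in> l_hom (H_of G cone) (Aut (Omega G cone))"
  unfolding H_of_def
  by (rule l_subgroup_l_group[OF Omega.Aut_l_group translations_l_subgroup]
      l_subgroup_inclusion[OF Omega.Aut_l_group translations_l_subgroup])+

lemma carrier_H_of: "carrier (H_of G cone) = translations"
  by (simp add: H_of_def)

lemma right_translation_H_of: "right_translation G cone \<in> po_hom G (H_of G cone)"
  using right_translation_po_hom right_translation_translations
  by (auto simp: po_hom_def hom_def H_of_def)

end

section \<open>Lattices generated by subgroups\<close>

context l_group
begin

text \<open>Products and inverses are left out as constructors, so that inductions over this set
  have only join and meet steps.\<close>

inductive_set lattice_span :: "'a set \<Rightarrow> 'a set" for A where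
  base: "a \<in> A \<Longrightarrow> a \<in> lattice_span A"
| join: "\<lbrakk>x \<in> lattice_span A; y \<in> lattice_span A\<rbrakk> \<Longrightarrow> x \<squnion> y \<in> lattice_span A"
| meet: "\<lbrakk>x \<in> lattice_span A; y \<in> lattice_span A\<rbrakk> \<Longrightarrow> x \<sqinter> y \<in> lattice_span A"

lemma lattice_span_subset:
  assumes "A \<subseteq> carrier G" shows "lattice_span A \<subseteq> carrier G"
proof
  fix x assume "x \<in> lattice_span A"
  then show "x \<in> carrier G" by induction (use assms in auto)
qed

text \<open>Multiplication distributes over joins and meets on both sides and inversion exchanges them, so
  the sublattice generated by a subgroup is already an \<open>\<ell>\<close>-subgroup.\<close>

lemma lattice_span_l_subgroup:
  assumes A: "subgroup A G"
  shows "l_subgroup (lattice_span A) G"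
proof -
  have sub: "x \<in> carrier G" if "x \<in> lattice_span A" for x
    using lattice_span_subset[OF subgroup.subset[OF A]] that by blast
  have left: "a \<otimes> y \<in> lattice_span A" if "a \<in> A" "y \<in> lattice_span A" for a y
    using that(2)
  proof induction
    case (base b)
    then show ?case using that(1) A by (intro lattice_span.base subgroup.m_closed)
  qed (use subsetD[OF subgroup.subset[OF A] that(1)] sub in
      \<open>auto simp: mult_gjoin_left mult_gmeet_left intro: lattice_span.intros\<close>)
  have mult: "x \<otimes> y \<in> lattice_span A" if "x \<in> lattice_span A" "y \<in> lattice_span A" for x y
    using that(1)
    by induction (use that(2) sub left in
      \<open>auto simp: mult_gjoin_right mult_gmeet_right intro: lattice_span.intros\<close>)
  have inv: "inv x \<in> lattice_span A" if "x \<in> lattice_span A" for x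
    using that
    by induction (use sub subgroup.m_inv_closed[OF A] in
      \<open>auto simp: inv_gjoin inv_gmeet intro: lattice_span.intros\<close>)
  have "subgroup (lattice_span A) G"
  proof (rule subgroupI)
    show "lattice_span A \<noteq> {}" using subgroup.one_closed[OF A] lattice_span.base by blast
  qed (use sub mult inv in blast)+
  then show ?thesis
    by (simp add: l_subgroup_def lattice_span.join lattice_span.meet)
qed

lemma l_subgroup_leval:
  assumes S: "l_subgroup S G" and e: "e ` lvars t \<subseteq> S" shows "leval G e t \<in> S"
  using e
  by (induction t)
    (auto simp: image_Un l_subgroup_one[OF S] l_subgroup_mult[OF S] l_subgroup_inv[OF S]
      l_subgroup_join[OF S] l_subgroup_meet[OF S])

end

section \<open>Prime subgroups of the free group as right pre-orders\<close>

lemma l_hom_image_l_subgroup: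
  assumes "l_group H" "l_group K" and h: "h \<in> l_hom H K"
  shows "l_subgroup (h ` carrier H) K"
proof -
  interpret H: l_group H by fact
  interpret K: l_group K by fact
  interpret group_hom H K h
    using h by unfold_locales (simp add: l_hom_def)
  have "gjoin K (h x) (h y) = h (gjoin H x y)" "gmeet K (h x) (h y) = h (gmeet H x y)"
    if "x \<in> carrier H" "y \<in> carrier H" for x y
    using h that by (simp_all add: l_hom_def)
  then show ?thesis
    unfolding l_subgroup_def using img_is_subgroup by auto
qed

text \<open>An assignment into \<open>K\<close> lifts along \<open>h\<close> to one into
  \<open>H\<close>, where the equations hold. Values of terms are compared in the ambient
  \<open>L\<close>, into which both \<open>h\<close> and the inclusion of \<open>K\<close>
  map.\<close>

lemma in_variety_of_image:
  assumes H: "in_variety H V" and K: "l_group K" and L: "l_group L"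
    and h: "h \<in> l_hom H L" and incl: "(\<lambda>x. x) \<in> l_hom K L" and sub: "carrier K \<subseteq> h ` carrier H"
  shows "in_variety K V"
  unfolding in_variety_def
proof (intro conjI K ballI, clarify)
  have lH: "l_group H" using H by (simp add: in_variety_def)
  fix s t and e :: "nat \<Rightarrow> _"
  assume st: "(s, t) \<in> V" and e: "range e \<subseteq> carrier K"
  have "\<forall>v. \<exists>x. x \<in> carrier H \<and> h x = e v" using e sub by (metis imageE range_subsetD subsetD)
  then obtain x where x: "\<And>v. x v \<in> carrier H" "\<And>v. h (x v) = e v" by metis
  have "leval K e u = h (leval H x u)" for u
  proof -
    have "leval K e u = leval L ((\<lambda>x. x) \<circ> e) u"
      using l_hom_leval[OF K L incl, of e u] e by auto
    also have "(\<lambda>x. x) \<circ> e = h \<circ> x" using x by (auto simp: fun_eq_iff)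
    also have "leval L (h \<circ> x) u = h (leval H x u)"
      by (rule l_hom_leval[OF lH L h, symmetric]) (use x(1) in blast)
    finally show ?thesis .
  qed
  moreover have "leval H x s = leval H x t"
    using H st x(1) unfolding in_variety_def by blast
  ultimately show "leval K e s = leval K e t" by simp
qed

locale free_l_group_over =
  fixes G :: "'g ordered_group" and V :: variety and H :: "'h ordered_group" and \<eta> :: "'g \<Rightarrow> 'h"
  assumes po_group_G: "po_group G" and free: "free_l_group V G H \<eta>"
begin

lemma in_variety_H: "in_variety H V"
  using free by (simp add: free_l_group_def)

lemma eta_po_hom: "\<eta> \<in> po_hom G H"
  using free by (simp add: free_l_group_def)

sublocale G: po_group G
  by (rule po_group_G)

sublocale H: l_group H
  using in_variety_H by (simp add: in_variety_def)

sublocale eta: group_hom G H \<eta>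
  using eta_po_hom by unfold_locales (simp add: po_hom_def)

lemma eta_mono: "\<lbrakk>a \<preceq>\<^bsub>G\<^esub> b; a \<in> carrier G; b \<in> carrier G\<rbrakk> \<Longrightarrow> \<eta> a \<preceq>\<^bsub>H\<^esub> \<eta> b"
  using eta_po_hom by (simp add: po_hom_def)

text \<open>Some extension of \<open>\<eta>\<close> along itself takes only values of terms over
  \<open>G\<close>. Uniqueness identifies it with the identity, and the sublattice spanned by a
  subgroup is closed under all term operations.\<close>

lemma lattice_span_eta: "H.lattice_span (\<eta> ` carrier G) = carrier H"
proof
  show "H.lattice_span (\<eta> ` carrier G) \<subseteq> carrier H"
    by (rule H.lattice_span_subset) auto
  show "carrier H \<subseteq> H.lattice_span (\<eta> ` carrier G)"
  proof
    fix x assume x: "x \<in> carrier H"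
    obtain h where h: "h \<in> l_hom H H" "\<And>a. a \<in> carrier G \<Longrightarrow> h (\<eta> a) = \<eta> a"
      "\<And>x. x \<in> carrier H \<Longrightarrow> \<exists>t. lvars t \<subseteq> carrier G \<and> h x = leval H \<eta> t"
      using extension_into_generated[OF po_group_G free in_variety_H eta_po_hom] by metis
    have "(\<lambda>x. x) \<in> l_hom H H" by (simp add: l_hom_def hom_def)
    moreover have "unique_extension G H \<eta> H"
      using free in_variety_H by (simp add: free_l_group_def)
    ultimately have "restrict h (carrier H) = restrict (\<lambda>x. x) (carrier H)"
      using eta_po_hom h(1,2) l_hom_restrict[OF H.l_group_axioms] eta.hom_closed
      unfolding unique_extension_def
      by (smt (verit, ccfv_threshold) restrict_apply' restrict_extensional)
    then have "h x = x" using x by (metis restrict_apply')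
    then obtain t where t: "lvars t \<subseteq> carrier G" "x = leval H \<eta> t" using h(3)[OF x] by auto
    show "x \<in> H.lattice_span (\<eta> ` carrier G)"
      unfolding t(2)
    proof (rule H.l_subgroup_leval[OF H.lattice_span_l_subgroup])
      show "subgroup (\<eta> ` carrier G) H" by (rule eta.img_is_subgroup)
      show "\<eta> ` lvars t \<subseteq> H.lattice_span (\<eta> ` carrier G)"
        using t(1) H.lattice_span.base by blast
    qed
  qed
qed

lemma H_induct [consumes 1, case_names eta join meet]:
  assumes x: "x \<in> carrier H"
    and eta: "\<And>a. a \<in> carrier G \<Longrightarrow> P (\<eta> a)"
    and join: "\<And>x y. \<lbrakk>x \<in> carrier H; y \<in> carrier H; P x; P y\<rbrakk> \<Longrightarrow> P (gjoin H x y)"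
    and meet: "\<And>x y. \<lbrakk>x \<in> carrier H; y \<in> carrier H; P x; P y\<rbrakk> \<Longrightarrow> P (gmeet H x y)"
  shows "P x"
proof -
  have "x \<in> H.lattice_span (\<eta> ` carrier G)" using x lattice_span_eta by simp
  then show ?thesis
    by induction (use eta join meet lattice_span_eta in auto)
qed

section \<open>Passage from prime subgroups to right pre-orders\<close>

definition cone_of :: "'h set \<Rightarrow> 'g set" where
  "cone_of p = {a \<in> carrier G. H.coset_le p \<one>\<^bsub>H\<^esub> (\<eta> a)}"

lemma mem_cone_of: "a \<in> cone_of p \<longleftrightarrow> a \<in> carrier G \<and> H.coset_le p \<one>\<^bsub>H\<^esub> (\<eta> a)"
  by (simp add: cone_of_def)

lemma coset_le_inv_iff:
  assumes p: "p \<in> Spec H" and x: "x \<in> carrier H"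
  shows "H.coset_le p \<one>\<^bsub>H\<^esub> (inv\<^bsub>H\<^esub> x) \<longleftrightarrow> H.coset_le p x \<one>\<^bsub>H\<^esub>"
  using H.coset_le_mult_right[OF H.Spec_l_subgroup[OF p], of x "\<one>\<^bsub>H\<^esub>" "inv\<^bsub>H\<^esub> x"]
    H.coset_le_mult_right[OF H.Spec_l_subgroup[OF p], of "\<one>\<^bsub>H\<^esub>" "inv\<^bsub>H\<^esub> x" x] x by auto

text \<open>For a prime, the condition that the coset of x lies above \<open>p\<close> turns joins
  into disjunctions and meets into conjunctions, so an inclusion known on the image of
  \<open>G\<close> extends to \<open>H\<close>. The prime consists of the x for which x and its
  inverse both satisfy the condition.\<close>

lemma cone_of_subset_iff:
  assumes p: "p \<in> Spec H" and q: "q \<in> Spec H"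
  shows "cone_of p \<subseteq> cone_of q \<longleftrightarrow> p \<subseteq> q"
proof
  assume "p \<subseteq> q"
  then show "cone_of p \<subseteq> cone_of q"
    unfolding cone_of_def H.coset_le_def by blast
next
  note lp = H.Spec_l_subgroup[OF p] and lq = H.Spec_l_subgroup[OF q]
  assume sub: "cone_of p \<subseteq> cone_of q"
  have le: "H.coset_le p \<one>\<^bsub>H\<^esub> x \<longrightarrow> H.coset_le q \<one>\<^bsub>H\<^esub> x" if "x \<in> carrier H" for x
    using that
  proof (induction rule: H_induct)
    case (eta a)
    then show ?case using sub by (auto simp: cone_of_def)
  next
    case (join x y)
    then show ?case
      using H.Spec_coset_le_gjoin_iff[OF p H.one_closed join(1,2)]
        H.Spec_coset_le_gjoin_iff[OF q H.one_closed join(1,2)] by blast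
  next
    case (meet x y)
    then show ?case
      using H.coset_le_gmeet_iff[OF lp H.one_closed meet(1,2)]
        H.coset_le_gmeet_iff[OF lq H.one_closed meet(1,2)] by blast
  qed
  have mem: "x \<in> r \<longleftrightarrow> H.coset_le r \<one>\<^bsub>H\<^esub> x \<and> H.coset_le r \<one>\<^bsub>H\<^esub> (inv\<^bsub>H\<^esub> x)"
    if r: "r \<in> Spec H" and x: "x \<in> carrier H" for r x
    using H.coset_le_one_both_iff[OF H.Spec_convex[OF r] x] coset_le_inv_iff[OF r x] by auto
  show "p \<subseteq> q"
  proof
    fix x assume xp: "x \<in> p"
    then have x: "x \<in> carrier H" using H.l_subgroup_subset[OF lp] by blast
    then show "x \<in> q"
      using xp mem[OF p x] mem[OF q x] le[OF x] le[of "inv\<^bsub>H\<^esub> x"] by simp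
  qed
qed

lemma inj_cone_of: "inj_on cone_of (Spec H)"
  by (rule inj_onI) (simp add: cone_of_subset_iff set_eq_subset)

text \<open>Modulo a prime, a join or meet is equivalent to one of its two arguments and thus
  inherits a representative.\<close>

lemma coset_representative:
  assumes p: "p \<in> Spec H" and x: "x \<in> carrier H"
  shows "\<exists>b\<in>carrier G. H.coset_le p x (\<eta> b) \<and> H.coset_le p (\<eta> b) x"
proof -
  note lp = H.Spec_l_subgroup[OF p]
  let ?eq = "\<lambda>x y. H.coset_le p x y \<and> H.coset_le p y x"
  have refl: "H.coset_le p x x" if "x \<in> carrier H" for x
    using H.coset_le_of_le[OF lp H.order_refl that] that by blast
  have trans: "?eq x z" if "?eq x y" "?eq y z" "x \<in> carrier H" "y \<in> carrier H" "z \<in> carrier H" for x y z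
    using that H.coset_le_trans[OF lp, of x y z] H.coset_le_trans[OF lp, of z y x] by blast
  have *: "\<exists>b\<in>carrier G. ?eq w (\<eta> b)"
    if w: "?eq w x \<or> ?eq w y" "w \<in> carrier H" "x \<in> carrier H" "y \<in> carrier H"
      and x: "\<exists>b\<in>carrier G. ?eq x (\<eta> b)" and y: "\<exists>b\<in>carrier G. ?eq y (\<eta> b)" for w x y
    using w(1)
  proof
    assume wx: "?eq w x"
    from x obtain b where b: "b \<in> carrier G" "?eq x (\<eta> b)" by blast
    have "?eq w (\<eta> b)" by (rule trans[OF wx b(2)]) (use b(1) w in simp_all)
    then show ?thesis using b(1) by blast
  next
    assume wy: "?eq w y"
    from y obtain b where b: "b \<in> carrier G" "?eq y (\<eta> b)" by blast
    have "?eq w (\<eta> b)" by (rule trans[OF wy b(2)]) (use b(1) w in simp_all)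
    then show ?thesis using b(1) by blast
  qed
  show ?thesis
    using x
  proof (induction rule: H_induct)
    case (eta a)
    show ?case by (rule bexI[OF _ eta]) (simp add: refl eta)
  next
    case (join x y)
    have "?eq (gjoin H x y) x \<or> ?eq (gjoin H x y) y"
      using H.Spec_coset_le_total[OF p join(1,2)] refl join(1,2)
        H.gjoin_coset_le_iff[OF lp join(1) join(1,2)] H.gjoin_coset_le_iff[OF lp join(2) join(1,2)]
        H.coset_le_of_le[OF lp H.gjoin_left] H.coset_le_of_le[OF lp H.gjoin_right] by auto
    then show ?case
      by (rule *) (use join in simp_all)
  next
    case (meet x y)
    have "?eq (gmeet H x y) x \<or> ?eq (gmeet H x y) y"
      using H.Spec_coset_le_total[OF p meet(1,2)] refl meet(1,2)
        H.coset_le_gmeet_iff[OF lp meet(1) meet(1,2)] H.coset_le_gmeet_iff[OF lp meet(2) meet(1,2)]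
        H.coset_le_of_le[OF lp H.gmeet_left] H.coset_le_of_le[OF lp H.gmeet_right] by auto
    then show ?case
      by (rule *) (use meet in simp_all)
  qed
qed

definition preorder_of :: "'h set \<Rightarrow> 'g rel" where
  "preorder_of p = {(a, b) \<in> carrier G \<times> carrier G. H.coset_le p (\<eta> a) (\<eta> b)}"

lemma mem_preorder_of:
  "(a, b) \<in> preorder_of p \<longleftrightarrow> a \<in> carrier G \<and> b \<in> carrier G \<and> H.coset_le p (\<eta> a) (\<eta> b)"
  by (simp add: preorder_of_def)

lemma pre_cone_preorder_of: "pre_cone G (preorder_of p) = cone_of p"
  by (auto simp: pre_cone_def mem_preorder_of cone_of_def)

lemma right_preorder_of:
  assumes p: "p \<in> Spec H" shows "right_preorder G (preorder_of p)"
proof -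
  note lp = H.Spec_l_subgroup[OF p]
  \<comment> \<open>If all pairs were related, every \<open>\<eta> a\<close> would lie in
    \<open>p\<close>, and an l-subgroup containing these is all of \<open>H\<close>.\<close>
  have "preorder_of p \<noteq> carrier G \<times> carrier G"
  proof
    assume all: "preorder_of p = carrier G \<times> carrier G"
    have eta_p: "\<eta> a \<in> p" if a: "a \<in> carrier G" for a
    proof -
      have "(a, \<one>\<^bsub>G\<^esub>) \<in> preorder_of p" "(\<one>\<^bsub>G\<^esub>, a) \<in> preorder_of p" using a all by simp_all
      then show ?thesis
        using H.coset_le_one_both_iff[OF H.Spec_convex[OF p], of "\<eta> a"] a
        by (simp add: mem_preorder_of)
    qed
    have "x \<in> p" if "x \<in> carrier H" for x
      using that by (induction rule: H_induct)
        (auto intro: eta_p H.l_subgroup_join[OF lp] H.l_subgroup_meet[OF lp])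
    then show False
      using H.Spec_proper[OF p] H.l_subgroup_subset[OF lp] by blast
  qed
  moreover have "refl_on (carrier G) (preorder_of p)"
    by (rule refl_onI) (simp add: mem_preorder_of H.coset_le_of_le[OF lp])
  moreover have "trans (preorder_of p)"
    by (rule transI) (auto simp: mem_preorder_of intro: H.coset_le_trans[OF lp])
  moreover have "total_on (carrier G) (preorder_of p)"
    using H.Spec_coset_le_total[OF p] by (simp add: total_on_def mem_preorder_of)
  moreover have "(a, b) \<in> preorder_of p" if "a \<in> carrier G" "b \<in> carrier G" "a \<preceq>\<^bsub>G\<^esub> b" for a b
    using that by (simp add: mem_preorder_of H.coset_le_of_le[OF lp] eta_mono)
  moreover have "(a \<otimes>\<^bsub>G\<^esub> t, b \<otimes>\<^bsub>G\<^esub> t) \<in> preorder_of p"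
    if "(a, b) \<in> preorder_of p" "t \<in> carrier G" for a b t
    using that by (simp add: mem_preorder_of H.coset_le_mult_right[OF lp])
  ultimately show ?thesis
    unfolding right_preorder_def by (auto simp: preorder_of_def)
qed

text \<open>The chain of the right pre-order of \<open>p\<close> is isomorphic to \<open>H/p\<close>, every coset of \<open>p\<close> being
  represented by an element of \<open>G\<close>. Right multiplication therefore makes \<open>H\<close> act on it, and
  \<open>H_of G (cone_of p)\<close> is a quotient of \<open>H\<close>.\<close>

lemma in_variety_H_of_cone_of:
  assumes p: "p \<in> Spec H" shows "in_variety (H_of G (cone_of p)) V"
proof -
  note lp = H.Spec_l_subgroup[OF p]
  interpret P: right_preordered_group G "preorder_of p"
    by unfold_locales (rule right_preorder_of[OF p])
  let ?O = "Omega G (pre_cone G (preorder_of p))"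
  let ?le = "H.coset_le p"
  let ?eq = "\<lambda>x y. ?le x y \<and> ?le y x"
  \<comment> \<open>The image of the class of \<open>a\<close> consists of the elements of
    \<open>G\<close> that represent the coset of the product of \<open>\<eta> a\<close> and
    \<open>x\<close>; ranging over all \<open>a\<close> in the class avoids choosing one.\<close>
  define \<rho> where "\<rho> x = (\<lambda>X\<in>carrier ?O. {b \<in> carrier G. \<exists>a\<in>X. ?eq (\<eta> b) (\<eta> a \<otimes>\<^bsub>H\<^esub> x)})" for x
  have refl: "?le x x" if "x \<in> carrier H" for x
    by (rule H.coset_le_of_le[OF lp H.order_refl[OF that] that])
  have trans: "?le x z"
    if "?le x y" "?le y z" "x \<in> carrier H" "y \<in> carrier H" "z \<in> carrier H" for x y z
    using that by (rule H.coset_le_trans[OF lp])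
  have mult: "?le (x \<otimes>\<^bsub>H\<^esub> z) (y \<otimes>\<^bsub>H\<^esub> z)"
    if "?le x y" "x \<in> carrier H" "y \<in> carrier H" "z \<in> carrier H" for x y z
    using that by (rule H.coset_le_mult_right[OF lp])
  \<comment> \<open>Any single representative \<open>c\<close> of the product coset determines the
    value; \<open>coset_representative\<close> supplies one in \<open>act\<close>.\<close>
  have cls: "\<rho> x (P.cls a) = P.cls c"
    if a: "a \<in> carrier G" and c: "c \<in> carrier G" and x: "x \<in> carrier H"
      and e: "?eq (\<eta> c) (\<eta> a \<otimes>\<^bsub>H\<^esub> x)" for a c x
  proof -
    have 1: "?eq (\<eta> b) (\<eta> a' \<otimes>\<^bsub>H\<^esub> x) \<longleftrightarrow> ?eq (\<eta> b) (\<eta> c)"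
      if "a' \<in> P.cls a" "b \<in> carrier G" for a' b
    proof -
      have a': "a' \<in> carrier G" "?eq (\<eta> a) (\<eta> a')"
        using that(1) unfolding P.mem_cls mem_preorder_of by simp_all
      then have "?eq (\<eta> a \<otimes>\<^bsub>H\<^esub> x) (\<eta> a' \<otimes>\<^bsub>H\<^esub> x)" using a x by (simp add: mult)
      then have "?eq (\<eta> c) (\<eta> a' \<otimes>\<^bsub>H\<^esub> x)"
        using e a a'(1) c x trans[of "\<eta> c" "\<eta> a \<otimes>\<^bsub>H\<^esub> x" "\<eta> a' \<otimes>\<^bsub>H\<^esub> x"]
          trans[of "\<eta> a' \<otimes>\<^bsub>H\<^esub> x" "\<eta> a \<otimes>\<^bsub>H\<^esub> x" "\<eta> c"] by simp
      then show ?thesis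
        using a'(1) that(2) c x trans[of "\<eta> c" "\<eta> a' \<otimes>\<^bsub>H\<^esub> x" "\<eta> b"]
          trans[of "\<eta> b" "\<eta> a' \<otimes>\<^bsub>H\<^esub> x" "\<eta> c"] trans[of "\<eta> b" "\<eta> c" "\<eta> a' \<otimes>\<^bsub>H\<^esub> x"]
          trans[of "\<eta> a' \<otimes>\<^bsub>H\<^esub> x" "\<eta> c" "\<eta> b"] by auto
    qed
    have aa: "a \<in> P.cls a" unfolding P.mem_cls using P.R_refl[OF a] by simp
    have "\<rho> x (P.cls a) = {b \<in> carrier G. \<exists>a'\<in>P.cls a. ?eq (\<eta> b) (\<eta> a' \<otimes>\<^bsub>H\<^esub> x)}"
      using a by (simp add: \<rho>_def P.carrier_Omega)
    also have "\<dots> = {b \<in> carrier G. ?eq (\<eta> b) (\<eta> c)}"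
      using 1 aa by blast
    also have "\<dots> = P.cls c"
      unfolding set_eq_iff P.mem_cls mem_preorder_of mem_Collect_eq using c by blast
    finally show ?thesis .
  qed
  have act: "\<exists>c\<in>carrier G. ?eq (\<eta> c) (\<eta> a \<otimes>\<^bsub>H\<^esub> x) \<and> \<rho> x (P.cls a) = P.cls c"
    if a: "a \<in> carrier G" and x: "x \<in> carrier H" for a x
  proof -
    have "\<eta> a \<otimes>\<^bsub>H\<^esub> x \<in> carrier H" using a x by simp
    then obtain c where c: "c \<in> carrier G" "?eq (\<eta> c) (\<eta> a \<otimes>\<^bsub>H\<^esub> x)"
      using coset_representative[OF p] by blast
    then show ?thesis using cls[OF a c(1) x c(2)] by blast
  qed
  have cls_le: "P.cls a \<sqsubseteq>\<^bsub>?O\<^esub> P.cls b \<longleftrightarrow> ?le (\<eta> a) (\<eta> b)"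
    if "a \<in> carrier G" "b \<in> carrier G" for a b
    using P.Omega_le_iff[OF that] that by (simp add: mem_preorder_of)
  have le_iff: "\<rho> x (P.cls a) \<sqsubseteq>\<^bsub>?O\<^esub> \<rho> y (P.cls b) \<longleftrightarrow> ?le (\<eta> a \<otimes>\<^bsub>H\<^esub> x) (\<eta> b \<otimes>\<^bsub>H\<^esub> y)"
    if ab: "a \<in> carrier G" "b \<in> carrier G" and xy: "x \<in> carrier H" "y \<in> carrier H" for a b x y
  proof -
    obtain c where c: "c \<in> carrier G" "?eq (\<eta> c) (\<eta> a \<otimes>\<^bsub>H\<^esub> x)" "\<rho> x (P.cls a) = P.cls c"
      using act[OF ab(1) xy(1)] by blast
    obtain d where d: "d \<in> carrier G" "?eq (\<eta> d) (\<eta> b \<otimes>\<^bsub>H\<^esub> y)" "\<rho> y (P.cls b) = P.cls d"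
      using act[OF ab(2) xy(2)] by blast
    have cl: "\<eta> c \<in> carrier H" "\<eta> d \<in> carrier H" "\<eta> a \<otimes>\<^bsub>H\<^esub> x \<in> carrier H" "\<eta> b \<otimes>\<^bsub>H\<^esub> y \<in> carrier H"
      using c d ab xy by simp_all
    have "?le (\<eta> c) (\<eta> d) \<longleftrightarrow> ?le (\<eta> a \<otimes>\<^bsub>H\<^esub> x) (\<eta> b \<otimes>\<^bsub>H\<^esub> y)"
      using c(2) d(2) cl by (meson trans)
    then show ?thesis
      unfolding c(3) d(3) cls_le[OF c(1) d(1)] .
  qed
  have closed: "\<rho> x X \<in> carrier ?O" if "X \<in> carrier ?O" "x \<in> carrier H" for x X
    using that act unfolding P.carrier_Omega by blast
  have Aut: "\<rho> x \<in> carrier (Aut ?O)" if x: "x \<in> carrier H" for x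
  proof (rule P.Omega.AutI)
    show "\<rho> x \<in> extensional (carrier ?O)" by (simp add: \<rho>_def)
    fix X assume X: "X \<in> carrier ?O"
    then show "\<rho> x X \<in> carrier ?O" using x by (rule closed)
    obtain a where a: "a \<in> carrier G" "X = P.cls a" using X unfolding P.carrier_Omega by blast
    obtain c where c: "c \<in> carrier G" "?eq (\<eta> c) (\<eta> a \<otimes>\<^bsub>H\<^esub> inv\<^bsub>H\<^esub> x)"
      using act[OF a(1), of "inv\<^bsub>H\<^esub> x"] x by auto
    have "\<eta> a \<otimes>\<^bsub>H\<^esub> inv\<^bsub>H\<^esub> x \<otimes>\<^bsub>H\<^esub> x = \<eta> a" using a x by (simp add: H.m_assoc)
    then have "?eq (\<eta> a) (\<eta> c \<otimes>\<^bsub>H\<^esub> x)"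
      using mult[of "\<eta> c" "\<eta> a \<otimes>\<^bsub>H\<^esub> inv\<^bsub>H\<^esub> x" x] mult[of "\<eta> a \<otimes>\<^bsub>H\<^esub> inv\<^bsub>H\<^esub> x" "\<eta> c" x] a c x by simp
    then have "\<rho> x (P.cls c) = X" unfolding a(2) using cls[OF c(1) a(1) x] by blast
    then show "\<exists>Y\<in>carrier ?O. \<rho> x Y = X" using c(1) unfolding P.carrier_Omega by blast
    fix Y assume "Y \<in> carrier ?O"
    then obtain b where b: "b \<in> carrier G" "Y = P.cls b" unfolding P.carrier_Omega by blast
    have "?le (\<eta> a \<otimes>\<^bsub>H\<^esub> x) (\<eta> b \<otimes>\<^bsub>H\<^esub> x) \<longleftrightarrow> ?le (\<eta> a) (\<eta> b)"
      using mult[of "\<eta> a" "\<eta> b" x] mult[of "\<eta> a \<otimes>\<^bsub>H\<^esub> x" "\<eta> b \<otimes>\<^bsub>H\<^esub> x" "inv\<^bsub>H\<^esub> x"] a(1) b(1) x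
      by (auto simp: H.m_assoc)
    then show "\<rho> x X \<sqsubseteq>\<^bsub>?O\<^esub> \<rho> x Y \<longleftrightarrow> X \<sqsubseteq>\<^bsub>?O\<^esub> Y"
      unfolding a(2) b(2) le_iff[OF a(1) b(1) x x] cls_le[OF a(1) b(1)] .
  qed
  have eqI: "\<rho> z X = \<rho> y X" if "X = P.cls a" "a \<in> carrier G" "z \<in> carrier H" "y \<in> carrier H"
    "?eq (\<eta> a \<otimes>\<^bsub>H\<^esub> z) (\<eta> a \<otimes>\<^bsub>H\<^esub> y)" for X a y z
  proof (rule P.Omega.le_antisym)
    have "X \<in> carrier ?O" using that unfolding P.carrier_Omega by blast
    then show "\<rho> z X \<in> carrier ?O" "\<rho> y X \<in> carrier ?O" using that closed by simp_all
    show "\<rho> z X \<sqsubseteq>\<^bsub>?O\<^esub> \<rho> y X" "\<rho> y X \<sqsubseteq>\<^bsub>?O\<^esub> \<rho> z X"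
      using that le_iff by simp_all
  qed
  have mono: "\<rho> x \<preceq>\<^bsub>Aut ?O\<^esub> \<rho> y" if "x \<preceq>\<^bsub>H\<^esub> y" "x \<in> carrier H" "y \<in> carrier H" for x y
    unfolding Aut_simps P.carrier_Omega
  proof clarify
    fix a assume a: "a \<in> carrier G"
    have "\<eta> a \<otimes>\<^bsub>H\<^esub> x \<preceq>\<^bsub>H\<^esub> \<eta> a \<otimes>\<^bsub>H\<^esub> y" using that a by (simp add: H.mult_left_mono)
    then have "?le (\<eta> a \<otimes>\<^bsub>H\<^esub> x) (\<eta> a \<otimes>\<^bsub>H\<^esub> y)"
      by (rule H.coset_le_of_le[OF lp]) (use that a in simp)
    then show "\<rho> x (P.cls a) \<sqsubseteq>\<^bsub>?O\<^esub> \<rho> y (P.cls a)"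
      unfolding le_iff[OF a a that(2,3)] .
  qed
  \<comment> \<open>The coset order decides which of the two products is larger, so at each point
    the join acts as one of \<open>x\<close>, \<open>y\<close> and the meet as the other.\<close>
  have pick: "\<rho> (gjoin H x y) X = \<rho> x X \<and> \<rho> (gmeet H x y) X = \<rho> y X \<or>
      \<rho> (gjoin H x y) X = \<rho> y X \<and> \<rho> (gmeet H x y) X = \<rho> x X"
    if X: "X \<in> carrier ?O" and x: "x \<in> carrier H" and y: "y \<in> carrier H" for x y X
  proof -
    obtain a where a: "a \<in> carrier G" "X = P.cls a" using X unfolding P.carrier_Omega by blast
    have c: "\<eta> a \<otimes>\<^bsub>H\<^esub> x \<in> carrier H" "\<eta> a \<otimes>\<^bsub>H\<^esub> y \<in> carrier H" using a x y by simp_all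
    let ?j = "gjoin H (\<eta> a \<otimes>\<^bsub>H\<^esub> x) (\<eta> a \<otimes>\<^bsub>H\<^esub> y)" and ?m = "gmeet H (\<eta> a \<otimes>\<^bsub>H\<^esub> x) (\<eta> a \<otimes>\<^bsub>H\<^esub> y)"
    have jm: "\<eta> a \<otimes>\<^bsub>H\<^esub> gjoin H x y = ?j" "\<eta> a \<otimes>\<^bsub>H\<^esub> gmeet H x y = ?m"
      using a x y by (simp_all add: H.mult_gjoin_left H.mult_gmeet_left)
    have b: "?le (\<eta> a \<otimes>\<^bsub>H\<^esub> x) ?j" "?le (\<eta> a \<otimes>\<^bsub>H\<^esub> y) ?j" "?le ?m (\<eta> a \<otimes>\<^bsub>H\<^esub> x)" "?le ?m (\<eta> a \<otimes>\<^bsub>H\<^esub> y)"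
      using c by (simp_all add: H.coset_le_of_le[OF lp] H.gjoin_left H.gjoin_right
          H.gmeet_left H.gmeet_right)
    have "?le (\<eta> a \<otimes>\<^bsub>H\<^esub> x) (\<eta> a \<otimes>\<^bsub>H\<^esub> y) \<or> ?le (\<eta> a \<otimes>\<^bsub>H\<^esub> y) (\<eta> a \<otimes>\<^bsub>H\<^esub> x)"
      by (rule H.Spec_coset_le_total[OF p c])
    then show ?thesis
    proof
      assume l: "?le (\<eta> a \<otimes>\<^bsub>H\<^esub> x) (\<eta> a \<otimes>\<^bsub>H\<^esub> y)"
      have "?le ?j (\<eta> a \<otimes>\<^bsub>H\<^esub> y)" "?le (\<eta> a \<otimes>\<^bsub>H\<^esub> x) ?m"
        using l refl c H.gjoin_coset_le_iff[OF lp c(2) c] H.coset_le_gmeet_iff[OF lp c(1) c] by simp_all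
      then have "\<rho> (gjoin H x y) X = \<rho> y X" "\<rho> (gmeet H x y) X = \<rho> x X"
        using b x y eqI[OF a(2,1), of "gjoin H x y" y] eqI[OF a(2,1), of "gmeet H x y" x]
        by (simp_all add: jm)
      then show ?thesis by blast
    next
      assume l: "?le (\<eta> a \<otimes>\<^bsub>H\<^esub> y) (\<eta> a \<otimes>\<^bsub>H\<^esub> x)"
      have "?le ?j (\<eta> a \<otimes>\<^bsub>H\<^esub> x)" "?le (\<eta> a \<otimes>\<^bsub>H\<^esub> y) ?m"
        using l refl c H.gjoin_coset_le_iff[OF lp c(1) c] H.coset_le_gmeet_iff[OF lp c(2) c] by simp_all
      then have "\<rho> (gjoin H x y) X = \<rho> x X" "\<rho> (gmeet H x y) X = \<rho> y X"
        using b x y eqI[OF a(2,1), of "gjoin H x y" x] eqI[OF a(2,1), of "gmeet H x y" y]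
        by (simp_all add: jm)
      then show ?thesis by blast
    qed
  qed
  have hom: "\<rho> \<in> l_hom H (Aut ?O)"
    unfolding l_hom_def
  proof (intro CollectI conjI ballI)
    show "\<rho> \<in> hom H (Aut ?O)"
    proof (rule homI)
      fix x y assume xy: "x \<in> carrier H" "y \<in> carrier H"
      show "\<rho> (x \<otimes>\<^bsub>H\<^esub> y) = \<rho> x \<otimes>\<^bsub>Aut ?O\<^esub> \<rho> y"
      proof (rule extensionalityI)
        fix X assume X: "X \<in> carrier ?O"
        then obtain a where a: "a \<in> carrier G" "X = P.cls a" unfolding P.carrier_Omega by blast
        obtain c where c: "c \<in> carrier G" "?eq (\<eta> c) (\<eta> a \<otimes>\<^bsub>H\<^esub> x)" "\<rho> x (P.cls a) = P.cls c"
          using act[OF a(1) xy(1)] by blast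
        obtain d where d: "d \<in> carrier G" "?eq (\<eta> d) (\<eta> c \<otimes>\<^bsub>H\<^esub> y)" "\<rho> y (P.cls c) = P.cls d"
          using act[OF c(1) xy(2)] by blast
        have "?eq (\<eta> c \<otimes>\<^bsub>H\<^esub> y) (\<eta> a \<otimes>\<^bsub>H\<^esub> (x \<otimes>\<^bsub>H\<^esub> y))"
          using mult[of "\<eta> c" "\<eta> a \<otimes>\<^bsub>H\<^esub> x" y] mult[of "\<eta> a \<otimes>\<^bsub>H\<^esub> x" "\<eta> c" y] c(1,2) a(1) xy
          by (simp add: H.m_assoc)
        then have "?eq (\<eta> d) (\<eta> a \<otimes>\<^bsub>H\<^esub> (x \<otimes>\<^bsub>H\<^esub> y))"
          using d(1,2) a(1) c(1) xy trans[of "\<eta> d" "\<eta> c \<otimes>\<^bsub>H\<^esub> y" "\<eta> a \<otimes>\<^bsub>H\<^esub> (x \<otimes>\<^bsub>H\<^esub> y)"]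
            trans[of "\<eta> a \<otimes>\<^bsub>H\<^esub> (x \<otimes>\<^bsub>H\<^esub> y)" "\<eta> c \<otimes>\<^bsub>H\<^esub> y" "\<eta> d"] by simp
        then have "\<rho> (x \<otimes>\<^bsub>H\<^esub> y) (P.cls a) = P.cls d"
          using cls[OF a(1) d(1)] xy by simp
        then show "\<rho> (x \<otimes>\<^bsub>H\<^esub> y) X = (\<rho> x \<otimes>\<^bsub>Aut ?O\<^esub> \<rho> y) X"
          unfolding Aut_simps compose_eq[OF X] unfolding a(2) c(3) d(3) .
      qed (simp_all add: \<rho>_def Aut_simps)
    qed (rule Aut)
    fix x y assume xy: "x \<in> carrier H" "y \<in> carrier H"
    \<comment> \<open>Upper bounds come from \<open>mono\<close>; leastness is checked at each
      point, where \<open>pick\<close> leaves one of two values.\<close>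
    show "\<rho> (gjoin H x y) = gjoin (Aut ?O) (\<rho> x) (\<rho> y)"
    proof (rule P.Aut_Omega.gjoin_eqI[symmetric])
      fix k assume k: "\<rho> x \<preceq>\<^bsub>Aut ?O\<^esub> k" "\<rho> y \<preceq>\<^bsub>Aut ?O\<^esub> k"
      show "\<rho> (gjoin H x y) \<preceq>\<^bsub>Aut ?O\<^esub> k"
        unfolding Aut_simps
      proof
        fix X assume X: "X \<in> carrier ?O"
        show "\<rho> (gjoin H x y) X \<sqsubseteq>\<^bsub>?O\<^esub> k X"
          using pick[OF X xy] k X unfolding Aut_simps by auto
      qed
    qed (use xy in \<open>auto intro!: Aut mono H.gjoin_left H.gjoin_right\<close>)
    show "\<rho> (gmeet H x y) = gmeet (Aut ?O) (\<rho> x) (\<rho> y)"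
    proof (rule P.Aut_Omega.gmeet_eqI[symmetric])
      fix k assume k: "k \<preceq>\<^bsub>Aut ?O\<^esub> \<rho> x" "k \<preceq>\<^bsub>Aut ?O\<^esub> \<rho> y"
      show "k \<preceq>\<^bsub>Aut ?O\<^esub> \<rho> (gmeet H x y)"
        unfolding Aut_simps
      proof
        fix X assume X: "X \<in> carrier ?O"
        show "k X \<sqsubseteq>\<^bsub>?O\<^esub> \<rho> (gmeet H x y) X"
          using pick[OF X xy] k X unfolding Aut_simps by auto
      qed
    qed (use xy in \<open>auto intro!: Aut mono H.gmeet_left H.gmeet_right\<close>)
  qed
  have rt: "\<rho> (\<eta> a) = right_translation G P.cone a" if a: "a \<in> carrier G" for a
  proof (rule extensionalityI)
    fix X assume "X \<in> carrier ?O"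
    then obtain b where b: "b \<in> carrier G" "X = P.cls b" unfolding P.carrier_Omega by blast
    have "\<rho> (\<eta> a) (P.cls b) = P.cls (b \<otimes>\<^bsub>G\<^esub> a)"
      by (rule cls) (use a b refl in simp_all)
    then show "\<rho> (\<eta> a) X = right_translation G P.cone a X"
      unfolding b(2) P.right_translation_cls[OF a b(1)] .
  qed (simp_all add: \<rho>_def right_translation_def)
  \<comment> \<open>The image of \<open>H\<close> is an l-subgroup containing all right
    translations, so it contains the l-subgroup they generate, and the equations transfer from
    \<open>H\<close>.\<close>
  have "P.translations \<subseteq> \<rho> ` carrier H"
  proof (rule P.translations_least)
    show "l_subgroup (\<rho> ` carrier H) (Aut ?O)"
      by (rule l_hom_image_l_subgroup[OF H.l_group_axioms P.Aut_Omega.l_group_axioms hom])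
    show "right_translation G P.cone ` carrier G \<subseteq> \<rho> ` carrier H"
      using rt eta.hom_closed by (auto simp flip: rt)
  qed
  then show ?thesis
    using in_variety_of_image[OF in_variety_H P.H_of_l_group P.Aut_Omega.l_group_axioms hom P.H_of_inclusion]
    unfolding P.carrier_H_of unfolding pre_cone_preorder_of by blast
qed

lemma cone_of_PreOrd: "p \<in> Spec H \<Longrightarrow> cone_of p \<in> PreOrd V G"
  unfolding PreOrd_def
  by (rule CollectI, rule exI[of _ "preorder_of p"])
    (simp add: pre_cone_preorder_of right_preorder_of in_variety_H_of_cone_of)

text \<open>On a chain, a meet moves \<open>w\<close> to the smaller of the two images. If the meet
  is the identity, one of its arguments must fix \<open>w\<close>, which is primeness; properness is
  the assumption that some element moves \<open>w\<close>.\<close>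

lemma Spec_stabilizer:
  assumes L: "chain L" and h: "h \<in> l_hom H (Aut L)" and w: "w \<in> carrier L"
    and moved: "\<exists>x\<in>carrier H. h x w \<noteq> w"
  shows "{x \<in> carrier H. h x w = w} \<in> Spec H" (is "?p \<in> _")
    and "x \<in> carrier H \<Longrightarrow>
      H.coset_le {x \<in> carrier H. h x w = w} \<one>\<^bsub>H\<^esub> x \<longleftrightarrow> w \<sqsubseteq>\<^bsub>L\<^esub> h x w"
proof -
  interpret L: chain L by (rule L)
  interpret A: l_group "Aut L" by (rule L.Aut_l_group)
  interpret h: group_hom H "Aut L" h
    using h by unfold_locales (simp add: l_hom_def)
  have hc: "h x X \<in> carrier L" if "x \<in> carrier H" "X \<in> carrier L" for x X
    using L.Aut_closed[OF h.hom_closed] that by blast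
  have one: "h \<one>\<^bsub>H\<^esub> w = w"
    using w by (simp add: Aut_simps)
  have mult: "h (x \<otimes>\<^bsub>H\<^esub> y) w = h y (h x w)" if "x \<in> carrier H" "y \<in> carrier H" for x y
    using that w by (simp add: Aut_simps compose_eq)
  have join: "h (gjoin H x y) w = (if h x w \<sqsubseteq>\<^bsub>L\<^esub> h y w then h y w else h x w)"
    and meet: "h (gmeet H x y) w = (if h x w \<sqsubseteq>\<^bsub>L\<^esub> h y w then h x w else h y w)"
    if "x \<in> carrier H" "y \<in> carrier H" for x y
    using that h L.Aut_gjoin_apply[OF h.hom_closed h.hom_closed w, of x y] by (simp_all add: l_hom_def)
  have mono: "h x w \<sqsubseteq>\<^bsub>L\<^esub> h y w" if "x \<preceq>\<^bsub>H\<^esub> y" "x \<in> carrier H" "y \<in> carrier H" for x y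
  proof -
    have "h (gmeet H x y) w = h x w" using that by (simp add: H.gmeet_absorb)
    then show ?thesis using meet[OF that(2,3)] hc[OF that(2) w] by (auto split: if_splits)
  qed
  have inv: "h (inv\<^bsub>H\<^esub> x) w = w" if "x \<in> carrier H" "h x w = w" for x
    using mult[of x "inv\<^bsub>H\<^esub> x"] that one by simp
  have "subgroup ?p H"
  proof (rule H.subgroupI)
    show "?p \<noteq> {}" using one by blast
  qed (use mult inv in auto)
  moreover have "gjoin H x y \<in> ?p \<and> gmeet H x y \<in> ?p" if "x \<in> ?p" "y \<in> ?p" for x y
    using that by (simp add: join meet)
  moreover have "x \<in> ?p" if "a \<in> ?p" "b \<in> ?p" "x \<in> carrier H" "a \<preceq>\<^bsub>H\<^esub> x" "x \<preceq>\<^bsub>H\<^esub> b" for a b x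
    using that mono[of a x] mono[of x b] L.le_antisym[OF _ _ hc[OF that(3) w] w] by simp
  ultimately have conv: "convex_l_subgroup ?p H"
    unfolding convex_l_subgroup_def l_subgroup_def by blast
  have "x \<in> ?p \<or> y \<in> ?p"
    if "x \<in> carrier H" "y \<in> carrier H" "gmeet H x y = \<one>\<^bsub>H\<^esub>" for x y
    using that meet[OF that(1,2)] one by (auto split: if_splits)
  moreover have "?p \<noteq> carrier H" using moved by blast
  ultimately show "?p \<in> Spec H" unfolding H.Spec_iff using conv by blast
  show "H.coset_le ?p \<one>\<^bsub>H\<^esub> x \<longleftrightarrow> w \<sqsubseteq>\<^bsub>L\<^esub> h x w" if x: "x \<in> carrier H"
  proof
    assume "H.coset_le ?p \<one>\<^bsub>H\<^esub> x"
    then obtain t where t: "t \<in> carrier H" "h t w = w" "\<one>\<^bsub>H\<^esub> \<preceq>\<^bsub>H\<^esub> t \<otimes>\<^bsub>H\<^esub> x"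
      by (auto simp: H.coset_le_def)
    then show "w \<sqsubseteq>\<^bsub>L\<^esub> h x w"
      using mono[of "\<one>\<^bsub>H\<^esub>" "t \<otimes>\<^bsub>H\<^esub> x"] mult[of t x] one x by simp
  next
    assume le: "w \<sqsubseteq>\<^bsub>L\<^esub> h x w"
    \<comment> \<open>As \<open>x\<close> does not move \<open>w\<close> down, its meet with the
      identity fixes \<open>w\<close>; the inverse of this meet witnesses the coset
      inequality.\<close>
    let ?m = "gmeet H \<one>\<^bsub>H\<^esub> x"
    have "?m \<in> ?p" using le meet[of "\<one>\<^bsub>H\<^esub>" x] one x by simp
    then have "inv\<^bsub>H\<^esub> ?m \<in> ?p" by (rule H.convex_l_subgroup_inv[OF conv])
    moreover have "\<one>\<^bsub>H\<^esub> \<preceq>\<^bsub>H\<^esub> inv\<^bsub>H\<^esub> ?m \<otimes>\<^bsub>H\<^esub> x"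
      using x by (simp add: H.le_mult_inv_iff H.gmeet_right)
    ultimately show "H.coset_le ?p \<one>\<^bsub>H\<^esub> x" unfolding H.coset_le_def by blast
  qed
qed

text \<open>\<open>h (\<eta> a)\<close> carries the class of the identity to that of
  \<open>a\<close>, so \<open>Spec_stabilizer\<close> turns membership in the cone of the stabilizer
  into the condition that \<open>a\<close> lies above the identity, which defines
  \<open>C\<close>.\<close>

lemma PreOrd_cone_of:
  assumes "C \<in> PreOrd V G"
  obtains p where "p \<in> Spec H" "C = cone_of p"
proof -
  obtain R where R: "C = pre_cone G R" "right_preorder G R" "in_variety (H_of G C) V"
    using assms unfolding PreOrd_def by blast
  interpret P: right_preordered_group G R
    by unfold_locales (rule R(2))
  let ?O = "Omega G P.cone"
  let ?w = "P.cls \<one>\<^bsub>G\<^esub>"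
  have "unique_extension G H \<eta> (H_of G P.cone)"
    by (rule free_l_groupD[OF po_group_G free R(3)[unfolded R(1)]])
  then obtain h where "h \<in> l_hom H (H_of G P.cone)"
    and h_eta: "\<And>a. a \<in> carrier G \<Longrightarrow> h (\<eta> a) = right_translation G P.cone a"
    using P.right_translation_H_of unfolding unique_extension_def by metis
  then have h: "h \<in> l_hom H (Aut ?O)"
    using l_hom_comp[OF _ P.H_of_inclusion] by (simp add: comp_def)
  have o: "?w \<in> carrier ?O" unfolding P.carrier_Omega by blast
  have ho: "h (\<eta> a) ?w = P.cls a" if "a \<in> carrier G" for a
    using that P.right_translation_cls[OF that G.one_closed] by (simp add: h_eta)
  \<comment> \<open>If every element fixed the class of the identity, all classes would coincide and
    \<open>R\<close> would be the full relation, which right pre-orders exclude.\<close>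
  have moved: "\<exists>x\<in>carrier H. h x ?w \<noteq> ?w"
  proof (rule ccontr)
    assume "\<not> ?thesis"
    then have "P.cls a = ?w" if "a \<in> carrier G" for a
      using ho[OF that] eta.hom_closed[OF that] by simp
    then have "(a, \<one>\<^bsub>G\<^esub>) \<in> R \<and> (\<one>\<^bsub>G\<^esub>, a) \<in> R" if "a \<in> carrier G" for a
      using P.cls_eq_iff[OF that G.one_closed] that by blast
    then have all: "(a, b) \<in> R" if "a \<in> carrier G" "b \<in> carrier G" for a b
      using P.R_trans[of a "\<one>\<^bsub>G\<^esub>" b] that by simp
    have "R = carrier G \<times> carrier G"
    proof (intro subset_antisym subrelI)
      show "(a, b) \<in> carrier G \<times> carrier G" if "(a, b) \<in> R" for a b
        using P.R_closed[OF that] by simp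
      show "(a, b) \<in> R" if "(a, b) \<in> carrier G \<times> carrier G" for a b
        using all that by simp
    qed
    then show False using R(2) by (simp add: right_preorder_def)
  qed
  note stab = Spec_stabilizer[OF P.Omega_chain h o moved]
  have "cone_of {x \<in> carrier H. h x ?w = ?w} = C"
  proof -
    have "a \<in> cone_of {x \<in> carrier H. h x ?w = ?w} \<longleftrightarrow> a \<in> C" if a: "a \<in> carrier G" for a
    proof -
      have "a \<in> cone_of {x \<in> carrier H. h x ?w = ?w} \<longleftrightarrow> ?w \<sqsubseteq>\<^bsub>?O\<^esub> P.cls a"
        using stab(2)[OF eta.hom_closed[OF a]] a unfolding mem_cone_of ho[OF a] by blast
      also have "\<dots> \<longleftrightarrow> a \<in> C"
        using P.Omega_le_iff[OF G.one_closed a] a unfolding R(1) pre_cone_def by blast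
      finally show ?thesis .
    qed
    moreover have "cone_of p \<subseteq> carrier G" for p by (auto simp: cone_of_def)
    moreover have "C \<subseteq> carrier G" unfolding R(1) pre_cone_def by blast
    ultimately show ?thesis by blast
  qed
  then show thesis using that stab(1) by blast
qed

lemma cone_of_image: "cone_of ` Spec H = PreOrd V G"
  using cone_of_PreOrd PreOrd_cone_of by blast

section \<open>Comparison of the two topologies\<close>

lemma topspace_PreOrd: "topspace (PreOrd_topology V G) = PreOrd V G"
  by (auto simp: PreOrd_topology_def)

lemma openin_PreOrd_basic:
  "a \<in> carrier G \<Longrightarrow> openin (PreOrd_topology V G) {C \<in> PreOrd V G. a \<in> C \<and> inv\<^bsub>G\<^esub> a \<notin> C}"
  unfolding PreOrd_topology_def by (rule topology_generated_by_Basis) blast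

text \<open>The basic open set of \<open>a\<close> expresses that the coset of
  \<open>\<eta> a\<close> lies strictly above \<open>p\<close>; in a total order this is the failure
  of the opposite comparison.\<close>

lemma cone_of_strict_iff:
  assumes p: "p \<in> Spec H" and a: "a \<in> carrier G"
  shows "a \<in> cone_of p \<and> inv\<^bsub>G\<^esub> a \<notin> cone_of p \<longleftrightarrow> \<not> H.coset_le p (\<eta> a) \<one>\<^bsub>H\<^esub>"
  using coset_le_inv_iff[OF p, of "\<eta> a"] H.Spec_coset_le_total[OF p, of "\<one>\<^bsub>H\<^esub>" "\<eta> a"] a
  by (auto simp: mem_cone_of)

lemma cone_of_strict_inv_iff:
  assumes p: "p \<in> Spec H" and a: "a \<in> carrier G"
  shows "inv\<^bsub>G\<^esub> a \<in> cone_of p \<and> inv\<^bsub>G\<^esub> (inv\<^bsub>G\<^esub> a) \<notin> cone_of p \<longleftrightarrow> \<not> H.coset_le p \<one>\<^bsub>H\<^esub> (\<eta> a)"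
  using cone_of_strict_iff[OF p, of "inv\<^bsub>G\<^esub> a"] coset_le_inv_iff[OF p, of "inv\<^bsub>H\<^esub> \<eta> a"] a by simp

theorem homeomorphic_map_cone_of:
  "homeomorphic_map (Spec_topology H) (PreOrd_topology V G) cone_of"
proof -
  let ?X = "Spec_topology H" and ?Y = "PreOrd_topology V G"
  let ?g = "the_inv_into (Spec H) cone_of"
  have gf: "?g (cone_of p) = p" if "p \<in> Spec H" for p
    using the_inv_into_f_f[OF inj_cone_of that] .
  have fg: "?g C \<in> Spec H \<and> cone_of (?g C) = C" if "C \<in> PreOrd V G" for C
  proof -
    obtain p where "p \<in> Spec H" "C = cone_of p" using PreOrd_cone_of[OF \<open>C \<in> PreOrd V G\<close>] .
    then show ?thesis by (simp add: gf)
  qed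
  have "continuous_map ?X ?Y cone_of"
    unfolding PreOrd_topology_def
  proof (rule continuous_on_generated_topo)
    show "cone_of ` topspace ?X \<subseteq> \<Union>(insert (PreOrd V G)
        {{C \<in> PreOrd V G. a \<in> C \<and> inv\<^bsub>G\<^esub> a \<notin> C} |a. a \<in> carrier G})"
      using cone_of_PreOrd by auto
    fix U assume "U \<in> insert (PreOrd V G) {{C \<in> PreOrd V G. a \<in> C \<and> inv\<^bsub>G\<^esub> a \<notin> C} |a. a \<in> carrier G}"
    then consider "U = PreOrd V G"
      | a where "a \<in> carrier G" "U = {C \<in> PreOrd V G. a \<in> C \<and> inv\<^bsub>G\<^esub> a \<notin> C}" by blast
    then show "openin ?X (cone_of -` U \<inter> topspace ?X)"
    proof cases
      case 1
      then have "cone_of -` U \<inter> topspace ?X = topspace ?X" using cone_of_PreOrd by auto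
      then show ?thesis by (simp only: openin_topspace)
    next
      case 2
      \<comment> \<open>The join with the identity has a coset above or equal to \<open>p\<close>,
        so a one-sided comparison becomes membership, and preimages of generating sets are basic
        open sets.\<close>
      have mem: "gjoin H (\<eta> a) \<one>\<^bsub>H\<^esub> \<in> p \<longleftrightarrow> H.coset_le p (\<eta> a) \<one>\<^bsub>H\<^esub>" if p: "p \<in> Spec H" for p
      proof -
        note lp = H.Spec_l_subgroup[OF p]
        let ?j = "gjoin H (\<eta> a) \<one>\<^bsub>H\<^esub>"
        have j: "?j \<in> carrier H" using 2(1) by simp
        have "H.coset_le p \<one>\<^bsub>H\<^esub> ?j"
          using 2(1) by (simp add: H.coset_le_of_le[OF lp] H.gjoin_right)
        then have "?j \<in> p \<longleftrightarrow> H.coset_le p ?j \<one>\<^bsub>H\<^esub>"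
          using H.coset_le_one_both_iff[OF H.Spec_convex[OF p] j] by blast
        then show ?thesis
          using H.gjoin_coset_le_iff[OF lp, of "\<one>\<^bsub>H\<^esub>" "\<eta> a" "\<one>\<^bsub>H\<^esub>"] 2(1)
            H.coset_le_of_le[OF lp, of "\<one>\<^bsub>H\<^esub>" "\<one>\<^bsub>H\<^esub>"] by simp
      qed
      have "cone_of -` U \<inter> topspace ?X = {p \<in> Spec H. gjoin H (\<eta> a) \<one>\<^bsub>H\<^esub> \<notin> p}"
        using cone_of_strict_iff[OF _ 2(1)] mem cone_of_PreOrd unfolding 2(2) by auto
      moreover have "openin ?X {p \<in> Spec H. gjoin H (\<eta> a) \<one>\<^bsub>H\<^esub> \<notin> p}"
        by (rule H.openin_Spec_basic) (use 2(1) in simp)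
      ultimately show ?thesis by (simp only:)
    qed
  qed
  moreover have "continuous_map ?Y ?X ?g"
  proof -
    \<comment> \<open>An element outside a prime has a coset strictly above or strictly below it.
      The split makes the induction work: joins and meets turn each condition into a union or an
      intersection, while the undivided condition is not determined by the two arguments in this
      way.\<close>
    let ?above = "\<lambda>x. {C \<in> PreOrd V G. \<not> H.coset_le (?g C) x \<one>\<^bsub>H\<^esub>}"
    let ?below = "\<lambda>x. {C \<in> PreOrd V G. \<not> H.coset_le (?g C) \<one>\<^bsub>H\<^esub> x}"
    have gS: "?g C \<in> Spec H" if "C \<in> PreOrd V G" for C using fg[OF that] by blast
    have open_x: "openin ?Y (?above x) \<and> openin ?Y (?below x)" if "x \<in> carrier H" for x
      using that
    proof (induction rule: H_induct)
      case (eta a)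
      have "?above (\<eta> a) = {C \<in> PreOrd V G. a \<in> C \<and> inv\<^bsub>G\<^esub> a \<notin> C}"
      proof (rule Collect_cong, rule conj_cong[OF HOL.refl])
        fix C assume "C \<in> PreOrd V G"
        then show "\<not> H.coset_le (?g C) (\<eta> a) \<one>\<^bsub>H\<^esub> \<longleftrightarrow> a \<in> C \<and> inv\<^bsub>G\<^esub> a \<notin> C"
          using cone_of_strict_iff[OF gS eta, of C] fg[of C] by simp
      qed
      moreover have "?below (\<eta> a) = {C \<in> PreOrd V G. inv\<^bsub>G\<^esub> a \<in> C \<and> inv\<^bsub>G\<^esub> (inv\<^bsub>G\<^esub> a) \<notin> C}"
      proof (rule Collect_cong, rule conj_cong[OF HOL.refl])
        fix C assume "C \<in> PreOrd V G"
        then show "\<not> H.coset_le (?g C) \<one>\<^bsub>H\<^esub> (\<eta> a) \<longleftrightarrow> inv\<^bsub>G\<^esub> a \<in> C \<and> inv\<^bsub>G\<^esub> (inv\<^bsub>G\<^esub> a) \<notin> C"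
          using cone_of_strict_inv_iff[OF gS eta, of C] fg[of C] by simp
      qed
      ultimately show ?case
        using openin_PreOrd_basic[OF eta] openin_PreOrd_basic[OF G.inv_closed[OF eta]] by (simp only: simp_thms)
    next
      case (join x y)
      have "?above (gjoin H x y) = ?above x \<union> ?above y"
        using H.gjoin_coset_le_iff[OF H.Spec_l_subgroup[OF gS] H.one_closed join(1,2)] by auto
      moreover have "?below (gjoin H x y) = ?below x \<inter> ?below y"
        using H.Spec_coset_le_gjoin_iff[OF gS H.one_closed join(1,2)] by auto
      ultimately show ?case using join(3,4) by (simp only: openin_Un openin_Int simp_thms)
    next
      case (meet x y)
      have "?above (gmeet H x y) = ?above x \<inter> ?above y"
        using H.Spec_gmeet_coset_le_iff[OF gS H.one_closed meet(1,2)] by auto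
      moreover have "?below (gmeet H x y) = ?below x \<union> ?below y"
        using H.coset_le_gmeet_iff[OF H.Spec_l_subgroup[OF gS] H.one_closed meet(1,2)] by auto
      ultimately show ?case using meet(3,4) by (simp only: openin_Un openin_Int simp_thms)
    qed
    show ?thesis
      unfolding Spec_topology_def
    proof (rule continuous_on_generated_topo)
      show "?g ` topspace ?Y \<subseteq> \<Union>{{p \<in> Spec H. \<not> A \<subseteq> p} |A. A \<subseteq> carrier H}"
        using gS H.topspace_Spec unfolding Spec_topology_def topology_generated_by_topspace
          topspace_PreOrd by blast
      fix U assume "U \<in> {{p \<in> Spec H. \<not> A \<subseteq> p} |A. A \<subseteq> carrier H}"
      then obtain A where A: "A \<subseteq> carrier H" "U = {p \<in> Spec H. \<not> A \<subseteq> p}" by blast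
      have mem: "x \<notin> ?g C \<longleftrightarrow> \<not> H.coset_le (?g C) x \<one>\<^bsub>H\<^esub> \<or> \<not> H.coset_le (?g C) \<one>\<^bsub>H\<^esub> x"
        if "C \<in> PreOrd V G" "x \<in> A" for C x
        using H.coset_le_one_both_iff[OF H.Spec_convex[OF gS[OF that(1)]], of x] A(1) that(2) by blast
      have "?g -` U \<inter> topspace ?Y = (\<Union>x\<in>A. ?above x \<union> ?below x)"
      proof (rule Set.set_eqI)
        fix C
        have "C \<in> ?g -` U \<inter> topspace ?Y \<longleftrightarrow> C \<in> PreOrd V G \<and> (\<exists>x\<in>A. x \<notin> ?g C)"
          using gS[of C] unfolding A(2) topspace_PreOrd by blast
        also have "\<dots> \<longleftrightarrow> C \<in> (\<Union>x\<in>A. ?above x \<union> ?below x)"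
          using mem[of C] by blast
        finally show "C \<in> ?g -` U \<inter> topspace ?Y \<longleftrightarrow> C \<in> (\<Union>x\<in>A. ?above x \<union> ?below x)" .
      qed
      moreover have "openin ?Y (\<Union>x\<in>A. ?above x \<union> ?below x)"
        using open_x A(1) by (intro openin_Union) (auto intro!: openin_Un)
      ultimately show "openin ?Y (?g -` U \<inter> topspace ?Y)" by (simp only:)
    qed
  qed
  ultimately have "homeomorphic_maps ?X ?Y cone_of ?g"
    unfolding homeomorphic_maps_def using gf fg by (simp add: topspace_PreOrd)
  then show ?thesis by (rule homeomorphic_maps_imp_map)
qed

lemma cone_of_minimal_iff:
  assumes "p \<in> Spec H"
  shows "cone_of p \<in> inclusion_minimal (PreOrd V G) \<longleftrightarrow> p \<in> inclusion_minimal (Spec H)"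
  using assms cone_of_subset_iff inj_on_eq_iff[OF inj_cone_of]
  unfolding inclusion_minimal_def cone_of_image[symmetric] by simp

theorem compact_minimal_layer_iff:
  "compact_space (minimal_layer V G) \<longleftrightarrow> compact_space (Min_space H)"
proof -
  have "homeomorphic_map (Min_space H) (minimal_layer V G) cone_of"
    unfolding Min_space_def minimal_layer_def
    by (rule homeomorphic_map_subtopologies_alt[OF homeomorphic_map_cone_of])
      (simp add: cone_of_minimal_iff)
  then show ?thesis
    using homeomorphic_compact_space homeomorphic_map_imp_homeomorphic_space by blast
qed

end

theorem corollary7p2:
  fixes G :: "'g ordered_group" and V :: variety and H :: "'h ordered_group" and \<eta> :: "'g \<Rightarrow> 'h"
  assumes "po_group G"
    and "free_l_group V G H \<eta>"
  shows "(compact_space (minimal_layer V G) \<longleftrightarrow> boolean_subalgebra_Pol (Pol_p H) H) \<and>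
         (compact_space (minimal_layer V G) \<longleftrightarrow> compact_space (Min_space H)) \<and>
         (compact_space (minimal_layer V G) \<longleftrightarrow> positive_cone_complemented H)"
proof -
  interpret free_l_group_over G V H \<eta>
    using assms by (rule free_l_group_over.intro)
  show ?thesis
    unfolding compact_minimal_layer_iff H.compact_Min_iff_complemented
      H.boolean_subalgebra_iff_complemented by simp
qed

end
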